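(* For every $(\theta,\beta)$ with $0\le\theta\le1$ and $0<\beta\le1$, the $C_0$-semigroup of contractions $S(t)=e^{t\mathbb{B}}$ on $\mathcal{H}$ is exponentially stable, i.e. there exist constants $M\ge1$ and $\omega>0$ such that $\|S(t)\|_{\mathcal{L}(\mathcal{H})}\le Me^{-\omega t}$ for all $t\ge0$.
   Context: Let $\Omega\subset\mathbb{R}^n$ be a bounded open set with smooth boundary. $L^2(\Omega)$ is the complex Hilbert space with inner product $\langle\cdot,\cdot\rangle$ and norm $\|\cdot\|$. Let $A=-\Delta$ with domain $D(A)=H^2(\Omega)\cap H^1_0(\Omega)$; it is positive self-adjoint with compact inverse. For $s\in\mathbb{R}$, $A^s$ is the fractional power and $D(A^s)$ carries the norm $\|A^s u\|$ (for $s<0$, $D(A^s)$ is the completion of $L^2(\Omega)$ in this norm, and powers of $A$ are extended to this scale of spaces accordingly); $D(A^0)=L^2(\Omega)$. Fix constants $\alpha,\kappa,\gamma,\delta>0$ and parameters $0\le\theta\le1$, $0<\beta\le1$. The operator $I+\kappa A^\beta$ is extended to an isomorphism $D(A^{\beta/2})\to D(A^{-\beta/2})$ by $\langle (I+\kappa A^\beta)z_1,z_2\rangle_{D(A^{-\beta/2})\times D(A^{\beta/2})}=\langle z_1,z_2\rangle+\kappa\langle A^{\beta/2}z_1,A^{\beta/2}z_2\rangle$. The phase space is $\mathcal{H}=D(A)\times D(A^{1/2})\times D(A^{\beta/2})\times D(A^0)$, whose elements are written $U=(u,v,w,z)$, with the Hilbert norm $\|U\|_{\mathcal{H}}^2=\alpha\|Au\|^2+\alpha\|A^{1/2}v\|^2+\|w\|^2+\kappa\|A^{\beta/2}w\|^2+\|z\|^2$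 (and the corresponding inner product). The operator $\mathbb{B}:D(\mathbb{B})\subset\mathcal{H}\to\mathcal{H}$ is $\mathbb{B}U=\big(w,\ z,\ -(I+\kappa A^\beta)^{-1}(\alpha A^2u+\gamma Az),\ -\alpha Av+\gamma Aw-\delta A^\theta z\big)$ with domain $D(\mathbb{B})=\{U\in\mathcal{H}: (w,z)\in D(A)\times D(A^{1/2}),\ -\alpha A^2u-\gamma Az\in D(A^{-\beta/2}),\ -\alpha v-\delta A^{\theta-1}z\in D(A)\}$. $\mathbb{B}$ generates a $C_0$-semigroup of contractions $S(t)=e^{t\mathbb{B}}$ on $\mathcal{H}$. It is the semigroup associated, via $U=(u,v,u_t,v_t)$, with the system $u_{tt}+\kappa A^\beta u_{tt}+\alpha A^2u+\gamma Av_t=0$, $v_{tt}+\alpha Av-\gamma Au_t+\delta A^\theta v_t=0$ in $\Omega\times(0,\infty)$, with boundary conditions $u=Au=0$, $v=0$ on $\partial\Omega$ and given initial data. *)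

theory Defs
  imports "HOL-Analysis.Analysis"
begin

section \<open>The complex Hilbert space of square-integrable functions\<close>

definition sq_integrable :: "((real ^ 'n) \<Rightarrow> complex) \<Rightarrow> bool" where
  "sq_integrable f \<longleftrightarrow>
     f \<in> borel_measurable lborel \<and> integrable lborel (\<lambda>x. (cmod (f x))\<^sup>2)"

lemma sq_integrable_mult:
  assumes "sq_integrable f" "sq_integrable g"
  shows "integrable lborel (\<lambda>x. f x * cnj (g x))"
proof (rule Bochner_Integration.integrable_bound)
  show "integrable lborel (\<lambda>x. (cmod (f x))\<^sup>2 + (cmod (g x))\<^sup>2)"
    using assms unfolding sq_integrable_def by (intro Bochner_Integration.integrable_add) auto
  have [measurable]: "f \<in> borel_measurable lborel" "g \<in> borel_measurable lborel"
    using assms unfolding sq_integrable_def by auto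
  have "(\<lambda>x. cnj (g x)) \<in> borel_measurable lborel"
    by (rule borel_measurable_continuous_on[OF continuous_on_cnj[OF continuous_on_id]]) auto
  then show "(\<lambda>x. f x * cnj (g x)) \<in> borel_measurable lborel" by measurable
  have "cmod (f x * cnj (g x)) \<le> norm ((cmod (f x))\<^sup>2 + (cmod (g x))\<^sup>2)" for x
  proof -
    have "0 \<le> (cmod (f x) - cmod (g x))\<^sup>2" "0 \<le> (cmod (f x))\<^sup>2 + (cmod (g x))\<^sup>2"
      "0 \<le> cmod (f x) * cmod (g x)" by auto
    then have "cmod (f x) * cmod (g x) \<le> (cmod (f x))\<^sup>2 + (cmod (g x))\<^sup>2"
      unfolding power2_diff by linarith
    then show ?thesis by (simp add: norm_mult)
  qed
  then show "AE x in lborel. cmod (f x * cnj (g x)) \<le> norm ((cmod (f x))\<^sup>2 + (cmod (g x))\<^sup>2)"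
    by simp
qed

lemma sq_integrable_scale: "sq_integrable f \<Longrightarrow> sq_integrable (\<lambda>x. a * f x)"
  unfolding sq_integrable_def by (auto simp: norm_mult power_mult_distrib)

lemma sq_integrable_add:
  assumes "sq_integrable f" "sq_integrable g"
  shows "sq_integrable (\<lambda>x. f x + g x)"
proof -
  have [measurable]: "f \<in> borel_measurable lborel" "g \<in> borel_measurable lborel"
    using assms unfolding sq_integrable_def by auto
  have "integrable lborel (\<lambda>x. (cmod (f x))\<^sup>2 + 2 * Re (f x * cnj (g x)) + (cmod (g x))\<^sup>2)"
    using assms integrable_Re[OF sq_integrable_mult[OF assms]] unfolding sq_integrable_def
    by (intro Bochner_Integration.integrable_add integrable_mult_right) (auto simp del: times_complex.sel)
  moreover have "(cmod (f x + g x))\<^sup>2 =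
      (cmod (f x))\<^sup>2 + 2 * Re (f x * cnj (g x)) + (cmod (g x))\<^sup>2" for x
    unfolding cmod_power2 by (simp add: power2_eq_square algebra_simps)
  ultimately show ?thesis unfolding sq_integrable_def by simp
qed

quotient_type 'n lsq = "(real ^ 'n) \<Rightarrow> complex" / partial:
  "\<lambda>f g. sq_integrable f \<and> sq_integrable g \<and> (AE x in lborel. f x = g x)"
  morphisms rep_lsq abs_lsq
proof (rule part_equivpI)
  show "\<exists>f::(real ^ 'n) \<Rightarrow> complex.
      sq_integrable f \<and> sq_integrable f \<and> (AE x in lborel. f x = f x)"
    by (rule exI[of _ "\<lambda>_. 0"]) (simp add: sq_integrable_def)
qed (auto simp: symp_def transp_def elim: AE_mp)

class scaleC = fixes scaleC :: "complex \<Rightarrow> 'a \<Rightarrow> 'a" (infixr "*\<^sub>C" 75)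

instantiation prod :: (scaleC, scaleC) scaleC
begin
definition "c *\<^sub>C p = (c *\<^sub>C fst p, c *\<^sub>C snd p)"
instance ..
end

instantiation lsq :: (finite) "{ab_group_add, scaleC, scaleR}"
begin
lift_definition zero_lsq :: "'a lsq" is "\<lambda>_. 0" by (simp add: sq_integrable_def)
lift_definition plus_lsq :: "'a lsq \<Rightarrow> 'a lsq \<Rightarrow> 'a lsq" is "\<lambda>f g x. f x + g x"
  by (auto intro: sq_integrable_add)
lift_definition uminus_lsq :: "'a lsq \<Rightarrow> 'a lsq" is "\<lambda>f x. - f x"
  using sq_integrable_scale[of _ "-1"] by auto
lift_definition minus_lsq :: "'a lsq \<Rightarrow> 'a lsq \<Rightarrow> 'a lsq" is "\<lambda>f g x. f x - g x"
proof -
  fix f f' g g' :: "(real ^ 'a) \<Rightarrow> complex"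
  assume "sq_integrable f \<and> sq_integrable f' \<and> (AE x in lborel. f x = f' x)"
    and "sq_integrable g \<and> sq_integrable g' \<and> (AE x in lborel. g x = g' x)"
  then show "sq_integrable (\<lambda>x. f x - g x) \<and> sq_integrable (\<lambda>x. f' x - g' x) \<and>
      (AE x in lborel. f x - g x = f' x - g' x)"
    using sq_integrable_add[of f "\<lambda>x. - 1 * g x"] sq_integrable_add[of f' "\<lambda>x. - 1 * g' x"]
      sq_integrable_scale[of g "-1"] sq_integrable_scale[of g' "-1"] by auto
qed
lift_definition scaleC_lsq :: "complex \<Rightarrow> 'a lsq \<Rightarrow> 'a lsq" is "\<lambda>c f x. c * f x"
  by (auto intro: sq_integrable_scale)
definition scaleR_lsq :: "real \<Rightarrow> 'a lsq \<Rightarrow> 'a lsq" where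
  "scaleR_lsq r f = complex_of_real r *\<^sub>C f"
instance
proof
  fix a b c :: "'a lsq"
  show "a + b + c = a + (b + c)"
    by transfer (auto simp: algebra_simps intro!: sq_integrable_add)
  show "a + b = b + a"
    by transfer (auto simp: algebra_simps intro!: sq_integrable_add)
  show "0 + a = a" by transfer auto
  show "- a + a = 0"
    by transfer (auto simp: sq_integrable_def)
  show "a - b = a + - b"
  proof transfer
    fix f g :: "(real ^ 'a) \<Rightarrow> complex"
    assume "sq_integrable f \<and> sq_integrable f \<and> (AE x in lborel. f x = f x)"
      and "sq_integrable g \<and> sq_integrable g \<and> (AE x in lborel. g x = g x)"
    then show "sq_integrable (\<lambda>x. f x - g x) \<and> sq_integrable (\<lambda>x. f x + - g x) \<and>
        (AE x in lborel. f x - g x = f x + - g x)"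
      using sq_integrable_add[of f "\<lambda>x. - 1 * g x"] sq_integrable_scale[of g "-1"] by auto
  qed
qed
end

lemma scaleC_lsq_simps:
  fixes f g :: "'n::finite lsq"
  shows "a *\<^sub>C (f + g) = a *\<^sub>C f + a *\<^sub>C g"
    and "(a + b) *\<^sub>C f = a *\<^sub>C f + b *\<^sub>C f"
    and "a *\<^sub>C b *\<^sub>C f = (a * b) *\<^sub>C f"
    and "1 *\<^sub>C f = f"
  by (transfer; auto simp: algebra_simps intro!: sq_integrable_add sq_integrable_scale
      sq_integrable_scale[of _ "_ + _", simplified distrib_right])+

instance lsq :: (finite) real_vector
  by standard (simp_all add: scaleR_lsq_def scaleC_lsq_simps)

text \<open>The inner product is linear in its first argument.\<close>

lift_definition cinner :: "'n::finite lsq \<Rightarrow> 'n lsq \<Rightarrow> complex" is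
  "\<lambda>f g. (LINT x|lborel. f x * cnj (g x))"
proof -
  fix f f' g g' :: "(real ^ 'n) \<Rightarrow> complex"
  assume f: "sq_integrable f \<and> sq_integrable f' \<and> (AE x in lborel. f x = f' x)"
    and g: "sq_integrable g \<and> sq_integrable g' \<and> (AE x in lborel. g x = g' x)"
  then have "integrable lborel (\<lambda>x. f x * cnj (g x))" "integrable lborel (\<lambda>x. f' x * cnj (g' x))"
    by (auto intro: sq_integrable_mult)
  moreover have "AE x in lborel. f x * cnj (g x) = f' x * cnj (g' x)"
    using f g by auto
  ultimately show "(LINT x|lborel. f x * cnj (g x)) = (LINT x|lborel. f' x * cnj (g' x))"
    by (intro integral_cong_AE) auto
qed

lemma cinner_add_left: "cinner (f + g) h = cinner f h + cinner g h"
  by transfer (auto simp: distrib_right intro!: Bochner_Integration.integral_add sq_integrable_mult)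

lemma cinner_scaleC_left: "cinner (a *\<^sub>C f) g = a * cinner f g"
  by transfer (simp add: mult.assoc)

lemma cinner_commute: "cinner g f = cnj (cinner f g)"
proof transfer
  fix f g :: "(real ^ 'a) \<Rightarrow> complex"
  show "(LINT x|lborel. g x * cnj (f x)) = cnj (LINT x|lborel. f x * cnj (g x))"
    using Bochner_Integration.integral_cnj[of lborel "\<lambda>x. f x * cnj (g x)"] by (simp add: mult.commute)
qed

lemma cinner_self: "cinner f f = complex_of_real (Re (cinner f f))"
  using cinner_commute[of f f] by (auto simp: complex_eq_iff)

lemma Re_cinner_self_nonneg: "0 \<le> Re (cinner f f)"
proof transfer
  fix f :: "(real ^ 'a) \<Rightarrow> complex"
  have "(LINT x|lborel. f x * cnj (f x)) = complex_of_real (LINT x|lborel. (cmod (f x))\<^sup>2)"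
    by (simp add: complex_norm_square[symmetric] integral_complex_of_real[symmetric]
        del: integral_complex_of_real)
  then show "0 \<le> Re (LINT x|lborel. f x * cnj (f x))" by simp
qed

lemma cinner_self_eq_0: "Re (cinner f f) = 0 \<longleftrightarrow> f = 0"
proof transfer
  fix f :: "(real ^ 'a) \<Rightarrow> complex"
  assume "sq_integrable f \<and> sq_integrable f \<and> (AE x in lborel. f x = f x)"
  then have f: "sq_integrable f" by simp
  have "(LINT x|lborel. f x * cnj (f x)) = complex_of_real (LINT x|lborel. (cmod (f x))\<^sup>2)"
    by (simp add: complex_norm_square[symmetric] integral_complex_of_real[symmetric]
        del: integral_complex_of_real)
  then show "Re (LINT x|lborel. f x * cnj (f x)) = 0 \<longleftrightarrow>
      sq_integrable f \<and> sq_integrable (\<lambda>_::(real ^ 'a). 0) \<and> (AE x in lborel. f x = 0)"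
    using f integral_nonneg_eq_0_iff_AE[of lborel "\<lambda>x. (cmod (f x))\<^sup>2"]
    by (auto simp: sq_integrable_def)
qed

instantiation lsq :: (finite) real_inner
begin
definition inner_lsq :: "'a lsq \<Rightarrow> 'a lsq \<Rightarrow> real" where
  "inner_lsq f g = Re (cinner f g)"
definition norm_lsq :: "'a lsq \<Rightarrow> real" where
  "norm_lsq f = sqrt (inner f f)"
definition sgn_lsq :: "'a lsq \<Rightarrow> 'a lsq" where
  "sgn_lsq f = inverse (norm f) *\<^sub>R f"
definition dist_lsq :: "'a lsq \<Rightarrow> 'a lsq \<Rightarrow> real" where
  "dist_lsq f g = norm (f - g)"
definition uniformity_lsq :: "('a lsq \<times> 'a lsq) filter" where
  "uniformity_lsq = (INF e\<in>{0<..}. principal {(f, g). dist f g < e})"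
definition open_lsq :: "'a lsq set \<Rightarrow> bool" where
  "open_lsq U \<longleftrightarrow> (\<forall>f\<in>U. eventually (\<lambda>(f', g). f' = f \<longrightarrow> g \<in> U) uniformity)"
instance
proof
  fix f g h :: "'a lsq" and r :: real
  show "inner f g = inner g f"
    by (simp add: inner_lsq_def cinner_commute[of f g])
  show "inner (f + g) h = inner f h + inner g h"
    by (simp add: inner_lsq_def cinner_add_left)
  show "inner (r *\<^sub>R f) g = r * inner f g"
    by (simp add: inner_lsq_def scaleR_lsq_def cinner_scaleC_left)
  show "0 \<le> inner f f" "inner f f = 0 \<longleftrightarrow> f = 0"
    by (simp_all add: inner_lsq_def Re_cinner_self_nonneg cinner_self_eq_0)
qed (simp_all add: norm_lsq_def sgn_lsq_def dist_lsq_def uniformity_lsq_def open_lsq_def)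
end

text \<open>Functions on \<open>\<Omega>\<close> are identified with their extensions by zero.\<close>

definition L2 :: "(real ^ 'n) set \<Rightarrow> 'n lsq set" where
  "L2 \<Omega> = {f. AE x in lborel. x \<notin> \<Omega> \<longrightarrow> rep_lsq f x = 0}"


section \<open>Smooth domains, test functions and Sobolev spaces\<close>

definition partial_deriv :: "'n \<Rightarrow> ((real ^ 'n) \<Rightarrow> 'b::real_normed_vector) \<Rightarrow> (real ^ 'n) \<Rightarrow> 'b"
  where "partial_deriv i f x = frechet_derivative f (at x) (axis i 1)"

definition smooth :: "((real ^ 'n) \<Rightarrow> 'b::real_normed_vector) \<Rightarrow> bool" where
  "smooth f \<longleftrightarrow> (\<forall>is x. foldr partial_deriv is f differentiable (at x))"

text \<open>The boundary is smooth if near each of its points the set lies on one side of the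
  zero set of a smooth function without critical points.\<close>

definition smooth_boundary :: "(real ^ 'n) set \<Rightarrow> bool" where
  "smooth_boundary \<Omega> \<longleftrightarrow>
     (\<forall>p\<in>frontier \<Omega>. \<exists>U \<rho>. open U \<and> p \<in> U \<and> smooth \<rho> \<and>
        (\<forall>x\<in>U. \<exists>i. partial_deriv i \<rho> x \<noteq> 0) \<and> \<Omega> \<inter> U = {x\<in>U. \<rho> x < (0::real)})"

definition test_functions :: "(real ^ 'n) set \<Rightarrow> ((real ^ 'n) \<Rightarrow> complex) set" where
  "test_functions \<Omega> = {\<phi>. smooth \<phi> \<and> compact (closure {x. \<phi> x \<noteq> 0}) \<and> closure {x. \<phi> x \<noteq> 0} \<subseteq> \<Omega>}"

definition weak_deriv :: "(real ^ 'n) set \<Rightarrow> 'n \<Rightarrow> 'n lsq \<Rightarrow> 'n lsq \<Rightarrow> bool" where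
  "weak_deriv \<Omega> i u g \<longleftrightarrow> u \<in> L2 \<Omega> \<and> g \<in> L2 \<Omega> \<and>
     (\<forall>\<phi>\<in>test_functions \<Omega>.
        (LINT x:\<Omega>|lborel. rep_lsq u x * partial_deriv i \<phi> x) = - (LINT x:\<Omega>|lborel. rep_lsq g x * \<phi> x))"

definition H1 :: "(real ^ 'n) set \<Rightarrow> 'n lsq set" where
  "H1 \<Omega> = {u. \<forall>i. \<exists>g. weak_deriv \<Omega> i u g}"

definition H2 :: "(real ^ 'n) set \<Rightarrow> 'n lsq set" where
  "H2 \<Omega> = {u. \<forall>i. \<exists>g\<in>H1 \<Omega>. weak_deriv \<Omega> i u g}"

text \<open>\<open>H\<^sub>0\<^sup>1(\<Omega>)\<close> is the closure of the test functions in the norm of \<open>H\<^sup>1(\<Omega>)\<close>.\<close>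

definition H10 :: "(real ^ 'n) set \<Rightarrow> 'n lsq set" where
  "H10 \<Omega> = {u. \<exists>g. (\<forall>i. weak_deriv \<Omega> i u (g i)) \<and>
     (\<forall>\<epsilon>>0. \<exists>\<phi>\<in>test_functions \<Omega>.
        sqrt ((norm (u - abs_lsq \<phi>))\<^sup>2 + (\<Sum>i\<in>UNIV. (norm (g i - abs_lsq (partial_deriv i \<phi>)))\<^sup>2)) < \<epsilon>)}"

definition weak_laplacian :: "(real ^ 'n) set \<Rightarrow> 'n lsq \<Rightarrow> 'n lsq \<Rightarrow> bool" where
  "weak_laplacian \<Omega> u f \<longleftrightarrow>
     (\<exists>g h. (\<forall>i. weak_deriv \<Omega> i u (g i) \<and> weak_deriv \<Omega> i (g i) (h i)) \<and> f = (\<Sum>i\<in>UNIV. h i))"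

text \<open>The graph of \<open>A = -\<Delta>\<close> with domain \<open>H\<^sup>2(\<Omega>) \<inter> H\<^sub>0\<^sup>1(\<Omega>)\<close>.\<close>

definition dirichlet_laplacian :: "(real ^ 'n) set \<Rightarrow> ('n lsq \<times> 'n lsq) set" where
  "dirichlet_laplacian \<Omega> = {(u, f). u \<in> H2 \<Omega> \<inter> H10 \<Omega> \<and> weak_laplacian \<Omega> u (- f)}"


section \<open>The scale of fractional powers\<close>

text \<open>Since \<open>A\<close> is positive self-adjoint with compact inverse, every \<open>u \<in> L\<^sup>2(\<Omega>)\<close> is the sum
  of its components \<open>c \<mu>\<close> in the eigenspaces \<open>ker (A - \<mu>)\<close>, and \<open>A\<^sup>s u\<close> is the sum of
  \<open>\<mu> powr s *\<^sub>R c \<mu>\<close>. For \<open>s < 0\<close> the completion of \<open>L\<^sup>2(\<Omega>)\<close> under \<open>\<parallel>A\<^sup>s u\<parallel>\<close> consists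
  of the families \<open>c\<close> for which \<open>\<mu> powr s * norm (c \<mu>)\<close> is square summable. Elements of the
  scale are therefore represented by their families of components (which vanish off the
  eigenvalues), and \<open>L\<^sup>2(\<Omega>)\<close> is embedded by \<open>components\<close>.\<close>

type_synonym 'n family = "real \<Rightarrow> 'n lsq"

definition eigenspace :: "(real ^ 'n) set \<Rightarrow> real \<Rightarrow> 'n lsq set" where
  "eigenspace \<Omega> \<mu> = {e. (e, \<mu> *\<^sub>R e) \<in> dirichlet_laplacian \<Omega>}"

definition eigen_expansion :: "(real ^ 'n) set \<Rightarrow> 'n lsq \<Rightarrow> 'n family \<Rightarrow> bool" where
  "eigen_expansion \<Omega> u c \<longleftrightarrow> (\<forall>\<mu>. c \<mu> \<in> eigenspace \<Omega> \<mu>) \<and> (c has_sum u) UNIV"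

definition components :: "(real ^ 'n) set \<Rightarrow> 'n lsq \<Rightarrow> 'n family" where
  "components \<Omega> u = (THE c. eigen_expansion \<Omega> u c)"

definition scale_power :: "real \<Rightarrow> 'n::finite family \<Rightarrow> 'n family" where
  "scale_power s c = (\<lambda>\<mu>. \<mu> powr s *\<^sub>R c \<mu>)"

definition scale_space :: "(real ^ 'n) set \<Rightarrow> real \<Rightarrow> 'n family set" where
  "scale_space \<Omega> s = {c. (\<forall>\<mu>. c \<mu> \<in> eigenspace \<Omega> \<mu>) \<and>
     (\<lambda>\<mu>. (norm (scale_power s c \<mu>))\<^sup>2) summable_on UNIV}"

definition family_norm :: "'n::finite family \<Rightarrow> real" where
  "family_norm c = sqrt (\<Sum>\<^sub>\<infinity>\<mu>. (norm (c \<mu>))\<^sup>2)"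

text \<open>The pairing extends the inner product of \<open>L\<^sup>2(\<Omega>)\<close> to \<open>D(A\<^sup>-\<^sup>s) \<times> D(A\<^sup>s)\<close>.\<close>

definition pairing :: "'n::finite family \<Rightarrow> 'n family \<Rightarrow> complex" where
  "pairing c d = (\<Sum>\<^sub>\<infinity>\<mu>. cinner (c \<mu>) (d \<mu>))"

text \<open>For \<open>s \<ge> 0\<close>: the domain of \<open>A\<^sup>s\<close> as a subspace of \<open>L\<^sup>2(\<Omega>)\<close>. Every element of \<open>L\<^sup>2(\<Omega>)\<close>
  has an eigenfunction expansion, so \<open>power_dom \<Omega> 0\<close> is \<open>L\<^sup>2(\<Omega>)\<close> and \<open>power_dom \<Omega> 1\<close>
  is the domain of \<open>A\<close>.\<close>

definition power_dom :: "(real ^ 'n) set \<Rightarrow> real \<Rightarrow> 'n lsq set" where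
  "power_dom \<Omega> s = {u \<in> L2 \<Omega>. \<exists>c\<in>scale_space \<Omega> s. eigen_expansion \<Omega> u c}"

text \<open>\<open>A\<^sup>s u\<close> for \<open>u \<in> L\<^sup>2(\<Omega>)\<close>, as an element of the scale.\<close>

definition A_pow :: "(real ^ 'n) set \<Rightarrow> real \<Rightarrow> 'n lsq \<Rightarrow> 'n family" where
  "A_pow \<Omega> s u = scale_power s (components \<Omega> u)"

definition of_components :: "'n::finite family \<Rightarrow> 'n lsq" where
  "of_components c = (\<Sum>\<^sub>\<infinity>\<mu>. c \<mu>)"


section \<open>The phase space and the operator\<close>

type_synonym 'n state = "'n lsq \<times> 'n lsq \<times> 'n lsq \<times> 'n lsq"

definition phase_space :: "(real ^ 'n) set \<Rightarrow> real \<Rightarrow> 'n state set" where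
  "phase_space \<Omega> \<beta> = power_dom \<Omega> 1 \<times> power_dom \<Omega> (1/2) \<times> power_dom \<Omega> (\<beta>/2) \<times> power_dom \<Omega> 0"

definition phase_norm :: "(real ^ 'n) set \<Rightarrow> real \<Rightarrow> real \<Rightarrow> real \<Rightarrow> 'n state \<Rightarrow> real" where
  "phase_norm \<Omega> \<alpha> \<kappa> \<beta> = (\<lambda>(u, v, w, z).
     sqrt (\<alpha> * (family_norm (A_pow \<Omega> 1 u))\<^sup>2 + \<alpha> * (family_norm (A_pow \<Omega> (1/2) v))\<^sup>2
       + (norm w)\<^sup>2 + \<kappa> * (family_norm (A_pow \<Omega> (\<beta>/2) w))\<^sup>2 + (norm z)\<^sup>2))"

text \<open>The isomorphism \<open>I + \<kappa> A\<^sup>\<beta>\<close> from \<open>D(A\<^sup>\<beta>\<^sup>/\<^sup>2)\<close> onto \<open>D(A\<^sup>-\<^sup>\<beta>\<^sup>/\<^sup>2)\<close>.\<close>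

definition inertia :: "(real ^ 'n) set \<Rightarrow> real \<Rightarrow> real \<Rightarrow> 'n lsq \<Rightarrow> 'n family" where
  "inertia \<Omega> \<kappa> \<beta> z1 = (THE f. f \<in> scale_space \<Omega> (-\<beta>/2) \<and>
     (\<forall>z2\<in>power_dom \<Omega> (\<beta>/2). pairing f (components \<Omega> z2) =
        cinner z1 z2 + complex_of_real \<kappa> * pairing (A_pow \<Omega> (\<beta>/2) z1) (A_pow \<Omega> (\<beta>/2) z2)))"

definition B_dom :: "(real ^ 'n) set \<Rightarrow> real \<Rightarrow> real \<Rightarrow> real \<Rightarrow> real \<Rightarrow> real \<Rightarrow> 'n state set" where
  "B_dom \<Omega> \<alpha> \<gamma> \<delta> \<theta> \<beta> = {(u, v, w, z) \<in> phase_space \<Omega> \<beta>.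
     w \<in> power_dom \<Omega> 1 \<and> z \<in> power_dom \<Omega> (1/2) \<and>
     (\<lambda>\<mu>. - \<alpha> *\<^sub>R A_pow \<Omega> 2 u \<mu> - \<gamma> *\<^sub>R A_pow \<Omega> 1 z \<mu>) \<in> scale_space \<Omega> (-\<beta>/2) \<and>
     (\<lambda>\<mu>. - \<alpha> *\<^sub>R components \<Omega> v \<mu> - \<delta> *\<^sub>R A_pow \<Omega> (\<theta> - 1) z \<mu>) \<in> scale_space \<Omega> 1}"

definition B_op :: "(real ^ 'n) set \<Rightarrow> real \<Rightarrow> real \<Rightarrow> real \<Rightarrow> real \<Rightarrow> real \<Rightarrow> real \<Rightarrow> 'n state \<Rightarrow> 'n state" where
  "B_op \<Omega> \<alpha> \<kappa> \<gamma> \<delta> \<theta> \<beta> = (\<lambda>(u, v, w, z).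
     (w, z,
      - inv_into (power_dom \<Omega> (\<beta>/2)) (inertia \<Omega> \<kappa> \<beta>)
          (\<lambda>\<mu>. \<alpha> *\<^sub>R A_pow \<Omega> 2 u \<mu> + \<gamma> *\<^sub>R A_pow \<Omega> 1 z \<mu>),
      of_components
          (\<lambda>\<mu>. - \<alpha> *\<^sub>R A_pow \<Omega> 1 v \<mu> + \<gamma> *\<^sub>R A_pow \<Omega> 1 w \<mu> - \<delta> *\<^sub>R A_pow \<Omega> \<theta> z \<mu>)))"


section \<open>Semigroups on a normed subspace\<close>

text \<open>The carrier \<open>X\<close> of the phase space and its norm \<open>N\<close> depend on parameters, so they are
  explicit arguments here instead of coming from the type.\<close>

definition c0_contraction_semigroup ::
  "'a::{real_vector,scaleC} set \<Rightarrow> ('a \<Rightarrow> real) \<Rightarrow> (real \<Rightarrow> 'a \<Rightarrow> 'a) \<Rightarrow> bool" where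
  "c0_contraction_semigroup X N S \<longleftrightarrow>
     (\<forall>t\<ge>0. \<forall>x\<in>X. S t x \<in> X \<and> N (S t x) \<le> N x) \<and>
     (\<forall>t\<ge>0. \<forall>x\<in>X. \<forall>y\<in>X. \<forall>c. S t (x + y) = S t x + S t y \<and> S t (c *\<^sub>C x) = c *\<^sub>C S t x) \<and>
     (\<forall>x\<in>X. S 0 x = x) \<and>
     (\<forall>s\<ge>0. \<forall>t\<ge>0. \<forall>x\<in>X. S (s + t) x = S s (S t x)) \<and>
     (\<forall>x\<in>X. ((\<lambda>t. N (S t x - x)) \<longlongrightarrow> 0) (at_right 0))"

definition has_generator ::
  "'a::real_vector set \<Rightarrow> ('a \<Rightarrow> real) \<Rightarrow> (real \<Rightarrow> 'a \<Rightarrow> 'a) \<Rightarrow> 'a set \<Rightarrow> ('a \<Rightarrow> 'a) \<Rightarrow> bool" where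
  "has_generator X N S D G \<longleftrightarrow>
     (\<forall>x\<in>X. \<forall>y\<in>X. ((\<lambda>h. N ((1 / h) *\<^sub>R (S h x - x) - y)) \<longlongrightarrow> 0) (at_right 0)
        \<longleftrightarrow> x \<in> D \<and> y = G x)"

definition operator_norm :: "'a set \<Rightarrow> ('a \<Rightarrow> real) \<Rightarrow> ('a \<Rightarrow> 'a) \<Rightarrow> real" where
  "operator_norm X N T = Sup {N (T x) | x. x \<in> X \<and> N x \<le> 1}"

definition exponentially_stable ::
  "'a set \<Rightarrow> ('a \<Rightarrow> real) \<Rightarrow> (real \<Rightarrow> 'a \<Rightarrow> 'a) \<Rightarrow> bool" where
  "exponentially_stable X N S \<longleftrightarrow>
     (\<exists>M \<omega>. M \<ge> 1 \<and> \<omega> > 0 \<and> (\<forall>t\<ge>0. operator_norm X N (S t) \<le> M * exp (- \<omega> * t)))"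

end

theory Submission
  imports Defs
begin

text \<open>On an eigenspace of \<open>A\<close>, in coordinates in which the phase norm is Euclidean, the equations become
  \<open>U' = p W\<close>, \<open>V' = s Z\<close>, \<open>W' = - p U - q Z\<close>, \<open>Z' = - s V + q W - d Z\<close>, where only \<open>Z\<close> is damped and
  \<open>a = p / q\<close> does not depend on the eigenvalue. Adding small multiples of \<open>- W Z / q\<close>, \<open>U W / (4 a q)\<close> and
  \<open>V Z / s\<close> to the energy makes \<open>W\<close>, \<open>U\<close> and \<open>V\<close> dissipate; the indefinite \<open>V W\<close> terms that arise are
  cancelled exactly by a multiple of \<open>U V\<close>. As \<open>s\<^sup>2\<close> and \<open>d\<close> are \<open>O(q\<^sup>2)\<close> and \<open>d\<close> is \<open>O(s\<^sup>2)\<close>, the decay rate is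
  uniform in the eigenvalue. On a single mode the semigroup is the limit of Euler's method, which inherits
  the decay of the Lyapunov function, and orthogonality of the modes gives the estimate on the dense
  subspace of finite sums of modes.\<close>

section \<open>Uniform decay of a single mode\<close>

text \<open>The spectrum is unbounded, so no norm of the generator serves for all modes at once. For
  a fixed mode the quadratic error of an Euler step enters the exponent only as a multiple of 1 / n,
  where n is the number of steps; however large the multiple, it vanishes in the limit before modes
  are combined. The rate survives because it depends only on lower bounds for the coefficients and
  on ratios that stay bounded: with \<beta> \<le> 1 the effective coupling \<open>q\<^sup>2\<close>
  grows at least like the eigenvalue, and with \<theta> \<le> 1 the damping grows at most like it.
  Eigenspaces may have dimension above one, and no eigenbasis is chosen. Mode coordinates are real
  numbers multiplying one eigenvector, complex or not, whereas the four entries of a state have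
  unrelated components in an eigenspace. Splitting a state into its four entries brings each part
  into the required form, at the price of the factor 4 that turns the constant 2 for finite sums of
  modes into 8.\<close>

type_synonym mode = "real \<times> real \<times> real \<times> real"

text \<open>In terms of the eigenvalue \<mu> the coefficients will be \<open>p = sqrt \<alpha> *
  \<mu> / sqrt (1 + \<kappa> * \<mu> powr \<beta>)\<close>, \<open>q = \<gamma> * \<mu> / sqrt (1 +
  \<kappa> * \<mu> powr \<beta>)\<close>, \<open>s = sqrt \<alpha> * sqrt \<mu>\<close> and
  \<open>d = \<delta> * \<mu> powr \<theta>\<close>. Apart from \<open>d\<close> the matrix is
  skew-symmetric.\<close>

definition mode_gen :: "real \<Rightarrow> real \<Rightarrow> real \<Rightarrow> real \<Rightarrow> mode \<Rightarrow> mode" where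
  "mode_gen p q s d = (\<lambda>(U, V, W, Z). (p * W, s * Z, - p * U - q * Z, - s * V + q * W - d * Z))"

text \<open>The coefficient of \<open>U * V\<close> is forced: \<open>- W * Z / q\<close> and
  \<open>V * Z / s\<close> contribute \<open>(s / q + q / s) * V * W\<close> to the derivative,
  while \<open>U * V\<close> contributes \<open>a * q * V * W\<close>. The factor 1/4 in the
  \<open>U * W\<close> term leaves three quarters of the \<open>W\<^sup>2\<close> gained from
  \<open>- W * Z / q\<close>.\<close>

definition lyapunov :: "real \<Rightarrow> real \<Rightarrow> real \<Rightarrow> real \<Rightarrow> mode \<Rightarrow> real" where
  "lyapunov r a q s = (\<lambda>(U, V, W, Z). U\<^sup>2 + V\<^sup>2 + W\<^sup>2 + Z\<^sup>2
     + 2 * r * (- W * Z / q + U * W / (4 * a * q) + V * Z / s - (1 / s + s / q\<^sup>2) / a * U * V))"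

text \<open>Minus half the derivative of \<open>lyapunov r a q s\<close> along the flow with
  \<open>p = a * q\<close>, after the \<open>V * W\<close> terms have cancelled.\<close>

definition dissipation :: "real \<Rightarrow> real \<Rightarrow> real \<Rightarrow> real \<Rightarrow> real \<Rightarrow> mode \<Rightarrow> real" where
  "dissipation r a q s d = (\<lambda>(U, V, W, Z). d * Z\<^sup>2 + r * (3/4 * W\<^sup>2 + 1/4 * U\<^sup>2 + V\<^sup>2 - 2 * Z\<^sup>2
     - (a - 1 / (4 * a) - (1 + s\<^sup>2 / q\<^sup>2) / a) * U * Z - d / q * Z * W + d / s * Z * V))"

lemma norm_mode: "(norm ((U, V, W, Z) :: mode))\<^sup>2 = U\<^sup>2 + V\<^sup>2 + W\<^sup>2 + Z\<^sup>2"
  by (simp add: norm_prod_def)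

lemma linear_mode_gen: "linear (mode_gen p q s d)"
  by (rule linearI) (auto simp: mode_gen_def algebra_simps)

text \<open>A quadratic form expands exactly over one Euler step: the linear term in
  \<open>h\<close> is the derivative along the flow, the quadratic one is the form at the increment,
  and no remainder has to be estimated.\<close>

lemma lyapunov_euler_step:
  assumes "a \<noteq> 0" "q \<noteq> 0" "s \<noteq> 0"
  shows "lyapunov r a q s (Y + h *\<^sub>R mode_gen (a * q) q s d Y) =
    lyapunov r a q s Y - 2 * h * dissipation r a q s d Y + h\<^sup>2 * lyapunov r a q s (mode_gen (a * q) q s d Y)"
proof -
  obtain U V W Z where Y: "Y = (U, V, W, Z)" by (cases Y)
  \<comment> \<open>With the reciprocals as new variables, tied to the old ones by polynomial
    relations, the claim becomes a polynomial identity modulo these relations.\<close>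
  define A where "A = inverse a"
  define Q where "Q = inverse q"
  define T where "T = inverse s"
  have *: "A * a = 1" "Q * q = 1" "T * s = 1" using assms by (simp_all add: A_def Q_def T_def)
  have **: "1 / (4 * a) = A / 4" "x / a = x * A" "x / q = x * Q" "x / s = x * T" "x / (4 * a * q) = x * A * Q / 4"
    "x / q\<^sup>2 = x * Q\<^sup>2" for x
    using assms by (simp_all add: A_def Q_def T_def field_simps)
  show ?thesis
    unfolding Y lyapunov_def dissipation_def mode_gen_def prod.case scaleR_prod_def plus_prod_def fst_conv snd_conv ** real_scaleR_def
    using * by algebra
qed

lemma abs_mult_le_sum_squares: "\<bar>x * y\<bar> \<le> x\<^sup>2 + (y::real)\<^sup>2"
proof -
  have "0 \<le> (\<bar>x\<bar> - \<bar>y\<bar>)\<^sup>2" "0 \<le> \<bar>x\<bar> * \<bar>y\<bar>" by simp_all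
  then show ?thesis unfolding power2_diff power2_abs abs_mult by linarith
qed

text \<open>Every cross term is at most the energy times its coefficient, and each coefficient has a
  bound in \<open>a\<close>, \<open>q0\<close>, \<open>s0\<close> and \<open>C\<close> alone. The
  condition on \<open>r\<close> then keeps the sum of the cross terms within half of the energy,
  whatever the frequency.\<close>

lemma lyapunov_bounds:
  assumes "0 < a" "0 < q0" "q0 \<le> q" "0 < s0" "s0 \<le> s" "s\<^sup>2 \<le> C * q\<^sup>2" "0 \<le> r"
    and r: "r * (1 / q0 + 1 / (4 * a * q0) + 1 / s0 + (1 + C) / (a * s0)) \<le> 1/4"
  shows "(norm Y)\<^sup>2 / 2 \<le> lyapunov r a q s Y" "lyapunov r a q s Y \<le> 2 * (norm Y)\<^sup>2"
proof -
  obtain U V W Z where Y: "Y = (U, V, W, Z)" by (cases Y)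
  let ?E = "U\<^sup>2 + V\<^sup>2 + W\<^sup>2 + Z\<^sup>2"
  have pos: "0 < q" "0 < s" using assms by auto
  have "0 < s\<^sup>2" "0 < q\<^sup>2" using pos by simp_all
  then have C: "0 \<le> C" using assms(6) by (smt (verit) mult_nonpos_nonneg)
  have x: "\<bar>U * W\<bar> \<le> ?E" "\<bar>W * Z\<bar> \<le> ?E" "\<bar>V * Z\<bar> \<le> ?E" "\<bar>U * V\<bar> \<le> ?E"
    by (auto intro!: order_trans[OF abs_mult_le_sum_squares])
  have E: "0 \<le> ?E" by simp
  have b1: "\<bar>W * Z / q\<bar> \<le> ?E * (1 / q0)"
  proof -
    have "\<bar>W * Z / q\<bar> = \<bar>W * Z\<bar> * (1 / q)" using pos by (simp add: abs_mult)
    also have "\<dots> \<le> ?E * (1 / q0)" using assms pos x E by (intro mult_mono) (auto simp: frac_le)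
    finally show ?thesis .
  qed
  have b2: "\<bar>U * W / (4 * a * q)\<bar> \<le> ?E * (1 / (4 * a * q0))"
  proof -
    have "\<bar>U * W / (4 * a * q)\<bar> = \<bar>U * W\<bar> * (1 / (4 * a * q))" using pos assms by (simp add: abs_mult)
    also have "\<dots> \<le> ?E * (1 / (4 * a * q0))" using assms pos x E by (intro mult_mono) (auto intro!: frac_le)
    finally show ?thesis .
  qed
  have b3: "\<bar>V * Z / s\<bar> \<le> ?E * (1 / s0)"
  proof -
    have "\<bar>V * Z / s\<bar> = \<bar>V * Z\<bar> * (1 / s)" using pos by (simp add: abs_mult)
    also have "\<dots> \<le> ?E * (1 / s0)" using assms pos x E by (intro mult_mono) (auto simp: frac_le)
    finally show ?thesis .
  qed
  have l: "0 \<le> (1 / s + s / q\<^sup>2) / a" using pos assms by simp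
  \<comment> \<open>For fixed \<open>q\<close> this coefficient grows with \<open>s\<close>; the
    bound on the ratio of \<open>s\<close> and \<open>q\<close> turns it into a multiple of
    \<open>1 / s\<close>.\<close>
  have "s / q\<^sup>2 = s\<^sup>2 / (q\<^sup>2 * s)" using pos by (simp add: power2_eq_square)
  also have "\<dots> \<le> C * q\<^sup>2 / (q\<^sup>2 * s)" using pos assms by (intro divide_right_mono) auto
  also have "\<dots> = C / s" using pos by simp
  finally have "1 / s + s / q\<^sup>2 \<le> (1 + C) / s" by (simp add: add_divide_distrib)
  also have "\<dots> \<le> (1 + C) / s0" using C assms by (intro divide_left_mono) auto
  finally have "(1 / s + s / q\<^sup>2) / a \<le> (1 + C) / s0 / a" using assms by (intro divide_right_mono) auto
  then have l2: "(1 / s + s / q\<^sup>2) / a \<le> (1 + C) / (a * s0)" by (simp add: mult.commute)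
  have b4: "\<bar>(1 / s + s / q\<^sup>2) / a * U * V\<bar> \<le> ?E * ((1 + C) / (a * s0))"
  proof -
    have "\<bar>(1 / s + s / q\<^sup>2) / a * U * V\<bar> = \<bar>U * V\<bar> * ((1 / s + s / q\<^sup>2) / a)"
      using l unfolding abs_mult[of _ V] abs_mult[of _ U] abs_mult[of U] by (simp only: mult_ac abs_of_nonneg)
    also have "\<dots> \<le> ?E * ((1 + C) / (a * s0))" using l l2 x(4) E by (intro mult_mono) auto
    finally show ?thesis .
  qed
  let ?F = "- W * Z / q + U * W / (4 * a * q) + V * Z / s - (1 / s + s / q\<^sup>2) / a * U * V"
  have "\<bar>?F\<bar> \<le> \<bar>W * Z / q\<bar> + \<bar>U * W / (4 * a * q)\<bar> + \<bar>V * Z / s\<bar> + \<bar>(1 / s + s / q\<^sup>2) / a * U * V\<bar>"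
    by (simp add: abs_if)
  also have "\<dots> \<le> ?E * (1 / q0 + 1 / (4 * a * q0) + 1 / s0 + (1 + C) / (a * s0))"
    using b1 b2 b3 b4 by (simp only: distrib_left)
  finally have "r * \<bar>?F\<bar> \<le> r * (?E * (1 / q0 + 1 / (4 * a * q0) + 1 / s0 + (1 + C) / (a * s0)))"
    using assms by (intro mult_left_mono) auto
  also have "\<dots> = ?E * (r * (1 / q0 + 1 / (4 * a * q0) + 1 / s0 + (1 + C) / (a * s0)))"
    by (simp only: mult_ac)
  also have "\<dots> \<le> ?E * (1/4)" using r E by (rule mult_left_mono)
  finally have F: "\<bar>r * ?F\<bar> \<le> ?E / 4" using assms by (simp add: abs_mult)
  have ends: "\<bar>f\<bar> \<le> e / 4 \<Longrightarrow> 0 \<le> e \<Longrightarrow> e / 2 \<le> e + 2 * f \<and> e + 2 * f \<le> 2 * e" for e f :: real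
    by linarith
  have L: "lyapunov r a q s Y = ?E + 2 * (r * ?F)" unfolding lyapunov_def Y by (simp only: prod.case mult.assoc)
  have Y2: "(norm Y)\<^sup>2 = ?E" unfolding Y by (rule norm_mode)
  show "(norm Y)\<^sup>2 / 2 \<le> lyapunov r a q s Y" "lyapunov r a q s Y \<le> 2 * (norm Y)\<^sup>2"
    unfolding L Y2 using ends[OF F E] by blast+
qed

text \<open>Young's inequality leaves at least one eighth of \<open>U\<^sup>2\<close>,
  \<open>V\<^sup>2\<close> and \<open>W\<^sup>2\<close> and moves the rest onto
  \<open>Z\<^sup>2\<close>. As \<open>d\<close> may grow along the spectrum, the terms with
  \<open>d / q\<close> and \<open>d / s\<close> cannot be absorbed by a constant: the squares of
  these ratios are at most \<open>C * d\<close>, so for small \<open>r\<close> they cost only a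
  fraction of the damping \<open>d * Z\<^sup>2\<close> itself.\<close>

lemma dissipation_lower_bound:
  assumes "0 < a" "0 < q" "0 < s" "s\<^sup>2 \<le> C * q\<^sup>2" "0 < d0" "d0 \<le> d" "d \<le> C * q\<^sup>2" "d \<le> C * s\<^sup>2" "0 \<le> r"
    and r: "r * (1/4 + (2 + 2 * (a + 1 / (4 * a) + (1 + C) / a)\<^sup>2) + 2 * C * d0) \<le> d0 / 2"
      "r * C \<le> 1/4"
  shows "r / 8 * (norm Y)\<^sup>2 \<le> dissipation r a q s d Y"
proof -
  obtain U V W Z where Y: "Y = (U, V, W, Z)" by (cases Y)
  define g where "g = a - 1 / (4 * a) - (1 + s\<^sup>2 / q\<^sup>2) / a"
  define G where "G = a + 1 / (4 * a) + (1 + C) / a"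
  have "s\<^sup>2 / q\<^sup>2 \<le> C" using assms by (simp add: divide_le_eq)
  then have "(1 + s\<^sup>2 / q\<^sup>2) / a \<le> (1 + C) / a" using assms by (intro divide_right_mono) auto
  moreover have "0 \<le> (1 + s\<^sup>2 / q\<^sup>2) / a" "0 \<le> 1 / (4 * a)" using assms by auto
  ultimately have "\<bar>g\<bar> \<le> G" using assms unfolding g_def G_def by linarith
  then have gG: "g\<^sup>2 \<le> G\<^sup>2" by (metis abs_ge_zero power2_abs power_mono)
  have sq: "x * y \<le> x\<^sup>2 / 8 + 2 * y\<^sup>2" "x * y \<le> x\<^sup>2 / 4 + y\<^sup>2" "- (x * y) \<le> x\<^sup>2 / 4 + y\<^sup>2" for x y :: real
    using zero_le_power2[of "x / 2 - 2 * y"] zero_le_power2[of "x / 2 - y"] zero_le_power2[of "x / 2 + y"]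
    by (simp_all add: power2_diff power2_sum power_divide power_mult_distrib)
  have c1: "g * U * Z \<le> U\<^sup>2 / 8 + 2 * G\<^sup>2 * Z\<^sup>2"
  proof -
    have "g * U * Z \<le> U\<^sup>2 / 8 + 2 * (g * Z)\<^sup>2" using sq(1)[of U "g * Z"] by (simp add: mult_ac)
    moreover have "g\<^sup>2 * Z\<^sup>2 \<le> G\<^sup>2 * Z\<^sup>2" using gG by (intro mult_right_mono) auto
    ultimately show ?thesis by (simp add: power_mult_distrib)
  qed
  have dd: "(d / q)\<^sup>2 \<le> C * d" "(d / s)\<^sup>2 \<le> C * d"
    using assms mult_left_mono[of d "C * q\<^sup>2" d] mult_left_mono[of d "C * s\<^sup>2" d]
    by (simp_all add: power_divide divide_le_eq power2_eq_square mult_ac)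
  have c: "e * Z * W \<le> W\<^sup>2 / 4 + C * d * Z\<^sup>2" "- (e * Z * W) \<le> W\<^sup>2 / 4 + C * d * Z\<^sup>2"
    if "e\<^sup>2 \<le> C * d" for e W
  proof -
    have "(e * Z)\<^sup>2 \<le> C * d * Z\<^sup>2"
      unfolding power_mult_distrib using that by (rule mult_right_mono) simp
    then show "e * Z * W \<le> W\<^sup>2 / 4 + C * d * Z\<^sup>2" "- (e * Z * W) \<le> W\<^sup>2 / 4 + C * d * Z\<^sup>2"
      using sq(2,3)[of W "e * Z"] by (simp_all add: mult.commute)
  qed
  note c2 = c(1)[OF dd(1), of W] and c3 = c(2)[OF dd(2), of V]
  have "U\<^sup>2 / 8 + V\<^sup>2 / 8 + W\<^sup>2 / 8 - (2 + 2 * G\<^sup>2 + 2 * C * d) * Z\<^sup>2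
     \<le> 3/4 * W\<^sup>2 + 1/4 * U\<^sup>2 + V\<^sup>2 - 2 * Z\<^sup>2 - g * U * Z - d / q * Z * W + d / s * Z * V"
    using c1 c2 c3 zero_le_power2[of V] zero_le_power2[of W] unfolding distrib_right by linarith
  from mult_left_mono[OF this assms(9)]
  have 1: "dissipation r a q s d Y \<ge> d * Z\<^sup>2 + r * (U\<^sup>2 / 8 + V\<^sup>2 / 8 + W\<^sup>2 / 8 - (2 + 2 * G\<^sup>2 + 2 * C * d) * Z\<^sup>2)"
    unfolding dissipation_def Y by (simp add: g_def)
  \<comment> \<open>Half of \<open>d\<close> pays for the term \<open>2 * C * d\<close>, through
    \<open>r * C \<le> 1/4\<close>; the other half pays for the terms that do not grow with
    \<open>d\<close>, through \<open>d0 \<le> d\<close>.\<close>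
  have "r / 8 + r * (2 + 2 * G\<^sup>2 + 2 * C * d) \<le> d"
  proof -
    have "r * (2 * C * d) = (r * C) * (2 * d)" by simp
    also have "\<dots> \<le> 1/4 * (2 * d)" using assms r by (intro mult_right_mono) auto
    finally have "r * (2 * C * d) \<le> d / 2" by simp
    moreover have "0 \<le> C"
    proof -
      have "0 < s\<^sup>2" "0 < q\<^sup>2" using assms by simp_all
      then show ?thesis using assms(4) by (smt (verit) mult_nonpos_nonneg)
    qed
    moreover from this have "0 \<le> r * (2 * C * d0)" using assms(5,9) by simp
    ultimately show ?thesis using r(1) assms(5,6,9)
      unfolding G_def[symmetric] distrib_left by linarith
  qed
  from mult_right_mono[OF this, of "Z\<^sup>2"] 1 show ?thesis
    unfolding Y norm_mode by (simp add: algebra_simps)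
qed

text \<open>The coefficients of the multipliers in the Lyapunov function scale like \<open>r / q\<close> and \<open>r / s\<close>,
  which makes the decay rate independent of the frequency.\<close>

lemma mode_euler_decay:
  assumes "0 < a" "0 < q0" "0 < s0" "0 < d0" "0 < C"
  obtains \<omega> where "0 < \<omega>"
    "\<And>q s d. \<lbrakk>q0 \<le> q; s0 \<le> s; d0 \<le> d; s\<^sup>2 \<le> C * q\<^sup>2; d \<le> C * q\<^sup>2; d \<le> C * s\<^sup>2\<rbrakk> \<Longrightarrow>
       \<exists>K. \<forall>h\<ge>0. \<forall>k Y. (norm (((\<lambda>Y. Y + h *\<^sub>R mode_gen (a * q) q s d Y) ^^ k) Y))\<^sup>2
          \<le> 4 * exp (real k * (- 2 * \<omega> * h + K * h\<^sup>2)) * (norm Y)\<^sup>2"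
proof -
  define c1 where "c1 = 1 / q0 + 1 / (4 * a * q0) + 1 / s0 + (1 + C) / (a * s0)"
  define c2 where "c2 = 1/4 + (2 + 2 * (a + 1 / (4 * a) + (1 + C) / a)\<^sup>2) + 2 * C * d0"
  have c: "0 < c1" "0 < c2" unfolding c1_def c2_def using assms by (auto intro!: add_pos_pos add_pos_nonneg)
  \<comment> \<open>The first entry is what \<open>lyapunov_bounds\<close> demands, the other two
    are what \<open>dissipation_lower_bound\<close> demands. None involves \<open>q\<close>,
    \<open>s\<close> or \<open>d\<close>.\<close>
  define r where "r = min (min (1 / (4 * c1)) (d0 / (2 * c2))) (1 / (4 * C))"
  have r: "0 < r" using c assms by (auto simp: r_def)
  have "r \<le> 1 / (4 * c1)" "r \<le> d0 / (2 * c2)" "r \<le> 1 / (4 * C)" by (auto simp: r_def)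
  then have rc: "r * c1 \<le> 1/4" "r * c2 \<le> d0 / 2" "r * C \<le> 1/4"
    using c assms by (simp_all add: pos_le_divide_eq mult_ac)
  show thesis
  \<comment> \<open>The dissipation is at least \<open>r / 8\<close> times the squared norm, and the
    Lyapunov function at most twice the squared norm.\<close>
  proof (rule that[of "r / 16"])
    show "0 < r / 16" using r by simp
    fix q s d assume h: "q0 \<le> q" "s0 \<le> s" "d0 \<le> d" "s\<^sup>2 \<le> C * q\<^sup>2" "d \<le> C * q\<^sup>2" "d \<le> C * s\<^sup>2"
    let ?M = "mode_gen (a * q) q s d" and ?L = "lyapunov r a q s"
    have b: "(norm Y)\<^sup>2 / 2 \<le> ?L Y" "?L Y \<le> 2 * (norm Y)\<^sup>2" for Y
      using lyapunov_bounds[OF assms(1,2) h(1) assms(3) h(2,4) less_imp_le[OF r]] rc(1) unfolding c1_def by auto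
    have dis: "r / 8 * (norm Y)\<^sup>2 \<le> dissipation r a q s d Y" for Y
      using assms h r rc by (intro dissipation_lower_bound[of a q s C d0 d]) (auto simp: c2_def)
    have dL: "r / 16 * ?L Y \<le> dissipation r a q s d Y" for Y
    proof -
      have "r / 16 * ?L Y \<le> r / 16 * (2 * (norm Y)\<^sup>2)" using b(2) r by (intro mult_left_mono) auto
      then show ?thesis using dis[of Y] by simp
    qed
    obtain B where B: "\<And>Y. norm (?M Y) \<le> B * norm Y"
      using linear_bounded[OF linear_mode_gen] by blast
    \<comment> \<open>This constant contains the norm of the generator and so depends on the mode.
      It multiplies \<open>h\<^sup>2\<close> only, which makes it harmless once the step size tends
      to zero for a fixed mode.\<close>
    define K where "K = 4 * B\<^sup>2"
    have step: "?L (Y + h *\<^sub>R ?M Y) \<le> exp (- 2 * (r / 16) * h + K * h\<^sup>2) * ?L Y" if "0 \<le> h" for h Y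
    proof -
      have nz: "a \<noteq> 0" "q \<noteq> 0" "s \<noteq> 0" using assms h by auto
      have "(norm (?M Y))\<^sup>2 \<le> (B * norm Y)\<^sup>2" using B by (intro power_mono) auto
      then have "?L (?M Y) \<le> 2 * B\<^sup>2 * (norm Y)\<^sup>2" using b(2)[of "?M Y"] by (simp add: power_mult_distrib)
      also have "\<dots> \<le> K * ?L Y"
        using mult_left_mono[OF b(1)[of Y], of "4 * B\<^sup>2"] by (simp add: K_def)
      finally have LM: "?L (?M Y) \<le> K * ?L Y" .
      have L0: "0 \<le> ?L Y" using b(1)[of Y] by (smt (verit) zero_le_power2 divide_nonneg_nonneg)
      have "?L (Y + h *\<^sub>R ?M Y) = ?L Y - 2 * h * dissipation r a q s d Y + h\<^sup>2 * ?L (?M Y)"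
        by (rule lyapunov_euler_step[OF nz])
      also have "\<dots> \<le> ?L Y - 2 * h * (r / 16 * ?L Y) + h\<^sup>2 * (K * ?L Y)"
        using that dL LM by (intro add_mono diff_mono mult_left_mono) auto
      also have "\<dots> = (1 + (- 2 * (r / 16) * h + K * h\<^sup>2)) * ?L Y" by (simp add: algebra_simps)
      \<comment> \<open>As \<open>1 + x \<le> exp x\<close> for every real \<open>x\<close>, the
        estimate holds for all step sizes, also where the bracket is negative.\<close>
      also have "\<dots> \<le> exp (- 2 * (r / 16) * h + K * h\<^sup>2) * ?L Y"
        using L0 exp_ge_add_one_self by (rule mult_right_mono[rotated])
      finally show ?thesis .
    qed
    have it: "?L (((\<lambda>Y. Y + h *\<^sub>R ?M Y) ^^ k) Y) \<le> exp (real k * (- 2 * (r / 16) * h + K * h\<^sup>2)) * ?L Y"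
      if "0 \<le> h" for h k Y
    proof (induction k)
      case (Suc k)
      have "?L (((\<lambda>Y. Y + h *\<^sub>R ?M Y) ^^ Suc k) Y)
          \<le> exp (- 2 * (r / 16) * h + K * h\<^sup>2) * ?L (((\<lambda>Y. Y + h *\<^sub>R ?M Y) ^^ k) Y)"
        using step[OF that] by simp
      also have "\<dots> \<le> exp (- 2 * (r / 16) * h + K * h\<^sup>2) * (exp (real k * (- 2 * (r / 16) * h + K * h\<^sup>2)) * ?L Y)"
        using Suc by (intro mult_left_mono) auto
      also have "\<dots> = exp (real (Suc k) * (- 2 * (r / 16) * h + K * h\<^sup>2)) * ?L Y"
        by (simp add: exp_add distrib_right)
      finally show ?case .
    qed simp
    \<comment> \<open>Passing from the norm to the Lyapunov function and back costs a factor 2 each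
      time.\<close>
    have "(norm (((\<lambda>Y. Y + h *\<^sub>R ?M Y) ^^ k) Y))\<^sup>2 \<le> 4 * exp (real k * (- 2 * (r / 16) * h + K * h\<^sup>2)) * (norm Y)\<^sup>2"
      if "0 \<le> h" for h k Y
      using b(1)[of "((\<lambda>Y. Y + h *\<^sub>R ?M Y) ^^ k) Y"] it[OF that, of k Y]
        mult_left_mono[OF b(2)[of Y] exp_ge_zero, of "real k * (- 2 * (r / 16) * h + K * h\<^sup>2)"] by linarith
    then show "\<exists>K. \<forall>h\<ge>0. \<forall>k Y. (norm (((\<lambda>Y. Y + h *\<^sub>R ?M Y) ^^ k) Y))\<^sup>2
          \<le> 4 * exp (real k * (- 2 * (r / 16) * h + K * h\<^sup>2)) * (norm Y)\<^sup>2" by blast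
  qed
qed

section \<open>Approximation of a contraction semigroup by Euler's method\<close>

definition seminorm_on :: "'a::real_vector set \<Rightarrow> ('a \<Rightarrow> real) \<Rightarrow> bool" where
  "seminorm_on X N \<longleftrightarrow> subspace X \<and> (\<forall>x\<in>X. 0 \<le> N x) \<and>
     (\<forall>x\<in>X. \<forall>y\<in>X. N (x + y) \<le> N x + N y) \<and> (\<forall>x\<in>X. \<forall>r. N (r *\<^sub>R x) = \<bar>r\<bar> * N x)"

lemma seminorm_onD:
  assumes "seminorm_on X N"
  shows "subspace X" "x \<in> X \<Longrightarrow> 0 \<le> N x" "x \<in> X \<Longrightarrow> y \<in> X \<Longrightarrow> N (x + y) \<le> N x + N y"
    "x \<in> X \<Longrightarrow> N (r *\<^sub>R x) = \<bar>r\<bar> * N x"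
  using assms by (auto simp: seminorm_on_def)

lemma seminorm_on_zero: "seminorm_on X N \<Longrightarrow> N 0 = 0"
  using seminorm_onD(4)[of X N 0 0] subspace_0[OF seminorm_onD(1)] by auto

lemma seminorm_on_sum:
  assumes "seminorm_on X N" "\<And>i. i \<in> I \<Longrightarrow> f i \<in> X"
  shows "N (sum f I) \<le> (\<Sum>i\<in>I. N (f i))"
proof (cases "finite I")
  case True
  then show ?thesis using assms(2)
  proof (induction I rule: finite_induct)
    case (insert i I)
    have "sum f I \<in> X" using insert by (intro subspace_sum[OF seminorm_onD(1)[OF assms(1)]]) auto
    then have "N (f i + sum f I) \<le> N (f i) + N (sum f I)"
      using insert by (intro seminorm_onD(3)[OF assms(1)]) auto
    then show ?case using insert by simp
  qed (simp add: seminorm_on_zero[OF assms(1)])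
qed (simp add: seminorm_on_zero[OF assms(1)])

text \<open>Contractivity makes Euler's method stable, so its local errors just add up.\<close>

lemma euler_tendsto_semigroup:
  fixes st :: "'e::euclidean_space \<Rightarrow> 'a::real_vector" and G :: "'e \<Rightarrow> 'e"
  assumes N: "seminorm_on X N"
    and maps: "\<And>t x. \<lbrakk>0 \<le> t; x \<in> X\<rbrakk> \<Longrightarrow> S t x \<in> X \<and> N (S t x) \<le> N x"
    and add: "\<And>t x y. \<lbrakk>0 \<le> t; x \<in> X; y \<in> X\<rbrakk> \<Longrightarrow> S t (x + y) = S t x + S t y"
    and scale: "\<And>t x r. \<lbrakk>0 \<le> t; x \<in> X\<rbrakk> \<Longrightarrow> S t (r *\<^sub>R x) = r *\<^sub>R S t x"
    and zero: "\<And>x. x \<in> X \<Longrightarrow> S 0 x = x"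
    and semi: "\<And>s t x. \<lbrakk>0 \<le> s; 0 \<le> t; x \<in> X\<rbrakk> \<Longrightarrow> S (s + t) x = S s (S t x)"
    and st: "linear st" "range st \<subseteq> X" and G: "linear G"
    and gen: "\<And>b. b \<in> Basis \<Longrightarrow>
      ((\<lambda>h. N ((1 / h) *\<^sub>R (S h (st b) - st b) - st (G b))) \<longlongrightarrow> 0) (at_right 0)"
    and t: "0 \<le> t"
  shows "(\<lambda>n. N (S t (st Y) - st (((\<lambda>Y. Y + (t / real n) *\<^sub>R G Y) ^^ n) Y))) \<longlonglongrightarrow> 0"
proof (cases "t = 0")
  case True
  have "((\<lambda>Y. Y + (t / real n) *\<^sub>R G Y) ^^ n) Y = Y" for n by (induction n) (simp_all add: True)
  moreover have "st Y \<in> X" using st(2) by auto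
  ultimately show ?thesis using True zero seminorm_on_zero[OF N] by simp
next
  case False
  with t have t: "0 < t" by simp
  note X = subspace_0[OF seminorm_onD(1)[OF N]] subspace_add[OF seminorm_onD(1)[OF N]]
    subspace_diff[OF seminorm_onD(1)[OF N]] subspace_scale[OF seminorm_onD(1)[OF N]]
    subspace_sum[OF seminorm_onD(1)[OF N]]
  have stX: "st y \<in> X" for y using st(2) by auto
  have S_diff: "S t (x - y) = S t x - S t y" if "0 \<le> t" "x \<in> X" "y \<in> X" for t x y
    using add[OF that(1,2), of "- y"] scale[OF that(1,3), of "-1"] X(4)[OF that(3), of "-1"] by simp
  have S_sum: "S t (sum f I) = (\<Sum>i\<in>I. S t (f i))" if "0 \<le> t" "\<And>i. i \<in> I \<Longrightarrow> f i \<in> X" "finite I" for t f and I :: "'e set"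
    using that(3,2)
  proof (induction I rule: finite_induct)
    case empty
    show ?case using scale[OF that(1) X(1), of 0] by simp
  next
    case (insert i I)
    then show ?case using add[OF that(1), of "f i" "sum f I"] X(5)[of I f] by simp
  qed
  define err where "err h b = (1 / h) *\<^sub>R (S h (st b) - st b) - st (G b)" for h b
  \<comment> \<open>The generator is known only pointwise. Since \<open>st\<close> and
    \<open>G\<close> are linear on a finite-dimensional space, the sum of the defects over a basis
    is one modulus that serves for all vectors.\<close>
  define \<epsilon> where "\<epsilon> h = (\<Sum>b\<in>Basis. N (err h b))" for h
  have \<epsilon>: "(\<epsilon> \<longlongrightarrow> 0) (at_right 0)"
    unfolding \<epsilon>_def err_def using tendsto_sum[OF gen, of Basis "\<lambda>b. b"] by simp
  have errX: "err h b \<in> X" if "0 \<le> h" for h b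
    unfolding err_def using that maps stX by (intro X) auto
  have local: "N (S h (st y) - st (y + h *\<^sub>R G y)) \<le> h * \<epsilon> h * norm y" if h: "0 < h" for h y
  proof -
    have "S h (st y) = S h (\<Sum>b\<in>Basis. (y \<bullet> b) *\<^sub>R st b)"
      by (subst euclidean_representation[of y, symmetric]) (simp add: linear_sum[OF st(1)] linear_scale[OF st(1)])
    also have "\<dots> = (\<Sum>b\<in>Basis. (y \<bullet> b) *\<^sub>R S h (st b))"
      using h stX X(4) by (subst S_sum) (auto simp: scale)
    finally have 1: "S h (st y) = (\<Sum>b\<in>Basis. (y \<bullet> b) *\<^sub>R S h (st b))" .
    have 2: "st (f y) = (\<Sum>b\<in>Basis. (y \<bullet> b) *\<^sub>R st (f b))" if "linear f" for f :: "'e \<Rightarrow> 'e"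
    proof -
      have "linear (\<lambda>y. st (f y))" using linear_compose[OF that st(1)] by (simp add: o_def)
      from linear_sum[OF this, of "\<lambda>b. (y \<bullet> b) *\<^sub>R b" Basis] show ?thesis
        by (simp add: euclidean_representation linear_scale[OF \<open>linear (\<lambda>y. st (f y))\<close>])
    qed
    have "linear (\<lambda>y. y + h *\<^sub>R G y)"
      by (intro linearI) (simp_all add: linear_add[OF G] linear_scale[OF G] algebra_simps)
    from 2[OF this] have "S h (st y) - st (y + h *\<^sub>R G y)
        = (\<Sum>b\<in>Basis. (y \<bullet> b) *\<^sub>R (S h (st b) - st (b + h *\<^sub>R G b)))"
      by (simp add: 1 sum_subtractf scaleR_diff_right)
    also have "\<dots> = (\<Sum>b\<in>Basis. ((y \<bullet> b) * h) *\<^sub>R ((1 / h) *\<^sub>R (S h (st b) - st b) - st (G b)))"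
      using h by (intro sum.cong) (auto simp: linear_add[OF st(1)] linear_scale[OF st(1)] algebra_simps)
    finally have eq: "S h (st y) - st (y + h *\<^sub>R G y) = (\<Sum>b\<in>Basis. ((y \<bullet> b) * h) *\<^sub>R err h b)"
      by (simp only: err_def)
    have "N (S h (st y) - st (y + h *\<^sub>R G y)) \<le> (\<Sum>b\<in>Basis. N (((y \<bullet> b) * h) *\<^sub>R err h b))"
      unfolding eq using X(4)[OF errX] h by (intro seminorm_on_sum[OF N]) auto
    also have "\<dots> = (\<Sum>b\<in>Basis. (\<bar>y \<bullet> b\<bar> * h) * N (err h b))"
      using seminorm_onD(4)[OF N errX] h by (intro sum.cong refl) (simp add: abs_mult)
    also have "\<dots> \<le> (\<Sum>b\<in>Basis. (norm y * h) * N (err h b))"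
      using h seminorm_onD(2)[OF N errX] Basis_le_norm by (intro sum_mono mult_right_mono) auto
    also have "\<dots> = h * \<epsilon> h * norm y" by (simp add: \<epsilon>_def sum_distrib_left mult_ac)
    finally show ?thesis .
  qed
  obtain B where B: "B > 0" "\<And>y. norm (G y) \<le> B * norm y"
    using linear_bounded_pos[OF G] by blast
  let ?y = "\<lambda>h k. ((\<lambda>Y. Y + h *\<^sub>R G Y) ^^ k) Y"
  \<comment> \<open>For \<open>k * h \<le> t\<close> this keeps all iterates within
    \<open>exp (t * B) * norm Y\<close>, however fine the step.\<close>
  have grow: "norm (?y h k) \<le> exp (real k * (h * B)) * norm Y" if "0 \<le> h" for h k
  proof (induction k)
    case (Suc k)
    have "norm (?y h (Suc k)) \<le> norm (?y h k) + h * norm (G (?y h k))"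
      using that norm_triangle_ineq[of "?y h k" "h *\<^sub>R G (?y h k)"] by simp
    also have "\<dots> \<le> norm (?y h k) + h * (B * norm (?y h k))"
      using B that by (intro add_left_mono mult_left_mono) auto
    also have "\<dots> = (1 + h * B) * norm (?y h k)" by (simp add: algebra_simps)
    also have "\<dots> \<le> exp (h * B) * (exp (real k * (h * B)) * norm Y)"
      using Suc that B(1) by (intro mult_mono exp_ge_add_one_self) auto
    also have "\<dots> = exp (real (Suc k) * (h * B)) * norm Y"
      by (simp add: exp_add distrib_right)
    finally show ?case .
  qed simp
  have eps0: "0 \<le> \<epsilon> h" if "0 \<le> h" for h
    unfolding \<epsilon>_def using that errX seminorm_onD(2)[OF N] by (intro sum_nonneg) auto
  have tele: "N (S (real k * h) (st Y) - st (?y h k)) \<le> real k * (h * \<epsilon> h * (exp (t * B) * norm Y))"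
    if h: "0 < h" and "real k * h \<le> t" for h k
    using that(2)
  proof (induction k)
    case 0
    then show ?case using zero[OF stX] seminorm_on_zero[OF N] by simp
  next
    case (Suc k)
    have k: "real k * h \<le> t" using Suc.prems h by (simp add: distrib_right)
    have Sk: "S (real k * h) (st Y) \<in> X" using maps stX h by simp
    have "S (real (Suc k) * h) (st Y) = S h (S (real k * h) (st Y))"
      using semi[of h "real k * h" "st Y"] h stX by (simp add: distrib_right)
    \<comment> \<open>The accumulated error is transported by the contraction \<open>S h\<close>,
      which does not enlarge it; the second summand is the local error at the current
      iterate.\<close>
    then have split: "S (real (Suc k) * h) (st Y) - st (?y h (Suc k)) =
       S h (S (real k * h) (st Y) - st (?y h k)) + (S h (st (?y h k)) - st (?y h k + h *\<^sub>R G (?y h k)))"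
      using S_diff[of h, OF _ Sk stX] h by simp
    have "N (S (real (Suc k) * h) (st Y) - st (?y h (Suc k))) \<le>
       N (S h (S (real k * h) (st Y) - st (?y h k))) + N (S h (st (?y h k)) - st (?y h k + h *\<^sub>R G (?y h k)))"
      unfolding split using h maps stX Sk X(3) by (intro seminorm_onD(3)[OF N]) auto
    also have "\<dots> \<le> N (S (real k * h) (st Y) - st (?y h k)) + h * \<epsilon> h * norm (?y h k)"
      using h maps stX Sk X(3) local[OF h] by (intro add_mono) auto
    also have "\<dots> \<le> real k * (h * \<epsilon> h * (exp (t * B) * norm Y)) + h * \<epsilon> h * (exp (t * B) * norm Y)"
    proof (intro add_mono Suc.IH k mult_left_mono)
      have "exp (real k * (h * B)) \<le> exp (t * B)" using k B(1) by (simp add: mult.assoc[symmetric])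
      then show "norm (?y h k) \<le> exp (t * B) * norm Y"
        using grow[of h k] h by (meson less_imp_le mult_right_mono norm_ge_zero order_trans)
    qed (use h eps0 in auto)
    also have "\<dots> = real (Suc k) * (h * \<epsilon> h * (exp (t * B) * norm Y))" by (simp add: algebra_simps)
    finally show ?case .
  qed
  \<comment> \<open>With \<open>n\<close> steps of length \<open>t / n\<close> the local errors add
    up to a constant times \<open>\<epsilon> (t / n)\<close>. The step length must approach zero
    through positive values, which is why \<open>t = 0\<close> was treated apart.\<close>
  have "filterlim (\<lambda>n. t / real n) (at_right 0) sequentially"
    unfolding filterlim_at
    using t by (auto intro!: tendsto_divide_0[OF tendsto_const] filterlim_real_at_infinity_sequentially
        eventually_mono[OF eventually_gt_at_top[of 0]])
  from tendsto_mult_left[OF filterlim_compose[OF \<epsilon> this], of "t * (exp (t * B) * norm Y)"]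
  have lim: "(\<lambda>n. t * (exp (t * B) * norm Y) * \<epsilon> (t / real n)) \<longlonglongrightarrow> 0" by simp
  show ?thesis
  proof (rule tendsto_sandwich[OF _ _ tendsto_const lim])
    show "\<forall>\<^sub>F n in sequentially. 0 \<le> N (S t (st Y) - st (?y (t / real n) n))"
      using t maps stX X(3) seminorm_onD(2)[OF N] by (intro always_eventually) auto
    show "\<forall>\<^sub>F n in sequentially. N (S t (st Y) - st (?y (t / real n) n)) \<le> t * (exp (t * B) * norm Y) * \<epsilon> (t / real n)"
      using eventually_gt_at_top[of 0]
    proof eventually_elim
      case (elim n)
      then show ?case using tele[of "t / real n" n] t by (simp add: mult_ac)
    qed
  qed
qed

section \<open>Eigenspaces of the Dirichlet Laplacian\<close>

lemma partial_deriv_eqI: "(f has_derivative f') (at x) \<Longrightarrow> partial_deriv i f x = f' (axis i 1)"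
  unfolding partial_deriv_def using frechet_derivative_at by metis

lemma smooth_differentiable: "smooth f \<Longrightarrow> f differentiable (at x)"
  unfolding smooth_def by (drule spec[of _ "[]"]) simp

lemma smooth_has_derivative: "smooth f \<Longrightarrow> (f has_derivative frechet_derivative f (at x)) (at x)"
  using smooth_differentiable frechet_derivative_works by blast

lemma smooth_partial_deriv: "smooth f \<Longrightarrow> smooth (partial_deriv i f)"
  unfolding smooth_def
proof safe
  fix "is" x assume "\<forall>is x. foldr partial_deriv is f differentiable (at x)"
  from this[rule_format, of "is @ [i]" x]
  show "foldr partial_deriv is (partial_deriv i f) differentiable (at x)" by simp
qed

text \<open>Smoothness is the largest class of differentiable functions closed under partial
  derivatives. Exhibiting such a class around \<open>f\<close> replaces an induction over
  multi-indices for each operation.\<close>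

lemma smooth_coinduct:
  assumes "P f" "\<And>f x. P f \<Longrightarrow> f differentiable (at x)" "\<And>f i. P f \<Longrightarrow> P (partial_deriv i f)"
  shows "smooth f"
proof -
  have "P (foldr partial_deriv is f)" for "is" by (induction "is") (auto intro: assms)
  then show ?thesis unfolding smooth_def using assms(2) by blast
qed

lemma smooth_continuous_on: "smooth f \<Longrightarrow> continuous_on S f"
  by (simp add: continuous_at_imp_continuous_on differentiable_imp_continuous_within smooth_differentiable)

lemma partial_deriv_add:
  assumes "smooth f" "smooth g"
  shows "partial_deriv i (\<lambda>x. f x + g x) = (\<lambda>x. partial_deriv i f x + partial_deriv i g x)"
  using partial_deriv_eqI[OF has_derivative_add[OF assms[THEN smooth_has_derivative]]]
  by (simp add: fun_eq_iff partial_deriv_def)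

lemma smooth_add:
  assumes "smooth f" "smooth g" shows "smooth (\<lambda>x. f x + g x)"
proof (rule smooth_coinduct[where P = "\<lambda>h. \<exists>f g. smooth f \<and> smooth g \<and> h = (\<lambda>x. f x + g x)"])
  show "\<And>h i. \<exists>f g. smooth f \<and> smooth g \<and> h = (\<lambda>x. f x + g x) \<Longrightarrow>
      \<exists>f g. smooth f \<and> smooth g \<and> partial_deriv i h = (\<lambda>x. f x + g x)"
    using partial_deriv_add smooth_partial_deriv by metis
qed (use assms in \<open>auto intro: differentiable_add smooth_differentiable\<close>)

lemma partial_deriv_bounded_linear:
  assumes "bounded_linear L" "smooth f"
  shows "partial_deriv i (\<lambda>x. L (f x)) = (\<lambda>x. L (partial_deriv i f x))"
  using partial_deriv_eqI[OF bounded_linear.has_derivative[OF assms(1) smooth_has_derivative[OF assms(2)]]]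
  by (simp add: fun_eq_iff partial_deriv_def)

lemma smooth_bounded_linear:
  assumes "bounded_linear L" "smooth f" shows "smooth (\<lambda>x. L (f x))"
proof (rule smooth_coinduct[where P = "\<lambda>h. \<exists>f. smooth f \<and> h = (\<lambda>x. L (f x))"])
  show "\<And>h i. \<exists>f. smooth f \<and> h = (\<lambda>x. L (f x)) \<Longrightarrow> \<exists>f. smooth f \<and> partial_deriv i h = (\<lambda>x. L (f x))"
    using partial_deriv_bounded_linear[OF assms(1)] smooth_partial_deriv by metis
  show "\<And>h x. \<exists>f. smooth f \<and> h = (\<lambda>x. L (f x)) \<Longrightarrow> h differentiable (at x)"
    using bounded_linear.has_derivative[OF assms(1) smooth_has_derivative] unfolding differentiable_def by blast
qed (use assms in auto)

lemma has_derivative_coord_mult: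
  fixes f :: "(real ^ 'n) \<Rightarrow> complex"
  assumes "smooth f"
  shows "((\<lambda>x. of_real (x $ j) * f x) has_derivative
     (\<lambda>v. of_real (x $ j) * frechet_derivative f (at x) v + of_real (v $ j) * f x)) (at x)"
proof -
  have "bounded_linear (\<lambda>x::real^'n. of_real (x $ j) :: complex)"
    by (rule bounded_linear_compose[OF bounded_linear_of_real bounded_linear_vec_nth])
  from has_derivative_mult[OF bounded_linear_imp_has_derivative[OF this] smooth_has_derivative[OF assms]]
  show ?thesis .
qed

lemma partial_deriv_coord_mult:
  fixes f :: "(real ^ 'n) \<Rightarrow> complex"
  assumes "smooth f"
  shows "partial_deriv i (\<lambda>x. of_real (x $ j) * f x) =
    (\<lambda>x. of_real (x $ j) * partial_deriv i f x + (if i = j then f x else 0))"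
  by (intro ext, subst partial_deriv_eqI[OF has_derivative_coord_mult[OF assms]])
     (auto simp: partial_deriv_def axis_def)

lemma partial_deriv_zero: "partial_deriv i (\<lambda>_. 0) = (\<lambda>_. 0)"
  by (rule ext) (rule partial_deriv_eqI[OF has_derivative_const])

lemma smooth_zero: "smooth (\<lambda>_. 0)"
  by (rule smooth_coinduct[where P = "\<lambda>f. f = (\<lambda>_. 0)"]) (auto simp: partial_deriv_zero)

text \<open>Differentiating the product leaves \<open>f\<close> itself as an extra summand, so the
  invariant class consists of such products plus a smooth function \<open>g\<close>.\<close>

lemma smooth_coord_mult:
  fixes f :: "(real ^ 'n) \<Rightarrow> complex"
  assumes "smooth f" shows "smooth (\<lambda>x. of_real (x $ j) * f x)"
proof (rule smooth_coinduct[where P = "\<lambda>h. \<exists>f g. smooth f \<and> smooth g \<and> h = (\<lambda>x. of_real (x $ j) * f x + g x)"])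
  show "\<exists>fa g. smooth fa \<and> smooth g \<and> (\<lambda>x. of_real (x $ j) * f x) = (\<lambda>x. of_real (x $ j) * fa x + g x)"
    using assms smooth_zero by (intro exI[of _ f] exI[of _ "\<lambda>_. 0"]) auto
next
  fix h :: "(real ^ 'n) \<Rightarrow> complex" and x
  assume "\<exists>f g. smooth f \<and> smooth g \<and> h = (\<lambda>x. of_real (x $ j) * f x + g x)"
  then show "h differentiable (at x)"
    using has_derivative_add[OF has_derivative_coord_mult smooth_has_derivative] unfolding differentiable_def by blast
next
  fix h :: "(real ^ 'n) \<Rightarrow> complex" and i
  assume "\<exists>f g. smooth f \<and> smooth g \<and> h = (\<lambda>x. of_real (x $ j) * f x + g x)"
  then obtain f g where fg: "smooth f" "smooth g" "h = (\<lambda>x. of_real (x $ j) * f x + g x)" by blast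
  have "partial_deriv i h = (\<lambda>x. of_real (x $ j) * partial_deriv i f x + ((if i = j then f x else 0) + partial_deriv i g x))"
  proof
    fix x
    show "partial_deriv i h x = of_real (x $ j) * partial_deriv i f x + ((if i = j then f x else 0) + partial_deriv i g x)"
      unfolding fg(3)
      by (subst partial_deriv_eqI[OF has_derivative_add[OF has_derivative_coord_mult smooth_has_derivative, OF fg(1,2)]])
         (auto simp: partial_deriv_def axis_def)
  qed
  moreover have "smooth (\<lambda>x. if i = j then f x else 0)"
    using fg(1) smooth_zero by (cases "i = j") simp_all
  then have "smooth (\<lambda>x. (if i = j then f x else 0) + partial_deriv i g x)"
    using fg(2) by (intro smooth_add smooth_partial_deriv)
  ultimately show "\<exists>f g. smooth f \<and> smooth g \<and> partial_deriv i h = (\<lambda>x. of_real (x $ j) * f x + g x)"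
    using smooth_partial_deriv[OF fg(1)] by blast
qed

section \<open>Closure properties of the test functions\<close>

lemma test_functionsI:
  assumes "smooth \<phi>" "\<And>x. x \<notin> K \<Longrightarrow> \<phi> x = 0" "compact K" "K \<subseteq> \<Omega>"
  shows "\<phi> \<in> test_functions \<Omega>"
proof -
  have "closure {x. \<phi> x \<noteq> 0} \<subseteq> K" using assms by (intro closure_minimal compact_imp_closed) auto
  then show ?thesis unfolding test_functions_def
    using assms by (auto intro: compact_closure[THEN iffD2] bounded_subset[OF compact_imp_bounded])
qed

lemma test_functionsE:
  assumes "\<phi> \<in> test_functions \<Omega>"
  obtains K where "smooth \<phi>" "\<And>x. x \<notin> K \<Longrightarrow> \<phi> x = 0" "compact K" "K \<subseteq> \<Omega>"
  using assms closure_subset[of "{x. \<phi> x \<noteq> 0}"] that[of "closure {x. \<phi> x \<noteq> 0}"]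
  unfolding test_functions_def by blast

lemma test_functions_smooth: "\<phi> \<in> test_functions \<Omega> \<Longrightarrow> smooth \<phi>"
  by (simp add: test_functions_def)

lemma test_functions_eq_0: "\<phi> \<in> test_functions \<Omega> \<Longrightarrow> x \<notin> \<Omega> \<Longrightarrow> \<phi> x = 0"
  by (erule test_functionsE) auto

lemma test_functions_add:
  assumes "\<phi> \<in> test_functions \<Omega>" "\<psi> \<in> test_functions \<Omega>"
  shows "(\<lambda>x. \<phi> x + \<psi> x) \<in> test_functions \<Omega>"
proof -
  obtain K L where "smooth \<phi>" "\<And>x. x \<notin> K \<Longrightarrow> \<phi> x = 0" "compact K" "K \<subseteq> \<Omega>"
    "smooth \<psi>" "\<And>x. x \<notin> L \<Longrightarrow> \<psi> x = 0" "compact L" "L \<subseteq> \<Omega>"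
    using assms by (elim test_functionsE) blast
  then show ?thesis by (intro test_functionsI[of _ "K \<union> L"] smooth_add) (auto simp: compact_Un)
qed

lemma test_functions_bounded_linear:
  assumes "bounded_linear L" "\<phi> \<in> test_functions \<Omega>"
  shows "(\<lambda>x. L (\<phi> x)) \<in> test_functions \<Omega>"
  using assms(2)
proof (rule test_functionsE)
  fix K assume "smooth \<phi>" "\<And>x. x \<notin> K \<Longrightarrow> \<phi> x = 0" "compact K" "K \<subseteq> \<Omega>"
  then show ?thesis using linear_0[OF bounded_linear.linear[OF assms(1)]]
    by (intro test_functionsI[OF smooth_bounded_linear[OF assms(1)], of \<phi> K]) auto
qed

lemma test_functions_partial_deriv:
  assumes "\<phi> \<in> test_functions \<Omega>"
  shows "partial_deriv i \<phi> \<in> test_functions \<Omega>"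
  using assms
proof (rule test_functionsE)
  fix K assume K: "smooth \<phi>" "\<And>x. x \<notin> K \<Longrightarrow> \<phi> x = 0" "compact K" "K \<subseteq> \<Omega>"
  have "partial_deriv i \<phi> x = 0" if "x \<notin> K" for x
  proof -
    \<comment> \<open>Since \<open>K\<close> is closed, the function vanishes near \<open>x\<close>
      and not merely at \<open>x\<close>.\<close>
    have "(\<phi> has_derivative (\<lambda>_. 0)) (at x)"
      using K that compact_imp_closed
      by (intro has_derivative_transform_within_open[OF has_derivative_const, of "- K"]) (auto simp: open_Compl)
    then show ?thesis by (rule partial_deriv_eqI)
  qed
  then show ?thesis using K by (intro test_functionsI[of _ K] smooth_partial_deriv) auto
qed

lemma test_functions_coord_mult:
  assumes "\<phi> \<in> test_functions \<Omega>"
  shows "(\<lambda>x. of_real (x $ j) * \<phi> x) \<in> test_functions \<Omega>"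
  using assms
  by (rule test_functionsE) (rule test_functionsI[OF smooth_coord_mult], auto)

lemma sq_integrable_test_function:
  assumes "\<phi> \<in> test_functions \<Omega>" shows "sq_integrable \<phi>"
  using assms
proof (rule test_functionsE)
  fix K assume K: "smooth \<phi>" "\<And>x. x \<notin> K \<Longrightarrow> \<phi> x = 0" "compact K"
  have "integrable lborel (\<lambda>x. indicator K x *\<^sub>R (cmod (\<phi> x))\<^sup>2)"
    using K smooth_continuous_on by (intro borel_integrable_compact continuous_intros) auto
  moreover have "(\<lambda>x. indicator K x *\<^sub>R (cmod (\<phi> x))\<^sup>2) = (\<lambda>x. (cmod (\<phi> x))\<^sup>2)"
    using K(2) by (auto simp: indicator_def fun_eq_iff)
  moreover have "\<phi> \<in> borel_measurable lborel"
    using borel_measurable_continuous_onI[OF smooth_continuous_on[OF K(1)]] by simp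
  ultimately show ?thesis by (simp add: sq_integrable_def)
qed

section \<open>Inner products, norms and sums in terms of representatives\<close>

lemma AE_rep_abs_lsq: "sq_integrable f \<Longrightarrow> AE x in lborel. rep_lsq (abs_lsq f) x = f x"
  using Quotient3_rep_abs[OF Quotient3_lsq, of f] by simp

lemma sq_integrable_rep_lsq: "sq_integrable (rep_lsq u)"
  using Quotient3_rep_reflp[OF Quotient3_lsq, of u] by simp

lemma cinner_rep: "cinner u v = (LINT x|lborel. rep_lsq u x * cnj (rep_lsq v x))"
  by (simp add: cinner_def)

lemma borel_measurable_cnj [measurable]: "cnj \<in> borel_measurable borel"
  by (intro borel_measurable_continuous_onI continuous_intros)

lemma cinner_abs_lsq:
  assumes "sq_integrable \<phi>"
  shows "cinner u (abs_lsq \<phi>) = (LINT x|lborel. rep_lsq u x * cnj (\<phi> x))"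
  unfolding cinner_rep
proof (rule integral_cong_AE)
  have [measurable]: "rep_lsq u \<in> borel_measurable lborel" "\<phi> \<in> borel_measurable lborel"
    "rep_lsq (abs_lsq \<phi>) \<in> borel_measurable lborel"
    using sq_integrable_rep_lsq assms unfolding sq_integrable_def by auto
  show "(\<lambda>x. rep_lsq u x * cnj (rep_lsq (abs_lsq \<phi>) x)) \<in> borel_measurable lborel"
    "(\<lambda>x. rep_lsq u x * cnj (\<phi> x)) \<in> borel_measurable lborel" by measurable
  show "AE x in lborel. rep_lsq u x * cnj (rep_lsq (abs_lsq \<phi>) x) = rep_lsq u x * cnj (\<phi> x)"
    using AE_rep_abs_lsq[OF assms] by eventually_elim simp
qed

lemma norm_abs_lsq:
  assumes "sq_integrable \<phi>"
  shows "(norm (abs_lsq \<phi>))\<^sup>2 = (LINT x|lborel. (cmod (\<phi> x))\<^sup>2)"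
proof -
  have "cinner (abs_lsq \<phi>) (abs_lsq \<phi>) = (LINT x|lborel. rep_lsq (abs_lsq \<phi>) x * cnj (\<phi> x))"
    by (rule cinner_abs_lsq[OF assms])
  also have "\<dots> = (LINT x|lborel. complex_of_real ((cmod (\<phi> x))\<^sup>2))"
  proof (rule integral_cong_AE)
    have [measurable]: "\<phi> \<in> borel_measurable lborel" "rep_lsq (abs_lsq \<phi>) \<in> borel_measurable lborel"
      using sq_integrable_rep_lsq assms unfolding sq_integrable_def by auto
    show "(\<lambda>x. rep_lsq (abs_lsq \<phi>) x * cnj (\<phi> x)) \<in> borel_measurable lborel"
      "(\<lambda>x. complex_of_real ((cmod (\<phi> x))\<^sup>2)) \<in> borel_measurable lborel" by measurable
    show "AE x in lborel. rep_lsq (abs_lsq \<phi>) x * cnj (\<phi> x) = complex_of_real ((cmod (\<phi> x))\<^sup>2)"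
      using AE_rep_abs_lsq[OF assms] by eventually_elim (simp only: complex_norm_square)
  qed
  finally have "Re (cinner (abs_lsq \<phi>) (abs_lsq \<phi>)) = (LINT x|lborel. (cmod (\<phi> x))\<^sup>2)"
    by (simp only: integral_complex_of_real Re_complex_of_real)
  then show ?thesis by (simp add: power2_norm_eq_inner inner_lsq_def)
qed

lemma abs_lsq_add:
  assumes "sq_integrable f" "sq_integrable g"
  shows "abs_lsq (\<lambda>x. f x + g x) = abs_lsq f + abs_lsq g"
  using assms by (simp add: plus_lsq.abs_eq)

lemma abs_lsq_scaleR:
  assumes "sq_integrable f"
  shows "abs_lsq (\<lambda>x. of_real r * f x) = r *\<^sub>R abs_lsq f"
  using assms by (simp add: scaleR_lsq_def scaleC_lsq.abs_eq)

lemma AE_rep_lsq_add: "AE x in lborel. rep_lsq (f + g) x = rep_lsq f x + rep_lsq g x"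
  using AE_rep_abs_lsq[OF sq_integrable_add[OF sq_integrable_rep_lsq sq_integrable_rep_lsq], of f g]
    abs_lsq_add[OF sq_integrable_rep_lsq sq_integrable_rep_lsq, of f g]
  by (simp add: Quotient3_abs_rep[OF Quotient3_lsq])

lemma AE_rep_lsq_scaleR: "AE x in lborel. rep_lsq (r *\<^sub>R f) x = of_real r * rep_lsq f x"
  using AE_rep_abs_lsq[OF sq_integrable_scale[OF sq_integrable_rep_lsq], of "of_real r" f]
    abs_lsq_scaleR[OF sq_integrable_rep_lsq, of r f]
  by (simp add: Quotient3_abs_rep[OF Quotient3_lsq])

lemma subspace_L2: "subspace (L2 \<Omega>)"
proof (rule subspaceI)
  have "AE x in lborel. rep_lsq (0 *\<^sub>R 0 :: 'a lsq) x = of_real 0 * rep_lsq 0 x" by (rule AE_rep_lsq_scaleR)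
  then show "0 \<in> L2 \<Omega>" unfolding L2_def by (auto elim: AE_mp)
next
  fix f g assume "f \<in> L2 \<Omega>" "g \<in> L2 \<Omega>"
  then have "AE x in lborel. x \<notin> \<Omega> \<longrightarrow> rep_lsq f x = 0" "AE x in lborel. x \<notin> \<Omega> \<longrightarrow> rep_lsq g x = 0"
    by (auto simp: L2_def)
  with AE_rep_lsq_add[of f g] have "AE x in lborel. x \<notin> \<Omega> \<longrightarrow> rep_lsq (f + g) x = 0"
    by eventually_elim auto
  then show "f + g \<in> L2 \<Omega>" by (simp add: L2_def)
next
  fix f r assume "f \<in> L2 \<Omega>"
  then have "AE x in lborel. x \<notin> \<Omega> \<longrightarrow> rep_lsq f x = 0" by (auto simp: L2_def)
  with AE_rep_lsq_scaleR[of r f] have "AE x in lborel. x \<notin> \<Omega> \<longrightarrow> rep_lsq (r *\<^sub>R f) x = 0"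
    by eventually_elim auto
  then show "r *\<^sub>R f \<in> L2 \<Omega>" by (simp add: L2_def)
qed

section \<open>The complex inner product and weak derivatives\<close>

lemma cinner_scaleR_left: "cinner (r *\<^sub>R f) g = of_real r * cinner f g"
  by (simp add: scaleR_lsq_def cinner_scaleC_left)

lemma cinner_zero_left [simp]: "cinner 0 g = 0"
  using cinner_scaleR_left[of 0 0 g] by simp

text \<open>The imaginary part of the complex inner product is the real inner product with
  \<open>\<i> *\<^sub>C g\<close>. Continuity and bounds for \<open>cinner\<close> are thereby
  inherited from the real inner product space.\<close>

lemma cinner_eq_inner:
  "cinner f g = of_real (inner f g) + \<i> * of_real (inner f (\<i> *\<^sub>C g))"
proof -
  have "cinner f (\<i> *\<^sub>C g) = cnj (\<i> * cinner g f)"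
    by (simp only: cinner_commute[of f "\<i> *\<^sub>C g"] cinner_scaleC_left)
  also have "\<dots> = - \<i> * cinner f g" by (simp add: cinner_commute[of f g])
  finally show ?thesis by (simp add: inner_lsq_def complex_eq_iff)
qed

lemma bounded_linear_cinner_left: "bounded_linear (\<lambda>f. cinner f g)"
proof -
  have "bounded_linear (\<lambda>f. of_real (inner f g) + \<i> * of_real (inner f (\<i> *\<^sub>C g)))"
    by (intro bounded_linear_add bounded_linear_const_mult bounded_linear_compose[OF bounded_linear_of_real]
        bounded_linear_inner_left)
  then show ?thesis by (simp add: cinner_eq_inner[abs_def])
qed

text \<open>The definition integrates without conjugation, but the test functions are stable under
  conjugation. The condition can thus be read as an identity of inner products, to which linearity
  and passage to the limit apply.\<close>

lemma weak_deriv_iff: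
  "weak_deriv \<Omega> i u g \<longleftrightarrow> u \<in> L2 \<Omega> \<and> g \<in> L2 \<Omega> \<and>
     (\<forall>\<phi>\<in>test_functions \<Omega>. cinner u (abs_lsq (partial_deriv i \<phi>)) = - cinner g (abs_lsq \<phi>))"
proof -
  have set: "(LINT x:\<Omega>|lborel. rep_lsq v x * \<phi> x) = cinner v (abs_lsq (\<lambda>x. cnj (\<phi> x)))"
    if "\<phi> \<in> test_functions \<Omega>" for \<phi> v
  proof -
    have "indicator \<Omega> x *\<^sub>R (rep_lsq v x * \<phi> x) = rep_lsq v x * \<phi> x" for x
      using test_functions_eq_0[OF that] by (auto simp: indicator_def)
    then show ?thesis
      using test_functions_bounded_linear[OF bounded_linear_cnj that]
      by (simp add: set_lebesgue_integral_def cinner_abs_lsq sq_integrable_test_function)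
  qed
  have cnj: "partial_deriv i (\<lambda>x. cnj (\<phi> x)) = (\<lambda>x. cnj (partial_deriv i \<phi> x))"
    "(\<lambda>x. cnj (\<phi> x)) \<in> test_functions \<Omega>"
    if "\<phi> \<in> test_functions \<Omega>" for \<phi>
    using that by (auto intro: partial_deriv_bounded_linear[OF bounded_linear_cnj] test_functions_smooth
        test_functions_bounded_linear[OF bounded_linear_cnj])
  have "(\<forall>\<phi>\<in>test_functions \<Omega>. (LINT x:\<Omega>|lborel. rep_lsq u x * partial_deriv i \<phi> x) = - (LINT x:\<Omega>|lborel. rep_lsq g x * \<phi> x))
    \<longleftrightarrow> (\<forall>\<phi>\<in>test_functions \<Omega>. cinner u (abs_lsq (\<lambda>x. cnj (partial_deriv i \<phi> x))) = - cinner g (abs_lsq (\<lambda>x. cnj (\<phi> x))))"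
    by (intro ball_cong refl) (simp add: set test_functions_partial_deriv)
  also have "\<dots> \<longleftrightarrow> (\<forall>\<phi>\<in>test_functions \<Omega>. cinner u (abs_lsq (partial_deriv i \<phi>)) = - cinner g (abs_lsq \<phi>))"
  proof safe
    fix \<phi> assume *: "\<phi> \<in> test_functions \<Omega>" "\<forall>\<phi>\<in>test_functions \<Omega>.
      cinner u (abs_lsq (\<lambda>x. cnj (partial_deriv i \<phi> x))) = - cinner g (abs_lsq (\<lambda>x. cnj (\<phi> x)))"
    from *(2)[rule_format, OF cnj(2)[OF *(1)]] show "cinner u (abs_lsq (partial_deriv i \<phi>)) = - cinner g (abs_lsq \<phi>)"
      by (simp add: cnj(1)[OF *(1)])
  next
    fix \<phi> assume *: "\<phi> \<in> test_functions \<Omega>" "\<forall>\<phi>\<in>test_functions \<Omega>.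
      cinner u (abs_lsq (partial_deriv i \<phi>)) = - cinner g (abs_lsq \<phi>)"
    from *(2)[rule_format, OF cnj(2)[OF *(1)]]
    show "cinner u (abs_lsq (\<lambda>x. cnj (partial_deriv i \<phi> x))) = - cinner g (abs_lsq (\<lambda>x. cnj (\<phi> x)))"
      by (simp add: cnj(1)[OF *(1)])
  qed
  finally show ?thesis unfolding weak_deriv_def by blast
qed

lemma weak_deriv_add:
  "weak_deriv \<Omega> i u g \<Longrightarrow> weak_deriv \<Omega> i u' g' \<Longrightarrow> weak_deriv \<Omega> i (u + u') (g + g')"
  unfolding weak_deriv_iff by (auto simp: cinner_add_left intro: subspace_add[OF subspace_L2])

lemma weak_deriv_scaleR:
  "weak_deriv \<Omega> i u g \<Longrightarrow> weak_deriv \<Omega> i (r *\<^sub>R u) (r *\<^sub>R g)"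
  unfolding weak_deriv_iff by (auto simp: cinner_scaleR_left intro: subspace_scale[OF subspace_L2])

section \<open>Functions with zero boundary values as limits of test functions\<close>

definition H10_gradient :: "(real ^ 'n) set \<Rightarrow> 'n lsq \<Rightarrow> ('n \<Rightarrow> 'n lsq) \<Rightarrow> (nat \<Rightarrow> (real ^ 'n) \<Rightarrow> complex) \<Rightarrow> bool" where
  "H10_gradient \<Omega> u g \<phi> \<longleftrightarrow> (\<forall>i. weak_deriv \<Omega> i u (g i)) \<and> (\<forall>k. \<phi> k \<in> test_functions \<Omega>) \<and>
     (\<lambda>k. abs_lsq (\<phi> k)) \<longlonglongrightarrow> u \<and> (\<forall>i. (\<lambda>k. abs_lsq (partial_deriv i (\<phi> k))) \<longlonglongrightarrow> g i)"

text \<open>Tolerances \<open>inverse (real (Suc k))\<close> turn the closure into a convergent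
  sequence. Gradient and sequence are kept explicit because Green's identity and the Poincare
  inequality are obtained as limits of identities for test functions.\<close>

lemma H10_iff: "u \<in> H10 \<Omega> \<longleftrightarrow> (\<exists>g \<phi>. H10_gradient \<Omega> u g \<phi>)"
proof
  assume "u \<in> H10 \<Omega>"
  then obtain g where g: "\<forall>i. weak_deriv \<Omega> i u (g i)" and
    *: "\<And>\<epsilon>. \<epsilon> > 0 \<Longrightarrow> \<exists>\<phi>\<in>test_functions \<Omega>. sqrt ((norm (u - abs_lsq \<phi>))\<^sup>2
      + (\<Sum>i\<in>UNIV. (norm (g i - abs_lsq (partial_deriv i \<phi>)))\<^sup>2)) < \<epsilon>"
    unfolding H10_def by blast
  have "\<forall>k. \<exists>\<phi>. \<phi>\<in>test_functions \<Omega> \<and> sqrt ((norm (u - abs_lsq \<phi>))\<^sup>2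
      + (\<Sum>i\<in>UNIV. (norm (g i - abs_lsq (partial_deriv i \<phi>)))\<^sup>2)) < inverse (real (Suc k))"
    using *[of "inverse (real (Suc k))" for k] by (simp add: Bex_def)
  from choice[OF this] obtain \<phi> where
    \<phi>: "\<And>k. \<phi> k \<in> test_functions \<Omega>" "\<And>k. sqrt ((norm (u - abs_lsq (\<phi> k)))\<^sup>2
      + (\<Sum>i\<in>UNIV. (norm (g i - abs_lsq (partial_deriv i (\<phi> k))))\<^sup>2)) < inverse (real (Suc k))"
    by blast
  have s: "0 \<le> (\<Sum>i\<in>UNIV. (norm (g i - abs_lsq (partial_deriv i (\<phi> k))))\<^sup>2)" for k
    by (intro sum_nonneg) auto
  have "norm (abs_lsq (\<phi> k) - u) \<le> inverse (real (Suc k))" for k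
  proof -
    have "norm (u - abs_lsq (\<phi> k)) \<le> sqrt ((norm (u - abs_lsq (\<phi> k)))\<^sup>2
      + (\<Sum>i\<in>UNIV. (norm (g i - abs_lsq (partial_deriv i (\<phi> k))))\<^sup>2))"
      using s[of k] by (intro real_le_rsqrt) simp
    then show ?thesis using \<phi>(2)[of k] by (simp add: norm_minus_commute)
  qed
  then have "(\<lambda>k. abs_lsq (\<phi> k)) \<longlonglongrightarrow> u"
    by (intro LIM_zero_cancel[OF Lim_null_comparison[OF _ LIMSEQ_inverse_real_of_nat]]) auto
  moreover have "norm (abs_lsq (partial_deriv i (\<phi> k)) - g i) \<le> inverse (real (Suc k))" for k i
  proof -
    have "(norm (g i - abs_lsq (partial_deriv i (\<phi> k))))\<^sup>2 \<le> (\<Sum>i\<in>UNIV. (norm (g i - abs_lsq (partial_deriv i (\<phi> k))))\<^sup>2)"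
      by (rule member_le_sum) auto
    then have "norm (g i - abs_lsq (partial_deriv i (\<phi> k))) \<le> sqrt ((norm (u - abs_lsq (\<phi> k)))\<^sup>2
      + (\<Sum>i\<in>UNIV. (norm (g i - abs_lsq (partial_deriv i (\<phi> k))))\<^sup>2))"
      by (intro real_le_rsqrt) (simp add: add_increasing)
    then show ?thesis using \<phi>(2)[of k] by (simp add: norm_minus_commute)
  qed
  then have "(\<lambda>k. abs_lsq (partial_deriv i (\<phi> k))) \<longlonglongrightarrow> g i" for i
    by (intro LIM_zero_cancel[OF Lim_null_comparison[OF _ LIMSEQ_inverse_real_of_nat]]) auto
  ultimately show "\<exists>g \<phi>. H10_gradient \<Omega> u g \<phi>" unfolding H10_gradient_def using g \<phi>(1) by blast
next
  assume "\<exists>g \<phi>. H10_gradient \<Omega> u g \<phi>"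
  then obtain g \<phi> where g: "\<forall>i. weak_deriv \<Omega> i u (g i)" "\<And>k. \<phi> k \<in> test_functions \<Omega>"
     and lim: "(\<lambda>k. abs_lsq (\<phi> k)) \<longlonglongrightarrow> u" "\<And>i. (\<lambda>k. abs_lsq (partial_deriv i (\<phi> k))) \<longlonglongrightarrow> g i"
    unfolding H10_gradient_def by blast
  have "(\<lambda>k. sqrt ((norm (u - abs_lsq (\<phi> k)))\<^sup>2 + (\<Sum>i\<in>UNIV. (norm (g i - abs_lsq (partial_deriv i (\<phi> k))))\<^sup>2)))
    \<longlonglongrightarrow> sqrt ((norm (u - u))\<^sup>2 + (\<Sum>i\<in>UNIV. (norm (g i - g i))\<^sup>2))"
    by (intro tendsto_intros lim)
  then have "\<forall>\<^sub>F k in sequentially. sqrt ((norm (u - abs_lsq (\<phi> k)))\<^sup>2 + (\<Sum>i\<in>UNIV. (norm (g i - abs_lsq (partial_deriv i (\<phi> k))))\<^sup>2)) < \<epsilon>"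
    if "0 < \<epsilon>" for \<epsilon> using that by (auto dest: order_tendstoD(2))
  from eventually_happens'[OF sequentially_bot this] show "u \<in> H10 \<Omega>"
    unfolding H10_def mem_Collect_eq using g by (intro exI[of _ g] conjI allI impI) blast+
qed

lemma H10_gradientD:
  assumes "H10_gradient \<Omega> u g \<phi>"
  shows "weak_deriv \<Omega> i u (g i)" "\<phi> k \<in> test_functions \<Omega>" "smooth (\<phi> k)"
    "partial_deriv i (\<phi> k) \<in> test_functions \<Omega>" "sq_integrable (\<phi> k)" "sq_integrable (partial_deriv i (\<phi> k))"
    "(\<lambda>k. abs_lsq (\<phi> k)) \<longlonglongrightarrow> u" "(\<lambda>k. abs_lsq (partial_deriv i (\<phi> k))) \<longlonglongrightarrow> g i"
  using assms unfolding H10_gradient_def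
  by (blast intro: test_functions_smooth test_functions_partial_deriv sq_integrable_test_function)+

lemma H10_gradient_add:
  assumes "H10_gradient \<Omega> u g \<phi>" "H10_gradient \<Omega> v h \<psi>"
  shows "H10_gradient \<Omega> (u + v) (\<lambda>i. g i + h i) (\<lambda>k x. \<phi> k x + \<psi> k x)"
  unfolding H10_gradient_def
  using assms[THEN H10_gradientD(1)] assms[THEN H10_gradientD(2)] tendsto_add[OF assms[THEN H10_gradientD(7)]]
    tendsto_add[OF assms[THEN H10_gradientD(8)]]
  by (simp add: weak_deriv_add test_functions_add abs_lsq_add partial_deriv_add assms[THEN H10_gradientD(3)]
      assms[THEN H10_gradientD(5)] assms[THEN H10_gradientD(6)])

lemma H10_gradient_scaleR:
  assumes "H10_gradient \<Omega> u g \<phi>"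
  shows "H10_gradient \<Omega> (r *\<^sub>R u) (\<lambda>i. r *\<^sub>R g i) (\<lambda>k x. of_real r * \<phi> k x)"
  unfolding H10_gradient_def
  using assms[THEN H10_gradientD(1)] assms[THEN H10_gradientD(2)] tendsto_scaleR[OF tendsto_const H10_gradientD(7)[OF assms]]
    tendsto_scaleR[OF tendsto_const H10_gradientD(8)[OF assms]]
  by (simp add: weak_deriv_scaleR test_functions_bounded_linear[OF bounded_linear_mult_right] abs_lsq_scaleR
      partial_deriv_bounded_linear[OF bounded_linear_mult_right] assms[THEN H10_gradientD(3)]
      assms[THEN H10_gradientD(5)] assms[THEN H10_gradientD(6)])

section \<open>Linear structure of the Sobolev spaces and of the Laplacian\<close>

lemma weak_deriv_zero: "weak_deriv \<Omega> i 0 0"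
  unfolding weak_deriv_iff using subspace_0[OF subspace_L2] by auto

lemma test_functions_zero: "(\<lambda>_. 0) \<in> test_functions \<Omega>"
  by (rule test_functionsI[of _ "{}"]) (auto simp: smooth_zero)

lemma subspace_H10: "subspace (H10 \<Omega>)"
proof (rule subspaceI)
  have "abs_lsq (\<lambda>_. 0) = (0::'a lsq)" by (simp add: zero_lsq_def)
  then have "H10_gradient \<Omega> 0 (\<lambda>_. 0) (\<lambda>_ _. 0)"
    unfolding H10_gradient_def by (auto simp: partial_deriv_zero intro: weak_deriv_zero test_functions_zero)
  then show "0 \<in> H10 \<Omega>" unfolding H10_iff by blast
next
  fix u v assume "u \<in> H10 \<Omega>" "v \<in> H10 \<Omega>"
  then show "u + v \<in> H10 \<Omega>" unfolding H10_iff by (elim exE) (rule exI, rule exI, rule H10_gradient_add)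
next
  fix u r assume "u \<in> H10 \<Omega>"
  then show "r *\<^sub>R u \<in> H10 \<Omega>" unfolding H10_iff by (elim exE) (rule exI, rule exI, rule H10_gradient_scaleR)
qed

text \<open>Serves twice: the class of all functions as \<open>G\<close> gives \<open>H1\<close>,
  and \<open>H1\<close> as \<open>G\<close> gives \<open>H2\<close>.\<close>

lemma subspace_weakly_differentiable:
  assumes "subspace G"
  shows "subspace {u. \<forall>i. \<exists>g\<in>G. weak_deriv \<Omega> i u g}"
proof (rule subspaceI; rule CollectI; rule allI)
  fix i
  show "\<exists>g\<in>G. weak_deriv \<Omega> i 0 g"
    by (intro bexI[of _ 0] weak_deriv_zero subspace_0[OF assms])
next
  fix u v i assume "u \<in> {u. \<forall>i. \<exists>g\<in>G. weak_deriv \<Omega> i u g}" "v \<in> {u. \<forall>i. \<exists>g\<in>G. weak_deriv \<Omega> i u g}"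
  then obtain g h where "g \<in> G" "h \<in> G" "weak_deriv \<Omega> i u g" "weak_deriv \<Omega> i v h" by blast
  then show "\<exists>g\<in>G. weak_deriv \<Omega> i (u + v) g"
    by (intro bexI[of _ "g + h"] weak_deriv_add subspace_add[OF assms])
next
  fix u r i assume "u \<in> {u. \<forall>i. \<exists>g\<in>G. weak_deriv \<Omega> i u g}"
  then obtain g where "g \<in> G" "weak_deriv \<Omega> i u g" by blast
  then show "\<exists>g\<in>G. weak_deriv \<Omega> i (r *\<^sub>R u) g"
    by (intro bexI[of _ "r *\<^sub>R g"] weak_deriv_scaleR subspace_scale[OF assms])
qed

lemma subspace_H1: "subspace (H1 \<Omega>)"
  unfolding H1_def using subspace_weakly_differentiable[OF subspace_UNIV] by simp

lemma subspace_H2: "subspace (H2 \<Omega>)"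
  unfolding H2_def by (rule subspace_weakly_differentiable[OF subspace_H1])

lemma subspace_dirichlet_laplacian: "subspace (dirichlet_laplacian \<Omega>)"
proof -
  have lap0: "weak_laplacian \<Omega> 0 0" unfolding weak_laplacian_def
    by (intro exI[of _ "\<lambda>_. 0"]) (auto intro: weak_deriv_zero)
  have lap_add: "weak_laplacian \<Omega> (u + u') (f + f')" if "weak_laplacian \<Omega> u f" "weak_laplacian \<Omega> u' f'" for u u' f f'
  proof -
    obtain g h g' h' where "\<forall>i. weak_deriv \<Omega> i u (g i) \<and> weak_deriv \<Omega> i (g i) (h i)" "f = (\<Sum>i\<in>UNIV. h i)"
       "\<forall>i. weak_deriv \<Omega> i u' (g' i) \<and> weak_deriv \<Omega> i (g' i) (h' i)" "f' = (\<Sum>i\<in>UNIV. h' i)"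
      using \<open>weak_laplacian \<Omega> u f\<close> \<open>weak_laplacian \<Omega> u' f'\<close> unfolding weak_laplacian_def by blast
    then show ?thesis unfolding weak_laplacian_def
      by (intro exI[of _ "\<lambda>i. g i + g' i"] exI[of _ "\<lambda>i. h i + h' i"]) (auto intro: weak_deriv_add simp: sum.distrib)
  qed
  have lap_scale: "weak_laplacian \<Omega> (r *\<^sub>R u) (r *\<^sub>R f)" if lap: "weak_laplacian \<Omega> u f" for r u f
  proof -
    obtain g h where "\<forall>i. weak_deriv \<Omega> i u (g i) \<and> weak_deriv \<Omega> i (g i) (h i)" "f = (\<Sum>i\<in>UNIV. h i)"
      using lap unfolding weak_laplacian_def by blast
    then show ?thesis unfolding weak_laplacian_def
      by (intro exI[of _ "\<lambda>i. r *\<^sub>R g i"] exI[of _ "\<lambda>i. r *\<^sub>R h i"]) (auto intro: weak_deriv_scaleR simp: scaleR_sum_right)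
  qed
  show ?thesis
  proof (rule subspaceI)
    show "0 \<in> dirichlet_laplacian \<Omega>"
      using lap0 subspace_0[OF subspace_H2[of \<Omega>]] subspace_0[OF subspace_H10[of \<Omega>]] by (simp add: dirichlet_laplacian_def zero_prod_def)
    show "x + y \<in> dirichlet_laplacian \<Omega>" if "x \<in> dirichlet_laplacian \<Omega>" "y \<in> dirichlet_laplacian \<Omega>" for x y
      using that lap_add[of "fst x" "- snd x" "fst y" "- snd y"]
      by (auto simp: dirichlet_laplacian_def intro: subspace_add[OF subspace_H2] subspace_add[OF subspace_H10])
    show "r *\<^sub>R x \<in> dirichlet_laplacian \<Omega>" if "x \<in> dirichlet_laplacian \<Omega>" for x r
      using that lap_scale[of "fst x" "- snd x" r]
      by (auto simp: dirichlet_laplacian_def intro: subspace_scale[OF subspace_H2] subspace_scale[OF subspace_H10])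
  qed
qed

section \<open>Eigenvectors: orthogonality and a positive lower bound for the eigenvalues\<close>

lemma subspace_eigenspace: "subspace (eigenspace \<Omega> \<mu>)"
proof (rule subspaceI)
  note S = subspace_dirichlet_laplacian[of \<Omega>]
  show "0 \<in> eigenspace \<Omega> \<mu>" using subspace_0[OF S] by (simp add: eigenspace_def zero_prod_def)
  show "x + y \<in> eigenspace \<Omega> \<mu>" if "x \<in> eigenspace \<Omega> \<mu>" "y \<in> eigenspace \<Omega> \<mu>" for x y
    using that subspace_add[OF S, of "(x, \<mu> *\<^sub>R x)" "(y, \<mu> *\<^sub>R y)"] by (simp add: eigenspace_def scaleR_add_right)
  show "r *\<^sub>R x \<in> eigenspace \<Omega> \<mu>" if "x \<in> eigenspace \<Omega> \<mu>" for x r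
    using that subspace_scale[OF S, of "(x, \<mu> *\<^sub>R x)" r] by (simp add: eigenspace_def mult.commute)
qed

lemma eigenspace_subset_L2: "eigenspace \<Omega> \<mu> \<subseteq> L2 \<Omega>"
  by (auto simp: eigenspace_def dirichlet_laplacian_def H10_def weak_deriv_def)

text \<open>The weak gradient from the definition of \<open>H\<^sub>0\<^sup>1\<close> and the one from the Laplacian have the same
  pairings with test functions; as derivatives of test functions are test functions again, this
  suffices, and uniqueness of weak derivatives is not needed.\<close>

lemma eigenspace_gradient_form:
  assumes e: "e \<in> eigenspace \<Omega> \<mu>" "H10_gradient \<Omega> e g \<phi>" and f: "H10_gradient \<Omega> f h \<psi>"
  shows "(\<Sum>i\<in>UNIV. cinner (h i) (g i)) = of_real \<mu> * cinner f e"
proof -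
  obtain G H where G: "\<And>i. weak_deriv \<Omega> i e (G i)" "\<And>i. weak_deriv \<Omega> i (G i) (H i)" "- (\<mu> *\<^sub>R e) = (\<Sum>i\<in>UNIV. H i)"
    using e(1) unfolding eigenspace_def dirichlet_laplacian_def weak_laplacian_def by blast
  have g: "\<And>i. weak_deriv \<Omega> i e (g i)" using e(2) by (auto simp: H10_gradient_def)
  have \<psi>: "\<psi> k \<in> test_functions \<Omega>" for k using f by (auto simp: H10_gradient_def)
  have *: "(\<Sum>i\<in>UNIV. cinner (abs_lsq (partial_deriv i (\<psi> k))) (g i)) = of_real \<mu> * cinner (abs_lsq (\<psi> k)) e" for k
  proof -
    have "cinner (g i) (abs_lsq (partial_deriv i (\<psi> k))) = - cinner (H i) (abs_lsq (\<psi> k))" for i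
    proof -
      note D\<psi> = test_functions_partial_deriv[OF \<psi>, of i k]
      have "cinner (g i) (abs_lsq (partial_deriv i (\<psi> k))) = cinner (G i) (abs_lsq (partial_deriv i (\<psi> k)))"
        using g[of i] G(1)[of i] D\<psi> unfolding weak_deriv_iff by (metis minus_equation_iff)
      also have "\<dots> = - cinner (H i) (abs_lsq (\<psi> k))" using G(2)[of i] \<psi>[of k] unfolding weak_deriv_iff by blast
      finally show ?thesis .
    qed
    then have "(\<Sum>i\<in>UNIV. cinner (g i) (abs_lsq (partial_deriv i (\<psi> k)))) = - cinner (\<Sum>i\<in>UNIV. H i) (abs_lsq (\<psi> k))"
      by (simp add: sum_negf linear_sum[OF bounded_linear.linear[OF bounded_linear_cinner_left]])
    also have "\<dots> = of_real \<mu> * cinner e (abs_lsq (\<psi> k))"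
      unfolding G(3)[symmetric] using cinner_scaleR_left[of "- \<mu>" e] by simp
    finally have "cnj (\<Sum>i\<in>UNIV. cinner (g i) (abs_lsq (partial_deriv i (\<psi> k)))) = of_real \<mu> * cnj (cinner e (abs_lsq (\<psi> k)))"
      by simp
    then show ?thesis by (simp add: cinner_commute[symmetric])
  qed
  have "(\<lambda>k. (\<Sum>i\<in>UNIV. cinner (abs_lsq (partial_deriv i (\<psi> k))) (g i))) \<longlonglongrightarrow> (\<Sum>i\<in>UNIV. cinner (h i) (g i))"
    using f unfolding H10_gradient_def
    by (intro tendsto_sum bounded_linear.tendsto[OF bounded_linear_cinner_left]) auto
  moreover have "(\<lambda>k. of_real \<mu> * cinner (abs_lsq (\<psi> k)) e) \<longlonglongrightarrow> of_real \<mu> * cinner f e"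
    using f unfolding H10_gradient_def
    by (intro tendsto_mult_left bounded_linear.tendsto[OF bounded_linear_cinner_left]) auto
  ultimately show ?thesis using LIMSEQ_unique unfolding * by blast
qed

lemma eigenspace_H10: "e \<in> eigenspace \<Omega> \<mu> \<Longrightarrow> \<exists>g \<phi>. H10_gradient \<Omega> e g \<phi>"
  by (simp add: eigenspace_def dirichlet_laplacian_def H10_iff)

text \<open>The gradient form is Hermitian, so evaluating it with either eigenvector in the second
  place gives both \<mu> and \<nu> times the same inner product.\<close>

lemma eigenspace_orthogonal:
  assumes "e \<in> eigenspace \<Omega> \<mu>" "f \<in> eigenspace \<Omega> \<nu>" "\<mu> \<noteq> \<nu>"
  shows "cinner e f = 0"
proof -
  obtain g \<phi> h \<psi> where g: "H10_gradient \<Omega> e g \<phi>" and h: "H10_gradient \<Omega> f h \<psi>"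
    using assms eigenspace_H10 by metis
  have "of_real \<mu> * cinner f e = (\<Sum>i\<in>UNIV. cinner (h i) (g i))"
    using eigenspace_gradient_form[OF assms(1) g h] by simp
  also have "\<dots> = cnj (\<Sum>i\<in>UNIV. cinner (g i) (h i))" by (simp add: cinner_commute[symmetric])
  also have "\<dots> = of_real \<nu> * cinner f e"
    unfolding eigenspace_gradient_form[OF assms(2) h g] by (simp add: cinner_commute[symmetric])
  finally have "cinner f e = 0" using assms(3) by simp
  then show ?thesis by (simp add: cinner_commute[of e f])
qed

lemma norm_coord_mult_le:
  assumes "\<phi> \<in> test_functions \<Omega>" "\<And>x. x \<in> \<Omega> \<Longrightarrow> norm x \<le> R" "0 \<le> R"
  shows "norm (abs_lsq (\<lambda>x. of_real (x $ j) * \<phi> x)) \<le> R * norm (abs_lsq \<phi>)"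
proof -
  have "(cmod (of_real (x $ j) * \<phi> x))\<^sup>2 \<le> R\<^sup>2 * (cmod (\<phi> x))\<^sup>2" for x
  proof (cases "x \<in> \<Omega>")
    case True
    then have "cmod (of_real (x $ j) * \<phi> x) \<le> R * cmod (\<phi> x)"
      using assms(2)[OF True] component_le_norm_cart[of x j] by (auto simp: norm_mult intro!: mult_right_mono)
    then show ?thesis by (metis norm_ge_zero power_mono power_mult_distrib)
  qed (simp add: test_functions_eq_0[OF assms(1)])
  then have "(LINT x|lborel. (cmod (of_real (x $ j) * \<phi> x))\<^sup>2) \<le> (LINT x|lborel. R\<^sup>2 * (cmod (\<phi> x))\<^sup>2)"
    using sq_integrable_test_function[OF assms(1)] sq_integrable_test_function[OF test_functions_coord_mult[OF assms(1)]]
    by (intro integral_mono) (auto simp: sq_integrable_def)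
  then have "(norm (abs_lsq (\<lambda>x. of_real (x $ j) * \<phi> x)))\<^sup>2 \<le> (R * norm (abs_lsq \<phi>))\<^sup>2"
    using sq_integrable_test_function[OF assms(1)] sq_integrable_test_function[OF test_functions_coord_mult[OF assms(1)]]
    by (simp add: norm_abs_lsq power_mult_distrib)
  then show ?thesis by (rule power2_le_imp_le) (simp add: assms(3))
qed

text \<open>Testing the weak derivative of \<open>u\<close> against \<open>x\<^sub>j \<phi>\<close>, where \<open>\<phi>\<close> tends to \<open>u\<close>, gives
  \<open>\<parallel>u\<parallel>\<^sup>2 = - \<langle>u, x\<^sub>j \<partial>\<^sub>j u\<rangle> - \<langle>\<partial>\<^sub>j u, x\<^sub>j u\<rangle>\<close>.\<close>

lemma poincare_inequality:
  assumes g: "H10_gradient \<Omega> u g \<phi>" and R: "\<And>x. x \<in> \<Omega> \<Longrightarrow> norm x \<le> R" "0 \<le> R"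
  shows "norm u \<le> 2 * R * norm (g j)"
proof -
  have \<phi>: "\<phi> k \<in> test_functions \<Omega>" for k using g by (auto simp: H10_gradient_def)
  have le: "inner u (abs_lsq (\<phi> k)) \<le> R * (norm u * norm (abs_lsq (partial_deriv j (\<phi> k))) + norm (g j) * norm (abs_lsq (\<phi> k)))" for k
  proof -
    let ?x = "\<lambda>\<psi> x. complex_of_real (x $ j) * \<psi> x"
    note D = test_functions_partial_deriv[OF \<phi>, of j k]
    have "inner u (abs_lsq (partial_deriv j (?x (\<phi> k)))) = - inner (g j) (abs_lsq (?x (\<phi> k)))"
      using H10_gradientD(1)[OF g, of j] test_functions_coord_mult[OF \<phi>, of j k] unfolding weak_deriv_iff inner_lsq_def
      by simp
    \<comment> \<open>The product rule produces \<open>\<phi> k\<close> itself, whose inner product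
      with \<open>u\<close> tends to the squared norm of \<open>u\<close>.\<close>
    moreover have "abs_lsq (partial_deriv j (?x (\<phi> k))) = abs_lsq (?x (partial_deriv j (\<phi> k))) + abs_lsq (\<phi> k)"
      by (simp add: partial_deriv_coord_mult H10_gradientD(3,5)[OF g] abs_lsq_add
          sq_integrable_test_function[OF test_functions_coord_mult[OF D]])
    ultimately have "inner u (abs_lsq (\<phi> k)) = - inner u (abs_lsq (?x (partial_deriv j (\<phi> k)))) - inner (g j) (abs_lsq (?x (\<phi> k)))"
      by (simp add: inner_add_right)
    also have "\<dots> \<le> norm u * norm (abs_lsq (?x (partial_deriv j (\<phi> k)))) + norm (g j) * norm (abs_lsq (?x (\<phi> k)))"
      using Cauchy_Schwarz_ineq2[of u "abs_lsq (?x (partial_deriv j (\<phi> k)))"]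
        Cauchy_Schwarz_ineq2[of "g j" "abs_lsq (?x (\<phi> k))"] by linarith
    also have "\<dots> \<le> norm u * (R * norm (abs_lsq (partial_deriv j (\<phi> k)))) + norm (g j) * (R * norm (abs_lsq (\<phi> k)))"
      using norm_coord_mult_le[OF \<phi> R] norm_coord_mult_le[OF D R] by (intro add_mono mult_left_mono) auto
    finally show ?thesis by (simp add: algebra_simps)
  qed
  have "(\<lambda>k. inner u (abs_lsq (\<phi> k))) \<longlonglongrightarrow> inner u u"
    by (intro tendsto_intros H10_gradientD[OF g])
  moreover have "(\<lambda>k. R * (norm u * norm (abs_lsq (partial_deriv j (\<phi> k))) + norm (g j) * norm (abs_lsq (\<phi> k))))
      \<longlonglongrightarrow> R * (norm u * norm (g j) + norm (g j) * norm u)"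
    by (intro tendsto_intros H10_gradientD[OF g])
  ultimately have "inner u u \<le> R * (norm u * norm (g j) + norm (g j) * norm u)"
    using le by (intro LIMSEQ_le) auto
  then have "norm u * norm u \<le> norm u * (2 * R * norm (g j))"
    by (simp add: power2_norm_eq_inner[symmetric] power2_eq_square algebra_simps)
  then show ?thesis using R(2) by (cases "norm u = 0") (auto simp: mult_le_cancel_left)
qed

text \<open>The Rayleigh quotient of \<open>e\<close> is \<mu>, and the Poincare inequality bounds
  it from below. Families are indexed by all reals; this is where the indices that occur become
  positive, so that \<open>powr\<close>, square roots and division by \<mu> have their usual
  meaning.\<close>

lemma eigenvalues_bounded_below:
  fixes \<Omega> :: "(real ^ 'n) set"
  assumes "bounded \<Omega>"
  obtains \<mu>\<^sub>0 where "0 < \<mu>\<^sub>0" "\<And>\<mu> e. e \<in> eigenspace \<Omega> \<mu> \<Longrightarrow> e \<noteq> 0 \<Longrightarrow> \<mu>\<^sub>0 \<le> \<mu>"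
proof -
  obtain R where R: "0 < R" "\<And>x. x \<in> \<Omega> \<Longrightarrow> norm x \<le> R" using assms bounded_pos by blast
  show thesis
  proof (rule that[of "1 / (4 * R\<^sup>2)"])
    fix \<mu> e assume e: "e \<in> eigenspace \<Omega> \<mu>" "e \<noteq> 0"
    obtain g \<phi> where g: "H10_gradient \<Omega> e g \<phi>" using eigenspace_H10[OF e(1)] by blast
    \<comment> \<open>The Poincare inequality holds along every coordinate direction, and one
      direction is enough; there is one because the index type is non-empty.\<close>
    obtain j :: 'n where True by blast
    have n: "(norm x)\<^sup>2 = Re (cinner x x)" for x :: "'n lsq" by (simp add: power2_norm_eq_inner inner_lsq_def)
    have "norm e \<le> 2 * R * norm (g j)" using poincare_inequality[OF g R(2)] R(1) by simp
    then have "(norm e)\<^sup>2 \<le> (2 * R * norm (g j))\<^sup>2" by (intro power_mono) auto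
    also have "\<dots> = 4 * R\<^sup>2 * (norm (g j))\<^sup>2" by (simp add: power_mult_distrib)
    also have "\<dots> \<le> 4 * R\<^sup>2 * (\<Sum>i\<in>UNIV. (norm (g i))\<^sup>2)"
      by (intro mult_left_mono member_le_sum) auto
    also have "(\<Sum>i\<in>UNIV. (norm (g i))\<^sup>2) = Re (\<Sum>i\<in>UNIV. cinner (g i) (g i))" by (simp add: n)
    also have "\<dots> = \<mu> * (norm e)\<^sup>2" unfolding eigenspace_gradient_form[OF e(1) g g] by (simp add: n)
    finally have "1 * (norm e)\<^sup>2 \<le> (4 * R\<^sup>2 * \<mu>) * (norm e)\<^sup>2" by simp
    then have "1 \<le> 4 * R\<^sup>2 * \<mu>" using e(2) by (simp only: mult_le_cancel_right zero_less_power2 norm_eq_zero) (auto simp: not_less)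
    then show "1 / (4 * R\<^sup>2) \<le> \<mu>" using R(1) by (simp add: divide_le_eq mult.commute)
  qed (use R in auto)
qed

section \<open>The phase space in eigenfunction expansions\<close>

lemma square_summable_add:
  fixes f g :: "'i \<Rightarrow> 'a::real_normed_vector"
  assumes "(\<lambda>i. (norm (f i))\<^sup>2) summable_on I" "(\<lambda>i. (norm (g i))\<^sup>2) summable_on I"
  shows "(\<lambda>i. (norm (f i + g i))\<^sup>2) summable_on I"
proof (rule summable_on_comparison_test)
  show "(\<lambda>i. 2 * (norm (f i))\<^sup>2 + 2 * (norm (g i))\<^sup>2) summable_on I"
    using assms by (intro summable_on_add summable_on_cmult_right)
  show "(norm (f i + g i))\<^sup>2 \<le> 2 * (norm (f i))\<^sup>2 + 2 * (norm (g i))\<^sup>2" for i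
  proof -
    have "(norm (f i + g i))\<^sup>2 \<le> (norm (f i) + norm (g i))\<^sup>2"
      by (rule power_mono[OF norm_triangle_ineq norm_ge_zero])
    moreover have "0 \<le> (norm (f i) - norm (g i))\<^sup>2" by simp
    ultimately show ?thesis unfolding power2_sum power2_diff by linarith
  qed
qed simp

text \<open>Minkowski's inequality for infinite families. The terms are non-negative, so it suffices
  to bound finite partial sums, where it is the triangle inequality for
  \<open>L2_set\<close>.\<close>

lemma has_sum_square_triangle:
  fixes f g :: "'i \<Rightarrow> 'a::real_normed_vector"
  assumes f: "((\<lambda>i. (norm (f i))\<^sup>2) has_sum F\<^sup>2) I" "0 \<le> F"
    and g: "((\<lambda>i. (norm (g i))\<^sup>2) has_sum G\<^sup>2) I" "0 \<le> G"
    and h: "((\<lambda>i. (norm (f i + g i))\<^sup>2) has_sum H\<^sup>2) I"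
  shows "H \<le> F + G"
proof (rule power2_le_imp_le)
  have le: "L2_set (\<lambda>i. norm (f i)) X \<le> F"
    if "((\<lambda>i. (norm (f i))\<^sup>2) has_sum F\<^sup>2) I" "0 \<le> F" "finite X" "X \<subseteq> I" for f :: "'i \<Rightarrow> 'a" and F X
  proof -
    have "(\<Sum>i\<in>X. (norm (f i))\<^sup>2) \<le> F\<^sup>2" by (rule finite_sum_le_has_sum[OF that(1,3,4)]) simp
    then show ?thesis unfolding L2_set_def using that(2) by (metis real_sqrt_abs real_sqrt_le_mono abs_of_nonneg)
  qed
  show "H\<^sup>2 \<le> (F + G)\<^sup>2"
  proof (rule has_sum_le_finite_sums[OF h])
    fix X assume X: "finite X" "X \<subseteq> I"
    have "(\<Sum>i\<in>X. (norm (f i + g i))\<^sup>2) = (L2_set (\<lambda>i. norm (f i + g i)) X)\<^sup>2"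
      unfolding L2_set_def by (simp add: sum_nonneg)
    also have "\<dots> \<le> (F + G)\<^sup>2"
    proof (rule power_mono)
      have "L2_set (\<lambda>i. norm (f i + g i)) X \<le> L2_set (\<lambda>i. norm (f i) + norm (g i)) X"
        by (rule L2_set_mono) (auto intro: norm_triangle_ineq)
      also have "\<dots> \<le> L2_set (\<lambda>i. norm (f i)) X + L2_set (\<lambda>i. norm (g i)) X" by (rule L2_set_triangle_ineq)
      also have "\<dots> \<le> F + G" by (rule add_mono[OF le[OF f X] le[OF g X]])
      finally show "L2_set (\<lambda>i. norm (f i + g i)) X \<le> F + G" .
    qed (rule L2_set_nonneg)
    finally show "(\<Sum>i\<in>X. (norm (f i + g i))\<^sup>2) \<le> (F + G)\<^sup>2" .
  qed
qed (use f g in simp)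

section \<open>Eigenfunction expansions and the domains of the powers\<close>

lemma eigen_expansionD:
  assumes "eigen_expansion \<Omega> u c"
  shows "c \<mu> \<in> eigenspace \<Omega> \<mu>" "(c has_sum u) UNIV"
  using assms by (auto simp: eigen_expansion_def)

text \<open>Orthogonality of the eigenspaces reduces the series to a single term; an inner product
  with an eigenvector thus reads off one component.\<close>

lemma eigen_expansion_cinner:
  assumes "eigen_expansion \<Omega> u c" "e \<in> eigenspace \<Omega> \<mu>"
  shows "cinner u e = cinner (c \<mu>) e"
proof -
  have "((\<lambda>\<nu>. cinner (c \<nu>) e) has_sum cinner u e) UNIV"
    by (rule has_sum_bounded_linear[OF bounded_linear_cinner_left eigen_expansionD(2)[OF assms(1)]])
  moreover have "((\<lambda>\<nu>. cinner (c \<nu>) e) has_sum cinner (c \<mu>) e) UNIV"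
    by (rule has_sum_finite_neutralI[of "{\<mu>}"])
       (auto intro: eigenspace_orthogonal[OF eigen_expansionD(1)[OF assms(1)] assms(2)])
  ultimately show ?thesis by (rule has_sum_unique)
qed

lemma cinner_diff_left: "cinner (f - g) h = cinner f h - cinner g h"
  using cinner_add_left[of "f - g" g h] by simp

lemma cinner_self_eq_0_iff: "cinner f f = 0 \<longleftrightarrow> f = 0"
  using cinner_self_eq_0[of f] cinner_self[of f] by auto

text \<open>The definite description in \<open>components\<close> rests on uniqueness: at each \<mu>
  the difference of two expansions is an eigenvector, and its inner product with itself
  vanishes.\<close>

lemma components_eq:
  assumes "eigen_expansion \<Omega> u c" shows "components \<Omega> u = c"
  unfolding components_def
proof (rule the_equality, rule assms)
  fix c' assume c': "eigen_expansion \<Omega> u c'"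
  show "c' = c"
  proof
    fix \<mu>
    have "c' \<mu> - c \<mu> \<in> eigenspace \<Omega> \<mu>"
      by (rule subspace_diff[OF subspace_eigenspace eigen_expansionD(1)[OF c'] eigen_expansionD(1)[OF assms]])
    from eigen_expansion_cinner[OF c' this] eigen_expansion_cinner[OF assms this]
    have "cinner (c' \<mu> - c \<mu>) (c' \<mu> - c \<mu>) = 0" by (simp only: cinner_diff_left) simp
    then show "c' \<mu> = c \<mu>" by (simp add: cinner_self_eq_0_iff)
  qed
qed

lemma eigen_expansion_parseval:
  assumes "eigen_expansion \<Omega> u c"
  shows "((\<lambda>\<mu>. (norm (c \<mu>))\<^sup>2) has_sum (norm u)\<^sup>2) UNIV"
proof -
  have "((\<lambda>\<mu>. inner (c \<mu>) u) has_sum inner u u) UNIV"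
    by (rule has_sum_bounded_linear[OF bounded_linear_inner_left eigen_expansionD(2)[OF assms]])
  moreover have "inner (c \<mu>) u = (norm (c \<mu>))\<^sup>2" for \<mu>
  proof -
    have "inner u (c \<mu>) = inner (c \<mu>) (c \<mu>)"
      unfolding inner_lsq_def eigen_expansion_cinner[OF assms eigen_expansionD(1)[OF assms]] ..
    then show ?thesis by (simp only: inner_commute[of "c \<mu>" u] power2_norm_eq_inner)
  qed
  ultimately show ?thesis by (simp add: power2_norm_eq_inner)
qed

lemma eigen_expansion_add:
  "eigen_expansion \<Omega> u c \<Longrightarrow> eigen_expansion \<Omega> v d \<Longrightarrow> eigen_expansion \<Omega> (u + v) (\<lambda>\<mu>. c \<mu> + d \<mu>)"
  unfolding eigen_expansion_def by (auto intro: has_sum_add subspace_add[OF subspace_eigenspace])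

lemma eigen_expansion_scaleR:
  "eigen_expansion \<Omega> u c \<Longrightarrow> eigen_expansion \<Omega> (r *\<^sub>R u) (\<lambda>\<mu>. r *\<^sub>R c \<mu>)"
  unfolding eigen_expansion_def by (auto intro: has_sum_scaleR subspace_scale[OF subspace_eigenspace])

lemma power_domI:
  assumes "u \<in> L2 \<Omega>" "eigen_expansion \<Omega> u c" "(\<lambda>\<mu>. (norm (\<mu> powr s *\<^sub>R c \<mu>))\<^sup>2) summable_on UNIV"
  shows "u \<in> power_dom \<Omega> s"
  using assms unfolding power_dom_def scale_space_def scale_power_def eigen_expansion_def by blast

lemma power_domD:
  assumes "u \<in> power_dom \<Omega> s"
  shows "u \<in> L2 \<Omega>" "eigen_expansion \<Omega> u (components \<Omega> u)" "components \<Omega> u \<in> scale_space \<Omega> s"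
    "(\<lambda>\<mu>. (norm (\<mu> powr s *\<^sub>R components \<Omega> u \<mu>))\<^sup>2) summable_on UNIV"
proof -
  obtain c where c: "u \<in> L2 \<Omega>" "c \<in> scale_space \<Omega> s" "eigen_expansion \<Omega> u c"
    using assms unfolding power_dom_def by blast
  then show "u \<in> L2 \<Omega>" "eigen_expansion \<Omega> u (components \<Omega> u)" "components \<Omega> u \<in> scale_space \<Omega> s"
    "(\<lambda>\<mu>. (norm (\<mu> powr s *\<^sub>R components \<Omega> u \<mu>))\<^sup>2) summable_on UNIV"
    by (simp_all add: components_eq scale_space_def scale_power_def)
qed

lemma components_add:
  assumes "u \<in> power_dom \<Omega> s" "v \<in> power_dom \<Omega> t"
  shows "components \<Omega> (u + v) = (\<lambda>\<mu>. components \<Omega> u \<mu> + components \<Omega> v \<mu>)"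
  by (rule components_eq[OF eigen_expansion_add[OF power_domD(2)[OF assms(1)] power_domD(2)[OF assms(2)]]])

lemma components_scaleR:
  assumes "u \<in> power_dom \<Omega> s"
  shows "components \<Omega> (r *\<^sub>R u) = (\<lambda>\<mu>. r *\<^sub>R components \<Omega> u \<mu>)"
  by (rule components_eq[OF eigen_expansion_scaleR[OF power_domD(2)[OF assms]]])

definition single_mode :: "real \<Rightarrow> 'n::finite lsq \<Rightarrow> 'n family" where
  "single_mode \<mu> e = (\<lambda>\<nu>. if \<nu> = \<mu> then e else 0)"

lemma has_sum_single_mode: "(single_mode \<mu> e has_sum e) UNIV"
  unfolding single_mode_def by (rule has_sum_finite_neutralI[of "{\<mu>}"]) auto

lemma eigen_expansion_single_mode: "e \<in> eigenspace \<Omega> \<mu> \<Longrightarrow> eigen_expansion \<Omega> e (single_mode \<mu> e)"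
  unfolding eigen_expansion_def using has_sum_single_mode subspace_0[OF subspace_eigenspace]
  by (auto simp: single_mode_def)

lemmas components_eigenspace = components_eq[OF eigen_expansion_single_mode]

lemma single_mode_in_scale_space:
  assumes "e \<in> eigenspace \<Omega> \<mu>" shows "single_mode \<mu> e \<in> scale_space \<Omega> s"
proof -
  have "((\<lambda>\<nu>. (norm (scale_power s (single_mode \<mu> e) \<nu>))\<^sup>2) has_sum (norm (\<mu> powr s *\<^sub>R e))\<^sup>2) UNIV"
    unfolding single_mode_def scale_power_def by (rule has_sum_finite_neutralI[of "{\<mu>}"]) auto
  then show ?thesis unfolding scale_space_def summable_on_def
    using eigen_expansionD(1)[OF eigen_expansion_single_mode[OF assms]] by blast
qed

lemma eigenspace_subset_power_dom: "e \<in> eigenspace \<Omega> \<mu> \<Longrightarrow> e \<in> power_dom \<Omega> s"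
  unfolding power_dom_def using eigen_expansion_single_mode single_mode_in_scale_space eigenspace_subset_L2 by blast

lemma subspace_power_dom: "subspace (power_dom \<Omega> s)"
proof (rule subspaceI)
  show "0 \<in> power_dom \<Omega> s" by (rule eigenspace_subset_power_dom[OF subspace_0[OF subspace_eigenspace, of \<Omega> 0]])
next
  fix u v assume uv: "u \<in> power_dom \<Omega> s" "v \<in> power_dom \<Omega> s"
  note D = power_domD[OF uv(1)] power_domD[OF uv(2)]
  show "u + v \<in> power_dom \<Omega> s"
    using square_summable_add[OF D(4,8)]
    by (intro power_domI[OF subspace_add[OF subspace_L2 D(1,5)] eigen_expansion_add[OF D(2,6)]]) (simp add: scaleR_add_right)
next
  fix u r assume u: "u \<in> power_dom \<Omega> s"
  note D = power_domD[OF u]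
  have "(\<lambda>\<mu>. r\<^sup>2 * (norm (\<mu> powr s *\<^sub>R components \<Omega> u \<mu>))\<^sup>2) summable_on UNIV"
    by (rule summable_on_cmult_right[OF D(4)])
  then show "r *\<^sub>R u \<in> power_dom \<Omega> s"
    by (intro power_domI[OF subspace_scale[OF subspace_L2 D(1)] eigen_expansion_scaleR[OF D(2)]])
       (simp add: power_mult_distrib mult_ac)
qed

lemma has_sum_family_norm:
  assumes "(\<lambda>\<mu>. (norm (c \<mu>))\<^sup>2) summable_on UNIV"
  shows "((\<lambda>\<mu>. (norm (c \<mu>))\<^sup>2) has_sum (family_norm c)\<^sup>2) UNIV"
proof -
  have "0 \<le> (\<Sum>\<^sub>\<infinity>\<mu>. (norm (c \<mu>))\<^sup>2)" by (rule infsum_nonneg) simp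
  then show ?thesis using has_sum_infsum[OF assms] by (simp add: family_norm_def)
qed

lemma has_sum_A_pow:
  assumes "u \<in> power_dom \<Omega> s"
  shows "((\<lambda>\<mu>. (norm (A_pow \<Omega> s u \<mu>))\<^sup>2) has_sum (family_norm (A_pow \<Omega> s u))\<^sup>2) UNIV"
  using power_domD(4)[OF assms] by (intro has_sum_family_norm) (simp add: A_pow_def scale_power_def)

text \<open>Componentwise, the norm of the phase space is that of a square summable family in
  the fourfold product of \<open>L\<^sup>2(\<Omega>)\<close>.\<close>

definition phase_family :: "(real ^ 'n) set \<Rightarrow> real \<Rightarrow> real \<Rightarrow> real \<Rightarrow> 'n state \<Rightarrow> real \<Rightarrow> 'n state" where
  "phase_family \<Omega> \<alpha> \<kappa> \<beta> = (\<lambda>(u, v, w, z) \<mu>. (sqrt \<alpha> *\<^sub>R A_pow \<Omega> 1 u \<mu>, sqrt \<alpha> *\<^sub>R A_pow \<Omega> (1/2) v \<mu>,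
     sqrt (1 + \<kappa> * \<mu> powr \<beta>) *\<^sub>R components \<Omega> w \<mu>, components \<Omega> z \<mu>))"

section \<open>The phase norm as a norm of square summable families\<close>

lemma subspace_phase_space: "subspace (phase_space \<Omega> \<beta>)"
  unfolding phase_space_def by (intro subspace_Times subspace_power_dom)

lemma phase_norm_nonneg: "0 \<le> \<alpha> \<Longrightarrow> 0 \<le> \<kappa> \<Longrightarrow> 0 \<le> phase_norm \<Omega> \<alpha> \<kappa> \<beta> x"
  by (cases x) (auto simp: phase_norm_def)

text \<open>By Parseval \<open>(norm w)\<^sup>2\<close> is a sum over \<mu> as well and merges with
  the term carrying \<kappa>; this is the origin of the weight
  \<open>sqrt (1 + \<kappa> * \<mu> powr \<beta>)\<close>.\<close>

lemma phase_norm_has_sum: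
  assumes "0 \<le> \<alpha>" "0 \<le> \<kappa>" "x \<in> phase_space \<Omega> \<beta>"
  shows "((\<lambda>\<mu>. (norm (phase_family \<Omega> \<alpha> \<kappa> \<beta> x \<mu>))\<^sup>2) has_sum (phase_norm \<Omega> \<alpha> \<kappa> \<beta> x)\<^sup>2) UNIV"
proof -
  obtain u v w z where x: "x = (u, v, w, z)" by (cases x)
  have dom: "u \<in> power_dom \<Omega> 1" "v \<in> power_dom \<Omega> (1/2)" "w \<in> power_dom \<Omega> (\<beta>/2)" "z \<in> power_dom \<Omega> 0"
    using assms(3) by (auto simp: x phase_space_def)
  have "(phase_norm \<Omega> \<alpha> \<kappa> \<beta> x)\<^sup>2 = \<alpha> * (family_norm (A_pow \<Omega> 1 u))\<^sup>2 + \<alpha> * (family_norm (A_pow \<Omega> (1/2) v))\<^sup>2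
       + (norm w)\<^sup>2 + \<kappa> * (family_norm (A_pow \<Omega> (\<beta>/2) w))\<^sup>2 + (norm z)\<^sup>2"
    using assms by (simp add: x phase_norm_def)
  moreover have "(norm (phase_family \<Omega> \<alpha> \<kappa> \<beta> x \<mu>))\<^sup>2 =
      \<alpha> * (norm (A_pow \<Omega> 1 u \<mu>))\<^sup>2 + \<alpha> * (norm (A_pow \<Omega> (1/2) v \<mu>))\<^sup>2 + (norm (components \<Omega> w \<mu>))\<^sup>2
       + \<kappa> * (norm (A_pow \<Omega> (\<beta>/2) w \<mu>))\<^sup>2 + (norm (components \<Omega> z \<mu>))\<^sup>2" for \<mu>
  proof -
    have "(\<mu> powr (\<beta>/2))\<^sup>2 = \<mu> powr \<beta>" by (simp add: power2_eq_square powr_add[symmetric])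
    moreover have "0 \<le> 1 + \<kappa> * \<mu> powr \<beta>" using assms by simp
    ultimately show ?thesis using assms
      by (simp add: x phase_family_def norm_prod_def power_mult_distrib A_pow_def scale_power_def distrib_right mult.assoc)
  qed
  ultimately show ?thesis
    using has_sum_A_pow[OF dom(1)] has_sum_A_pow[OF dom(2)] has_sum_A_pow[OF dom(3)]
      eigen_expansion_parseval[OF power_domD(2)[OF dom(3)]] eigen_expansion_parseval[OF power_domD(2)[OF dom(4)]]
    by (simp only:) (intro has_sum_add has_sum_cmult_right)
qed

lemma phase_family_add:
  assumes "x \<in> phase_space \<Omega> \<beta>" "y \<in> phase_space \<Omega> \<beta>"
  shows "phase_family \<Omega> \<alpha> \<kappa> \<beta> (x + y) \<mu> = phase_family \<Omega> \<alpha> \<kappa> \<beta> x \<mu> + phase_family \<Omega> \<alpha> \<kappa> \<beta> y \<mu>"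
  using assms by (auto simp: phase_family_def phase_space_def A_pow_def scale_power_def components_add scaleR_add_right)

lemma phase_family_scaleR:
  assumes "x \<in> phase_space \<Omega> \<beta>"
  shows "phase_family \<Omega> \<alpha> \<kappa> \<beta> (r *\<^sub>R x) \<mu> = r *\<^sub>R phase_family \<Omega> \<alpha> \<kappa> \<beta> x \<mu>"
  using assms by (auto simp: phase_family_def phase_space_def A_pow_def scale_power_def components_scaleR mult.commute)

lemma phase_family_zero: "phase_family \<Omega> \<alpha> \<kappa> \<beta> 0 \<mu> = 0"
  using phase_family_scaleR[OF subspace_0[OF subspace_phase_space], of \<Omega> \<alpha> \<kappa> \<beta> 0 \<mu>] by simp

lemma phase_family_sum:
  assumes "\<And>i. i \<in> I \<Longrightarrow> f i \<in> phase_space \<Omega> \<beta>"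
  shows "phase_family \<Omega> \<alpha> \<kappa> \<beta> (sum f I) \<mu> = (\<Sum>i\<in>I. phase_family \<Omega> \<alpha> \<kappa> \<beta> (f i) \<mu>)"
  using assms
proof (induction I rule: infinite_finite_induct)
  case (insert i I)
  then have "phase_family \<Omega> \<alpha> \<kappa> \<beta> (f i + sum f I) \<mu> = phase_family \<Omega> \<alpha> \<kappa> \<beta> (f i) \<mu> + phase_family \<Omega> \<alpha> \<kappa> \<beta> (sum f I) \<mu>"
    by (intro phase_family_add subspace_sum[OF subspace_phase_space]) auto
  then show ?case using insert by simp
qed (simp_all add: phase_family_zero)

text \<open>The triangle inequality is Minkowski's inequality for the phase families, and
  homogeneity comes from comparing two sums of the same series.\<close>

lemma seminorm_on_phase_space:
  assumes "0 \<le> \<alpha>" "0 \<le> \<kappa>"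
  shows "seminorm_on (phase_space \<Omega> \<beta>) (phase_norm \<Omega> \<alpha> \<kappa> \<beta>)"
  unfolding seminorm_on_def
proof (intro conjI ballI allI)
  show "subspace (phase_space \<Omega> \<beta>)" by (rule subspace_phase_space)
  show "0 \<le> phase_norm \<Omega> \<alpha> \<kappa> \<beta> x" for x by (rule phase_norm_nonneg[OF assms])
next
  fix x y assume xy: "x \<in> phase_space \<Omega> \<beta>" "y \<in> phase_space \<Omega> \<beta>"
  have "x + y \<in> phase_space \<Omega> \<beta>" by (rule subspace_add[OF subspace_phase_space xy])
  from phase_norm_has_sum[OF assms this]
  show "phase_norm \<Omega> \<alpha> \<kappa> \<beta> (x + y) \<le> phase_norm \<Omega> \<alpha> \<kappa> \<beta> x + phase_norm \<Omega> \<alpha> \<kappa> \<beta> y"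
    unfolding phase_family_add[OF xy]
    by (rule has_sum_square_triangle[OF phase_norm_has_sum[OF assms xy(1)] phase_norm_nonneg[OF assms]
          phase_norm_has_sum[OF assms xy(2)] phase_norm_nonneg[OF assms]])
next
  fix x r assume x: "x \<in> phase_space \<Omega> \<beta>"
  have "((\<lambda>\<mu>. r\<^sup>2 * (norm (phase_family \<Omega> \<alpha> \<kappa> \<beta> x \<mu>))\<^sup>2) has_sum r\<^sup>2 * (phase_norm \<Omega> \<alpha> \<kappa> \<beta> x)\<^sup>2) UNIV"
    by (rule has_sum_cmult_right[OF phase_norm_has_sum[OF assms x]])
  moreover have "((\<lambda>\<mu>. r\<^sup>2 * (norm (phase_family \<Omega> \<alpha> \<kappa> \<beta> x \<mu>))\<^sup>2) has_sum (phase_norm \<Omega> \<alpha> \<kappa> \<beta> (r *\<^sub>R x))\<^sup>2) UNIV"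
    using phase_norm_has_sum[OF assms subspace_scale[OF subspace_phase_space x, of r]]
    by (simp add: phase_family_scaleR[OF x] power_mult_distrib)
  ultimately have "(phase_norm \<Omega> \<alpha> \<kappa> \<beta> (r *\<^sub>R x))\<^sup>2 = (\<bar>r\<bar> * phase_norm \<Omega> \<alpha> \<kappa> \<beta> x)\<^sup>2"
    using has_sum_unique by (fastforce simp: power_mult_distrib)
  then show "phase_norm \<Omega> \<alpha> \<kappa> \<beta> (r *\<^sub>R x) = \<bar>r\<bar> * phase_norm \<Omega> \<alpha> \<kappa> \<beta> x"
    by (rule power2_eq_imp_eq) (auto intro: phase_norm_nonneg[OF assms] mult_nonneg_nonneg)
qed

section \<open>The pairing and the inertia operator\<close>

lemma cinner_scaleR_right: "cinner f (r *\<^sub>R g) = of_real r * cinner f g"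
  using arg_cong[OF cinner_scaleR_left[of r g f], of cnj] by (simp add: cinner_commute[symmetric])

text \<open>A bound by squares, so that square summability of two families gives absolute
  convergence of their pairing by comparison.\<close>

lemma cmod_cinner_le: "cmod (cinner f g) \<le> (norm f)\<^sup>2 + (norm g)\<^sup>2"
proof -
  have "cinner (\<i> *\<^sub>C g) (\<i> *\<^sub>C g) = \<i> * cnj (\<i> * cinner g g)"
    by (simp only: cinner_scaleC_left cinner_commute[of g "\<i> *\<^sub>C g"])
  also have "\<dots> = cinner g g" by (simp add: cinner_commute[symmetric])
  finally have ng: "norm (\<i> *\<^sub>C g) = norm g" by (simp add: norm_lsq_def inner_lsq_def)
  have "cmod (cinner f g) \<le> \<bar>inner f g\<bar> + \<bar>inner f (\<i> *\<^sub>C g)\<bar>"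
    unfolding cinner_eq_inner using norm_triangle_ineq[of "of_real (inner f g)" "\<i> * of_real (inner f (\<i> *\<^sub>C g))"]
    by (simp add: norm_mult)
  also have "\<dots> \<le> norm f * norm g + norm f * norm g"
    using Cauchy_Schwarz_ineq2[of f g] Cauchy_Schwarz_ineq2[of f "\<i> *\<^sub>C g"] by (simp add: ng)
  also have "\<dots> \<le> (norm f)\<^sup>2 + (norm g)\<^sup>2"
    using zero_le_power2[of "norm f - norm g"] unfolding power2_diff by linarith
  finally show ?thesis .
qed

lemma has_sum_pairing:
  assumes "(\<lambda>\<mu>. (norm (c \<mu>))\<^sup>2) summable_on UNIV" "(\<lambda>\<mu>. (norm (d \<mu>))\<^sup>2) summable_on UNIV"
  shows "((\<lambda>\<mu>. cinner (c \<mu>) (d \<mu>)) has_sum pairing c d) UNIV"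
proof -
  have "(\<lambda>\<mu>. norm (cinner (c \<mu>) (d \<mu>))) summable_on UNIV"
    by (rule summable_on_comparison_test[OF summable_on_add[OF assms]]) (auto intro: cmod_cinner_le)
  then show ?thesis unfolding pairing_def by (rule has_sum_infsum[OF abs_summable_summable])
qed

lemma pairing_single_mode: "pairing f (single_mode \<mu> e) = cinner (f \<mu>) e"
proof -
  have zero: "cinner x 0 = 0" for x :: "'a lsq" using cinner_scaleR_right[of x 0 0] by simp
  have "((\<lambda>\<nu>. cinner (f \<nu>) (single_mode \<mu> e \<nu>)) has_sum cinner (f \<mu>) e) UNIV"
    unfolding single_mode_def by (rule has_sum_finite_neutralI[of "{\<mu>}"]) (auto simp: zero)
  then show ?thesis unfolding pairing_def by (rule infsumI)
qed

lemma eigen_expansion_cinner_has_sum: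
  assumes "eigen_expansion \<Omega> u c" "eigen_expansion \<Omega> v d"
  shows "((\<lambda>\<mu>. cinner (c \<mu>) (d \<mu>)) has_sum cinner u v) UNIV"
proof -
  have "cinner (c \<mu>) v = cinner (c \<mu>) (d \<mu>)" for \<mu>
    unfolding cinner_commute[of "c \<mu>"] by (simp only: eigen_expansion_cinner[OF assms(2) eigen_expansionD(1)[OF assms(1)]])
  then show ?thesis
    using has_sum_bounded_linear[OF bounded_linear_cinner_left eigen_expansionD(2)[OF assms(1)], of v] by simp
qed

text \<open>The operator is given weakly, through its pairing with all of
  \<open>power_dom \<Omega> (\<beta>/2)\<close>. Summing both inner products mode by mode shows that
  the diagonal family is a solution; it is the only one, because eigenvectors are admissible test
  elements and each sees a single component.\<close>

lemma inertia_eq: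
  assumes "bounded \<Omega>" "0 \<le> \<kappa>" "0 < \<beta>" and z1: "z1 \<in> power_dom \<Omega> (\<beta>/2)"
  shows "inertia \<Omega> \<kappa> \<beta> z1 = (\<lambda>\<mu>. (1 + \<kappa> * \<mu> powr \<beta>) *\<^sub>R components \<Omega> z1 \<mu>)" (is "_ = ?f")
  unfolding inertia_def
proof (rule the_equality, intro conjI ballI)
  let ?c = "components \<Omega> z1"
  have half: "\<mu> powr \<beta> = \<mu> powr (\<beta>/2) * \<mu> powr (\<beta>/2)" for \<mu> :: real by (simp add: powr_add[symmetric])
  obtain \<mu>\<^sub>0 where \<mu>0: "0 < \<mu>\<^sub>0" "\<And>\<mu> e. e \<in> eigenspace \<Omega> \<mu> \<Longrightarrow> e \<noteq> 0 \<Longrightarrow> \<mu>\<^sub>0 \<le> \<mu>"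
    using eigenvalues_bounded_below[OF assms(1)] by blast
  note c = eigen_expansionD(1)[OF power_domD(2)[OF z1]]
  show "?f \<in> scale_space \<Omega> (-\<beta>/2)"
    unfolding scale_space_def scale_power_def
  proof (intro CollectI conjI allI)
    show "?f \<mu> \<in> eigenspace \<Omega> \<mu>" for \<mu> by (rule subspace_scale[OF subspace_eigenspace c])
    show "(\<lambda>\<mu>. (norm (\<mu> powr (-\<beta>/2) *\<^sub>R ?f \<mu>))\<^sup>2) summable_on UNIV"
    proof (rule summable_on_comparison_test)
      \<comment> \<open>For positive \<mu> the multiplier \<open>\<mu> powr (-\<beta>/2) * (1 +
        \<kappa> * \<mu> powr \<beta>)\<close> equals
        \<open>(\<mu> powr (-\<beta>) + \<kappa>) * \<mu> powr (\<beta>/2)\<close>. Its first factor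
        decreases in \<mu>, so the lower bound of the spectrum controls it.\<close>
      show "(\<lambda>\<mu>. (\<mu>\<^sub>0 powr (-\<beta>) + \<kappa>)\<^sup>2 * (norm (\<mu> powr (\<beta>/2) *\<^sub>R ?c \<mu>))\<^sup>2) summable_on UNIV"
        by (rule summable_on_cmult_right[OF power_domD(4)[OF z1]])
      show "(norm (\<mu> powr (-\<beta>/2) *\<^sub>R ?f \<mu>))\<^sup>2 \<le> (\<mu>\<^sub>0 powr (-\<beta>) + \<kappa>)\<^sup>2 * (norm (\<mu> powr (\<beta>/2) *\<^sub>R ?c \<mu>))\<^sup>2" for \<mu>
      proof (cases "?c \<mu> = 0")
        case False
        then have \<mu>: "\<mu>\<^sub>0 \<le> \<mu>" using \<mu>0(2) c by blast
        then have pos: "0 < \<mu>" using \<mu>0(1) by simp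
        have "\<mu> powr (-\<beta>/2) * (1 + \<kappa> * \<mu> powr \<beta>) = (\<mu> powr (-\<beta>) + \<kappa>) * \<mu> powr (\<beta>/2)"
        proof -
          have eqs: "\<mu> powr (-\<beta>/2) * \<mu> powr \<beta> = \<mu> powr (\<beta>/2)" "\<mu> powr (-\<beta>) * \<mu> powr (\<beta>/2) = \<mu> powr (-\<beta>/2)"
            by (simp_all add: powr_add[symmetric])
          have "\<mu> powr (-\<beta>/2) * (1 + \<kappa> * \<mu> powr \<beta>) = \<mu> powr (-\<beta>/2) + \<kappa> * (\<mu> powr (-\<beta>/2) * \<mu> powr \<beta>)"
            by (simp only: distrib_left mult_1_right mult.left_commute)
          also have "\<dots> = \<mu> powr (-\<beta>) * \<mu> powr (\<beta>/2) + \<kappa> * \<mu> powr (\<beta>/2)" by (simp only: eqs)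
          finally show ?thesis by (simp only: distrib_right)
        qed
        also have "\<dots> \<le> (\<mu>\<^sub>0 powr (-\<beta>) + \<kappa>) * \<mu> powr (\<beta>/2)"
          using \<mu> \<mu>0(1) assms(3) by (intro mult_right_mono add_right_mono powr_mono2') auto
        finally have le: "\<mu> powr (-\<beta>/2) * (1 + \<kappa> * \<mu> powr \<beta>) \<le> (\<mu>\<^sub>0 powr (-\<beta>) + \<kappa>) * \<mu> powr (\<beta>/2)" .
        have nn: "0 \<le> \<mu> powr (-\<beta>/2) * (1 + \<kappa> * \<mu> powr \<beta>)" using assms(2) by simp
        have "norm (\<mu> powr (-\<beta>/2) *\<^sub>R ?f \<mu>) = (\<mu> powr (-\<beta>/2) * (1 + \<kappa> * \<mu> powr \<beta>)) * norm (?c \<mu>)"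
          unfolding scaleR_scaleR norm_scaleR abs_of_nonneg[OF nn] ..
        also have "\<dots> \<le> ((\<mu>\<^sub>0 powr (-\<beta>) + \<kappa>) * \<mu> powr (\<beta>/2)) * norm (?c \<mu>)"
          using le by (rule mult_right_mono) simp
        also have "\<dots> = (\<mu>\<^sub>0 powr (-\<beta>) + \<kappa>) * norm (\<mu> powr (\<beta>/2) *\<^sub>R ?c \<mu>)" by simp
        finally have "(norm (\<mu> powr (-\<beta>/2) *\<^sub>R ?f \<mu>))\<^sup>2 \<le> ((\<mu>\<^sub>0 powr (-\<beta>) + \<kappa>) * norm (\<mu> powr (\<beta>/2) *\<^sub>R ?c \<mu>))\<^sup>2"
          by (rule power_mono) simp
        then show ?thesis by (simp only: power_mult_distrib)
      qed simp
    qed simp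
  qed
  have pairing: "pairing ?f (components \<Omega> z2) =
        cinner z1 z2 + complex_of_real \<kappa> * pairing (A_pow \<Omega> (\<beta>/2) z1) (A_pow \<Omega> (\<beta>/2) z2)"
    if z2: "z2 \<in> power_dom \<Omega> (\<beta>/2)" for z2
  proof -
    have "((\<lambda>\<mu>. cinner (?c \<mu>) (components \<Omega> z2 \<mu>) + complex_of_real \<kappa> * cinner (A_pow \<Omega> (\<beta>/2) z1 \<mu>) (A_pow \<Omega> (\<beta>/2) z2 \<mu>))
       has_sum (cinner z1 z2 + complex_of_real \<kappa> * pairing (A_pow \<Omega> (\<beta>/2) z1) (A_pow \<Omega> (\<beta>/2) z2))) UNIV"
      using has_sum_A_pow[OF z1] has_sum_A_pow[OF z2]
      by (intro has_sum_add has_sum_cmult_right has_sum_pairing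
          eigen_expansion_cinner_has_sum[OF power_domD(2)[OF z1] power_domD(2)[OF z2]])
         (auto simp: summable_on_def)
    moreover have "cinner (?c \<mu>) (components \<Omega> z2 \<mu>) + complex_of_real \<kappa> * cinner (A_pow \<Omega> (\<beta>/2) z1 \<mu>) (A_pow \<Omega> (\<beta>/2) z2 \<mu>)
        = cinner (?f \<mu>) (components \<Omega> z2 \<mu>)" for \<mu>
      by (simp add: A_pow_def scale_power_def cinner_scaleR_left cinner_scaleR_right half distrib_right mult.assoc)
    ultimately show ?thesis unfolding pairing_def by (intro infsumI) simp
  qed
  then show "pairing ?f (components \<Omega> z2) =
        cinner z1 z2 + complex_of_real \<kappa> * pairing (A_pow \<Omega> (\<beta>/2) z1) (A_pow \<Omega> (\<beta>/2) z2)"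
    if "z2 \<in> power_dom \<Omega> (\<beta>/2)" for z2 using that .
  fix g assume g: "g \<in> scale_space \<Omega> (-\<beta>/2) \<and> (\<forall>z2\<in>power_dom \<Omega> (\<beta>/2). pairing g (components \<Omega> z2) =
        cinner z1 z2 + complex_of_real \<kappa> * pairing (A_pow \<Omega> (\<beta>/2) z1) (A_pow \<Omega> (\<beta>/2) z2))"
  show "g = ?f"
  proof
    fix \<mu>
    have e: "g \<mu> - ?f \<mu> \<in> eigenspace \<Omega> \<mu>"
      using g subspace_diff[OF subspace_eigenspace _ subspace_scale[OF subspace_eigenspace c]]
      by (auto simp: scale_space_def)
    have dom: "g \<mu> - ?f \<mu> \<in> power_dom \<Omega> (\<beta>/2)" by (rule eigenspace_subset_power_dom[OF e])
    from g dom have "pairing g (components \<Omega> (g \<mu> - ?f \<mu>)) = pairing ?f (components \<Omega> (g \<mu> - ?f \<mu>))"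
      unfolding pairing[OF dom] by blast
    then have "cinner (g \<mu> - ?f \<mu>) (g \<mu> - ?f \<mu>) = 0"
      unfolding components_eigenspace[OF e] pairing_single_mode by (simp only: cinner_diff_left) simp
    then show "g \<mu> = ?f \<mu>" by (simp add: cinner_self_eq_0_iff)
  qed
qed

text \<open>Only the value at one mode is wanted, but \<open>inv_into\<close> calls for injectivity
  on the whole domain; it holds because the factor \<open>1 + \<kappa> * \<mu> powr \<beta>\<close>
  is positive at every index.\<close>

lemma inv_into_inertia:
  assumes "bounded \<Omega>" "0 \<le> \<kappa>" "0 < \<beta>" and e: "e \<in> eigenspace \<Omega> \<mu>"
  shows "inv_into (power_dom \<Omega> (\<beta>/2)) (inertia \<Omega> \<kappa> \<beta>) (single_mode \<mu> ((1 + \<kappa> * \<mu> powr \<beta>) *\<^sub>R e)) = e"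
proof (rule inv_into_f_eq)
  show "inj_on (inertia \<Omega> \<kappa> \<beta>) (power_dom \<Omega> (\<beta>/2))"
  proof (rule inj_onI)
    fix x y assume xy: "x \<in> power_dom \<Omega> (\<beta>/2)" "y \<in> power_dom \<Omega> (\<beta>/2)" "inertia \<Omega> \<kappa> \<beta> x = inertia \<Omega> \<kappa> \<beta> y"
    have "components \<Omega> x = components \<Omega> y"
    proof
      fix \<mu> :: real
      have "0 < 1 + \<kappa> * \<mu> powr \<beta>" using assms(2) by (intro add_pos_nonneg) auto
      moreover have "(1 + \<kappa> * \<mu> powr \<beta>) *\<^sub>R components \<Omega> x \<mu> = (1 + \<kappa> * \<mu> powr \<beta>) *\<^sub>R components \<Omega> y \<mu>"
        using xy(3) unfolding inertia_eq[OF assms(1-3) xy(1)] inertia_eq[OF assms(1-3) xy(2)] by metis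
      ultimately show "components \<Omega> x \<mu> = components \<Omega> y \<mu>" by simp
    qed
    then show "x = y"
      using has_sum_unique eigen_expansionD(2)[OF power_domD(2)[OF xy(1)]] eigen_expansionD(2)[OF power_domD(2)[OF xy(2)]]
      by metis
  qed
  show dom: "e \<in> power_dom \<Omega> (\<beta>/2)" by (rule eigenspace_subset_power_dom[OF e])
  show "inertia \<Omega> \<kappa> \<beta> e = single_mode \<mu> ((1 + \<kappa> * \<mu> powr \<beta>) *\<^sub>R e)"
    unfolding inertia_eq[OF assms(1-3) dom] components_eigenspace[OF e] by (auto simp: single_mode_def)
qed

section \<open>States carried by one eigenvector\<close>

definition mode_state :: "real \<Rightarrow> real \<Rightarrow> real \<Rightarrow> real \<Rightarrow> 'n::finite lsq \<Rightarrow> mode \<Rightarrow> 'n state" where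
  "mode_state \<alpha> \<kappa> \<beta> \<mu> e = (\<lambda>(U, V, W, Z). ((U / (sqrt \<alpha> * \<mu>)) *\<^sub>R e, (V / (sqrt \<alpha> * sqrt \<mu>)) *\<^sub>R e,
     (W / sqrt (1 + \<kappa> * \<mu> powr \<beta>)) *\<^sub>R e, Z *\<^sub>R e))"

lemma linear_mode_state: "linear (mode_state \<alpha> \<kappa> \<beta> \<mu> e)"
  by (rule linearI) (auto simp: mode_state_def add_divide_distrib scaleR_add_left)

lemma mode_state_in_phase_space:
  assumes "e \<in> eigenspace \<Omega> \<mu>" shows "mode_state \<alpha> \<kappa> \<beta> \<mu> e Y \<in> phase_space \<Omega> \<beta>"
  using subspace_scale[OF subspace_eigenspace assms, THEN eigenspace_subset_power_dom]
  by (cases Y) (simp add: mode_state_def phase_space_def)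

text \<open>The divisors in \<open>mode_state\<close> are the weights of \<open>phase_family\<close>
  and cancel here, so the phase norm becomes the Euclidean norm of the coordinates times
  \<open>norm e\<close>.\<close>

lemma phase_family_mode_state:
  assumes "0 < \<alpha>" "0 \<le> \<kappa>" "0 < \<mu>" and e: "e \<in> eigenspace \<Omega> \<mu>"
  shows "phase_family \<Omega> \<alpha> \<kappa> \<beta> (mode_state \<alpha> \<kappa> \<beta> \<mu> e (U, V, W, Z)) \<nu> =
     (if \<nu> = \<mu> then (U *\<^sub>R e, V *\<^sub>R e, W *\<^sub>R e, Z *\<^sub>R e) else 0)"
proof -
  have c: "components \<Omega> (r *\<^sub>R e) = single_mode \<mu> (r *\<^sub>R e)" for r
    by (rule components_eigenspace[OF subspace_scale[OF subspace_eigenspace e]])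
  have "0 < 1 + \<kappa> * \<mu> powr \<beta>" using assms by (intro add_pos_nonneg) auto
  then show ?thesis using assms
    by (auto simp: phase_family_def mode_state_def A_pow_def scale_power_def c single_mode_def zero_prod_def
        powr_half_sqrt)
qed

lemma norm_scaled_state:
  "(norm (U *\<^sub>R e, V *\<^sub>R e, W *\<^sub>R e, Z *\<^sub>R e))\<^sup>2 = (norm (U, V, W, Z))\<^sup>2 * (norm (e :: 'a::real_normed_vector))\<^sup>2"
  by (simp add: norm_prod_def power_mult_distrib algebra_simps)

text \<open>States with different eigenvalues occupy different indices of the phase family, so there
  are no cross terms and the squared norms add.\<close>

lemma phase_norm_mode_state_sum:
  assumes "0 < \<alpha>" "0 \<le> \<kappa>" "finite F" and e: "\<And>\<mu>. \<mu> \<in> F \<Longrightarrow> 0 < \<mu> \<and> e \<mu> \<in> eigenspace \<Omega> \<mu>"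
  shows "(phase_norm \<Omega> \<alpha> \<kappa> \<beta> (\<Sum>\<mu>\<in>F. mode_state \<alpha> \<kappa> \<beta> \<mu> (e \<mu>) (Y \<mu>)))\<^sup>2 = (\<Sum>\<mu>\<in>F. (norm (Y \<mu>))\<^sup>2 * (norm (e \<mu>))\<^sup>2)"
proof (rule has_sum_unique[OF phase_norm_has_sum])
  have st: "mode_state \<alpha> \<kappa> \<beta> \<mu> (e \<mu>) (Y \<mu>) \<in> phase_space \<Omega> \<beta>" if "\<mu> \<in> F" for \<mu>
    using mode_state_in_phase_space e[OF that] by blast
  then show "(\<Sum>\<mu>\<in>F. mode_state \<alpha> \<kappa> \<beta> \<mu> (e \<mu>) (Y \<mu>)) \<in> phase_space \<Omega> \<beta>"
    by (rule subspace_sum[OF subspace_phase_space])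
  have fam: "phase_family \<Omega> \<alpha> \<kappa> \<beta> (mode_state \<alpha> \<kappa> \<beta> \<mu> (e \<mu>) (Y \<mu>)) \<nu> =
     (if \<mu> = \<nu> then (case Y \<nu> of (U, V, W, Z) \<Rightarrow> (U *\<^sub>R e \<nu>, V *\<^sub>R e \<nu>, W *\<^sub>R e \<nu>, Z *\<^sub>R e \<nu>)) else 0)" if "\<mu> \<in> F" for \<mu> \<nu>
    using phase_family_mode_state[OF assms(1,2), of \<mu> "e \<mu>" \<Omega>] e[OF that] by (cases "Y \<mu>") auto
  have "phase_family \<Omega> \<alpha> \<kappa> \<beta> (\<Sum>\<mu>\<in>F. mode_state \<alpha> \<kappa> \<beta> \<mu> (e \<mu>) (Y \<mu>)) \<nu> =
     (if \<nu> \<in> F then (case Y \<nu> of (U, V, W, Z) \<Rightarrow> (U *\<^sub>R e \<nu>, V *\<^sub>R e \<nu>, W *\<^sub>R e \<nu>, Z *\<^sub>R e \<nu>)) else 0)" for \<nu>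
  proof -
    have "phase_family \<Omega> \<alpha> \<kappa> \<beta> (\<Sum>\<mu>\<in>F. mode_state \<alpha> \<kappa> \<beta> \<mu> (e \<mu>) (Y \<mu>)) \<nu> =
      (\<Sum>\<mu>\<in>F. if \<mu> = \<nu> then (case Y \<nu> of (U, V, W, Z) \<Rightarrow> (U *\<^sub>R e \<nu>, V *\<^sub>R e \<nu>, W *\<^sub>R e \<nu>, Z *\<^sub>R e \<nu>)) else 0)"
      by (subst phase_family_sum[where \<beta> = \<beta>]) (auto intro!: st sum.cong simp: fam)
    then show ?thesis using assms(3) by simp
  qed
  then have eq: "(norm (phase_family \<Omega> \<alpha> \<kappa> \<beta> (\<Sum>\<mu>\<in>F. mode_state \<alpha> \<kappa> \<beta> \<mu> (e \<mu>) (Y \<mu>)) \<nu>))\<^sup>2 =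
     (if \<nu> \<in> F then (norm (Y \<nu>))\<^sup>2 * (norm (e \<nu>))\<^sup>2 else 0)" for \<nu>
    by (cases "Y \<nu>") (simp add: norm_scaled_state)
  show "((\<lambda>\<nu>. (norm (phase_family \<Omega> \<alpha> \<kappa> \<beta> (\<Sum>\<mu>\<in>F. mode_state \<alpha> \<kappa> \<beta> \<mu> (e \<mu>) (Y \<mu>)) \<nu>))\<^sup>2)
     has_sum (\<Sum>\<mu>\<in>F. (norm (Y \<mu>))\<^sup>2 * (norm (e \<mu>))\<^sup>2)) UNIV"
    unfolding eq by (rule has_sum_finite_neutralI[OF assms(3)]) auto
qed (use assms in auto)

text \<open>On multiples of one eigenvector the powers of \<open>A\<close> and the inertia are
  scalars, so the operator is a real 4 by 4 matrix, and the weights of \<open>mode_state\<close>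
  bring it into the form of \<open>mode_gen\<close>. A family with a single component lies in every
  space of the scale, which settles the domain conditions.\<close>

lemma mode_state_generator:
  assumes "bounded \<Omega>" "0 < \<alpha>" "0 \<le> \<kappa>" "0 < \<beta>" "0 < \<mu>" and e: "e \<in> eigenspace \<Omega> \<mu>"
  shows "mode_state \<alpha> \<kappa> \<beta> \<mu> e Y \<in> B_dom \<Omega> \<alpha> \<gamma> \<delta> \<theta> \<beta>"
    and "B_op \<Omega> \<alpha> \<kappa> \<gamma> \<delta> \<theta> \<beta> (mode_state \<alpha> \<kappa> \<beta> \<mu> e Y) =
      mode_state \<alpha> \<kappa> \<beta> \<mu> e (mode_gen (sqrt \<alpha> * \<mu> / sqrt (1 + \<kappa> * \<mu> powr \<beta>)) (\<gamma> * \<mu> / sqrt (1 + \<kappa> * \<mu> powr \<beta>))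
        (sqrt \<alpha> * sqrt \<mu>) (\<delta> * \<mu> powr \<theta>) Y)"
proof -
  obtain U V W Z where Y: "Y = (U, V, W, Z)" by (cases Y)
  define m where "m = 1 + \<kappa> * \<mu> powr \<beta>"
  have m: "0 < m" unfolding m_def using assms by (intro add_pos_nonneg) auto
  have E: "r *\<^sub>R e \<in> eigenspace \<Omega> \<mu>" for r by (rule subspace_scale[OF subspace_eigenspace e])
  have c: "components \<Omega> (r *\<^sub>R e) = single_mode \<mu> (r *\<^sub>R e)" for r by (rule components_eigenspace[OF E])
  have A: "A_pow \<Omega> s (r *\<^sub>R e) = single_mode \<mu> ((\<mu> powr s * r) *\<^sub>R e)" for s r
    by (auto simp: A_pow_def c scale_power_def single_mode_def)
  have lin: "(\<lambda>\<nu>. a *\<^sub>R single_mode \<mu> (r *\<^sub>R e) \<nu> + b *\<^sub>R single_mode \<mu> (s *\<^sub>R e) \<nu>) = single_mode \<mu> ((a * r + b * s) *\<^sub>R e)"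
    "(\<lambda>\<nu>. a *\<^sub>R single_mode \<mu> (r *\<^sub>R e) \<nu> - b *\<^sub>R single_mode \<mu> (s *\<^sub>R e) \<nu>) = single_mode \<mu> ((a * r - b * s) *\<^sub>R e)"
    "(\<lambda>\<nu>. a *\<^sub>R single_mode \<mu> (r *\<^sub>R e) \<nu> + b *\<^sub>R single_mode \<mu> (s *\<^sub>R e) \<nu> - d *\<^sub>R single_mode \<mu> (t *\<^sub>R e) \<nu>)
       = single_mode \<mu> ((a * r + b * s - d * t) *\<^sub>R e)"
    for a b d r s t by (auto simp: single_mode_def scaleR_add_left scaleR_diff_left)
  show "mode_state \<alpha> \<kappa> \<beta> \<mu> e Y \<in> B_dom \<Omega> \<alpha> \<gamma> \<delta> \<theta> \<beta>"
    using mode_state_in_phase_space[OF e, of \<alpha> \<kappa> \<beta> Y] E[THEN eigenspace_subset_power_dom]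
    by (simp add: Y mode_state_def B_dom_def c A lin single_mode_in_scale_space[OF E] del: scaleR_minus_left)
  have inv: "inv_into (power_dom \<Omega> (\<beta>/2)) (inertia \<Omega> \<kappa> \<beta>) (single_mode \<mu> (r *\<^sub>R e)) = (r / m) *\<^sub>R e" for r
    using inv_into_inertia[OF assms(1,3,4) E, of "r / m"] m by (simp add: m_def)
  have oc: "of_components (single_mode \<mu> x) = x" for x :: "'a lsq"
    unfolding of_components_def by (rule infsumI[OF has_sum_single_mode])
  show "B_op \<Omega> \<alpha> \<kappa> \<gamma> \<delta> \<theta> \<beta> (mode_state \<alpha> \<kappa> \<beta> \<mu> e Y) =
      mode_state \<alpha> \<kappa> \<beta> \<mu> e (mode_gen (sqrt \<alpha> * \<mu> / sqrt (1 + \<kappa> * \<mu> powr \<beta>)) (\<gamma> * \<mu> / sqrt (1 + \<kappa> * \<mu> powr \<beta>))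
        (sqrt \<alpha> * sqrt \<mu>) (\<delta> * \<mu> powr \<theta>) Y)"
  proof -
    have sq: "sqrt \<alpha> * sqrt \<alpha> = \<alpha>" "sqrt \<mu> * sqrt \<mu> = \<mu>" "sqrt m * sqrt m = m" using assms m by simp_all
    \<comment> \<open>The division by \<open>m\<close> is the inverse inertia. It is split into two
      factors \<open>sqrt m\<close>: one belongs to the coefficients of \<open>mode_gen\<close>, the
      other to the weight of \<open>W\<close>.\<close>
    have "- ((\<alpha> * (\<mu> powr 2 * (U / (sqrt \<alpha> * \<mu>))) + \<gamma> * (\<mu> powr 1 * Z)) / m)
        = (- (sqrt \<alpha> * \<mu> / sqrt m) * U - \<gamma> * \<mu> / sqrt m * Z) / sqrt m"
    proof -
      have "\<mu> powr 2 = \<mu>\<^sup>2" using assms(5) by (simp add: powr_numeral)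
      then show ?thesis using assms m sq
        by (simp add: field_simps power2_eq_square)
    qed
    moreover have "- \<alpha> * (\<mu> powr 1 * (V / (sqrt \<alpha> * sqrt \<mu>))) + \<gamma> * (\<mu> powr 1 * (W / sqrt m)) - \<delta> * (\<mu> powr \<theta> * Z)
        = - (sqrt \<alpha> * sqrt \<mu>) * V + \<gamma> * \<mu> / sqrt m * W - \<delta> * \<mu> powr \<theta> * Z"
    proof -
      have "\<alpha> * \<mu> / (sqrt \<alpha> * sqrt \<mu>) = sqrt \<alpha> * sqrt \<mu>"
        using sq assms by (simp add: divide_eq_eq mult_ac)
      then have "\<alpha> * (\<mu> * (V / (sqrt \<alpha> * sqrt \<mu>))) = sqrt \<alpha> * sqrt \<mu> * V" by (simp add: divide_inverse mult_ac)
      then show ?thesis using assms(5) by simp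
    qed
    moreover have "W / sqrt m = sqrt \<alpha> * \<mu> / sqrt m * W / (sqrt \<alpha> * \<mu>)" "Z = sqrt \<alpha> * sqrt \<mu> * Z / (sqrt \<alpha> * sqrt \<mu>)"
      using assms by simp_all
    ultimately show ?thesis
      unfolding Y mode_state_def mode_gen_def B_op_def prod.case c A lin inv oc m_def[symmetric]
      by (simp only: scaleR_minus_left[symmetric])
  qed
qed

section \<open>Exponential stability\<close>

text \<open>Everything is compared with \<mu>: \<open>s\<^sup>2\<close> is
  \<open>\<alpha> * \<mu>\<close>, while \<open>\<theta> \<le> 1\<close> makes \<open>d\<close> at
  most a multiple of \<mu> and \<open>\<beta> \<le> 1\<close> makes \<open>q\<^sup>2\<close> at
  least a multiple of it. Additive constants are absorbed because \<mu> stays away from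
  zero.\<close>

lemma mode_coefficient_bounds:
  fixes \<alpha> \<kappa> \<gamma> \<delta> \<theta> \<beta> \<mu>\<^sub>0 :: real
  assumes "0 < \<alpha>" "0 \<le> \<kappa>" "0 < \<gamma>" "0 < \<delta>" "0 \<le> \<theta>" "\<theta> \<le> 1" "0 < \<beta>" "\<beta> \<le> 1" "0 < \<mu>\<^sub>0"
  shows "\<exists>q0>0. \<exists>s0>0. \<exists>d0>0. \<exists>C>0. \<forall>\<mu>\<ge>\<mu>\<^sub>0.
    let q = \<gamma> * \<mu> / sqrt (1 + \<kappa> * \<mu> powr \<beta>); s = sqrt \<alpha> * sqrt \<mu>; d = \<delta> * \<mu> powr \<theta>
    in q0 \<le> q \<and> s0 \<le> s \<and> d0 \<le> d \<and> s\<^sup>2 \<le> C * q\<^sup>2 \<and> d \<le> C * q\<^sup>2 \<and> d \<le> C * s\<^sup>2"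
proof -
  have powr_le: "\<mu> powr t \<le> 1 + \<mu>" if "0 < \<mu>" "0 \<le> t" "t \<le> 1" for \<mu> t :: real
  proof (cases "1 \<le> \<mu>")
    case True
    then show ?thesis using powr_mono[of t 1 \<mu>] that by simp
  next
    case False
    then show ?thesis using powr_mono'[of 0 t \<mu>] that by simp
  qed
  have powr_ge: "min 1 \<mu>\<^sub>0 \<le> \<mu> powr t" if "\<mu>\<^sub>0 \<le> \<mu>" "0 \<le> t" "t \<le> 1" for \<mu> t :: real
  proof (cases "1 \<le> \<mu>")
    case True
    then show ?thesis using powr_mono[of 0 t \<mu>] that by simp
  next
    case False
    then show ?thesis using powr_mono'[of t 1 \<mu>] that assms(9) by simp
  qed
  \<comment> \<open>On the spectrum \<open>1 + \<mu> \<le> b * \<mu>\<close>, and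
    \<open>1 + \<kappa> * \<mu> powr \<beta> \<le> c * \<mu>\<close>.\<close>
  define b where "b = 1 + 1 / \<mu>\<^sub>0"
  define c where "c = (1 + \<kappa> * b) + 1 / \<mu>\<^sub>0"
  have b: "0 < b" and c: "0 < c" unfolding b_def c_def using assms by (auto intro!: add_pos_pos add_pos_nonneg)
  \<comment> \<open>One summand for each of the three comparisons that \<open>C\<close> has to
    satisfy.\<close>
  define C where "C = \<alpha> * c / \<gamma>\<^sup>2 + \<delta> * b * c / \<gamma>\<^sup>2 + \<delta> * b / \<alpha>"
  have C: "0 < C" unfolding C_def using assms b c by (intro add_pos_pos divide_pos_pos mult_pos_pos) auto
  have Cs: "\<alpha> * c / \<gamma>\<^sup>2 \<le> C" "\<delta> * b * c / \<gamma>\<^sup>2 \<le> C" "\<delta> * b / \<alpha> \<le> C"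
    unfolding C_def using assms b c by (auto intro!: add_nonneg_nonneg add_increasing add_increasing2)
  have one: "1 + \<mu> \<le> b * \<mu>" if "\<mu>\<^sub>0 \<le> \<mu>" for \<mu>
    using that assms(9) by (simp add: b_def field_simps)
  have q2: "\<gamma>\<^sup>2 * \<mu> / c \<le> (\<gamma> * \<mu> / sqrt (1 + \<kappa> * \<mu> powr \<beta>))\<^sup>2" if \<mu>: "\<mu>\<^sub>0 \<le> \<mu>" for \<mu>
  proof -
    have pos: "0 < \<mu>" using \<mu> assms(9) by simp
    have m: "0 < 1 + \<kappa> * \<mu> powr \<beta>" using assms(2) by (intro add_pos_nonneg) auto
    have "\<kappa> * \<mu> powr \<beta> \<le> \<kappa> * (b * \<mu>)"
      using powr_le[OF pos, of \<beta>] one[OF \<mu>] assms by (intro mult_left_mono) auto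
    moreover have "1 \<le> \<mu> / \<mu>\<^sub>0" using \<mu> assms(9) by simp
    ultimately have mc: "1 + \<kappa> * \<mu> powr \<beta> \<le> c * \<mu>"
      using pos by (simp add: c_def algebra_simps)
    have "(\<gamma> * \<mu> / sqrt (1 + \<kappa> * \<mu> powr \<beta>))\<^sup>2 = \<gamma>\<^sup>2 * \<mu>\<^sup>2 / (1 + \<kappa> * \<mu> powr \<beta>)"
      using m by (simp add: power_divide power_mult_distrib)
    moreover have "\<gamma>\<^sup>2 * \<mu>\<^sup>2 / (c * \<mu>) \<le> \<gamma>\<^sup>2 * \<mu>\<^sup>2 / (1 + \<kappa> * \<mu> powr \<beta>)"
      using m mc c pos by (intro divide_left_mono mult_pos_pos) auto
    moreover have "\<gamma>\<^sup>2 * \<mu>\<^sup>2 / (c * \<mu>) = \<gamma>\<^sup>2 * \<mu> / c" using pos by (simp add: power2_eq_square)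
    ultimately show ?thesis by simp
  qed
  have s2: "(sqrt \<alpha> * sqrt \<mu>)\<^sup>2 = \<alpha> * \<mu>" if "\<mu>\<^sub>0 \<le> \<mu>" for \<mu>
    using that assms by (simp add: power_mult_distrib)
  have d: "\<delta> * \<mu> powr \<theta> \<le> \<delta> * b * \<mu>" if \<mu>: "\<mu>\<^sub>0 \<le> \<mu>" for \<mu>
    using powr_le[of \<mu> \<theta>] one[OF \<mu>] assms that mult_left_mono[of "\<mu> powr \<theta>" "b * \<mu>" \<delta>] by (simp add: mult.assoc)
  have scale: "x * \<mu> \<le> C * (\<gamma> * \<mu> / sqrt (1 + \<kappa> * \<mu> powr \<beta>))\<^sup>2" if \<mu>: "\<mu>\<^sub>0 \<le> \<mu>" and x: "0 \<le> x" "x * c / \<gamma>\<^sup>2 \<le> C" for x \<mu>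
  proof -
    have "x * \<mu> = x * c / \<gamma>\<^sup>2 * (\<gamma>\<^sup>2 * \<mu> / c)" using c assms(3) by simp
    also have "\<dots> \<le> C * (\<gamma> * \<mu> / sqrt (1 + \<kappa> * \<mu> powr \<beta>))\<^sup>2"
      using q2[OF \<mu>] x C c \<mu> assms by (intro mult_mono) auto
    finally show ?thesis .
  qed
  define q0 where "q0 = sqrt (\<gamma>\<^sup>2 * \<mu>\<^sub>0 / c)"
  define s0 where "s0 = sqrt \<alpha> * sqrt \<mu>\<^sub>0"
  define d0 where "d0 = \<delta> * min 1 \<mu>\<^sub>0"
  have main: "q0 \<le> q \<and> s0 \<le> s \<and> d0 \<le> d \<and> s\<^sup>2 \<le> C * q\<^sup>2 \<and> d \<le> C * q\<^sup>2 \<and> d \<le> C * s\<^sup>2"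
    if \<mu>: "\<mu>\<^sub>0 \<le> \<mu>" and q: "q = \<gamma> * \<mu> / sqrt (1 + \<kappa> * \<mu> powr \<beta>)"
      and s: "s = sqrt \<alpha> * sqrt \<mu>" and d_def: "d = \<delta> * \<mu> powr \<theta>" for \<mu> q s d
    unfolding q s d_def q0_def s0_def d0_def
  proof (intro conjI)
    show "sqrt (\<gamma>\<^sup>2 * \<mu>\<^sub>0 / c) \<le> \<gamma> * \<mu> / sqrt (1 + \<kappa> * \<mu> powr \<beta>)"
    proof (rule real_le_lsqrt)
      have "\<gamma>\<^sup>2 * \<mu>\<^sub>0 / c \<le> \<gamma>\<^sup>2 * \<mu> / c" using \<mu> c by (intro divide_right_mono mult_left_mono) auto
      then show "\<gamma>\<^sup>2 * \<mu>\<^sub>0 / c \<le> (\<gamma> * \<mu> / sqrt (1 + \<kappa> * \<mu> powr \<beta>))\<^sup>2" using q2[OF \<mu>] by simp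
    qed (use \<mu> assms in auto)
    show "sqrt \<alpha> * sqrt \<mu>\<^sub>0 \<le> sqrt \<alpha> * sqrt \<mu>" using \<mu> assms(1) by simp
    show "\<delta> * min 1 \<mu>\<^sub>0 \<le> \<delta> * \<mu> powr \<theta>" using powr_ge[OF \<mu> assms(5,6)] assms(4) by (intro mult_left_mono) auto
    show "(sqrt \<alpha> * sqrt \<mu>)\<^sup>2 \<le> C * (\<gamma> * \<mu> / sqrt (1 + \<kappa> * \<mu> powr \<beta>))\<^sup>2"
      unfolding s2[OF \<mu>] using assms(1) Cs(1) by (intro scale[OF \<mu>]) auto
    show "\<delta> * \<mu> powr \<theta> \<le> C * (\<gamma> * \<mu> / sqrt (1 + \<kappa> * \<mu> powr \<beta>))\<^sup>2"
      by (rule order_trans[OF d[OF \<mu>] scale[OF \<mu> _ Cs(2)]]) (use assms(4) b in simp)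
    have "\<delta> * b * \<mu> = \<delta> * b / \<alpha> * (\<alpha> * \<mu>)" using assms(1) by simp
    also have "\<dots> \<le> C * (\<alpha> * \<mu>)" using Cs(3) \<mu> assms by (intro mult_right_mono) auto
    finally show "\<delta> * \<mu> powr \<theta> \<le> C * (sqrt \<alpha> * sqrt \<mu>)\<^sup>2" unfolding s2[OF \<mu>] by (rule order_trans[OF d[OF \<mu>]])
  qed
  have p: "0 < q0" "0 < s0" "0 < d0" using assms c by (simp_all add: q0_def s0_def d0_def)
  show ?thesis
    unfolding Let_def
    by (rule exI[of _ q0], rule conjI[OF p(1)], rule exI[of _ s0], rule conjI[OF p(2)], rule exI[of _ d0],
        rule conjI[OF p(3)], rule exI[of _ C], rule conjI[OF C], intro allI impI, rule main[OF _ refl refl refl])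
qed

section \<open>Decay of the semigroup, on finite sums of modes and on the phase space\<close>

locale plate_semigroup =
  fixes \<Omega> :: "(real ^ 'n) set" and \<alpha> \<kappa> \<gamma> \<delta> \<theta> \<beta> :: real and S :: "real \<Rightarrow> 'n state \<Rightarrow> 'n state"
  assumes bounded: "bounded \<Omega>"
    and pos: "0 < \<alpha>" "0 < \<kappa>" "0 < \<gamma>" "0 < \<delta>" "0 \<le> \<theta>" "\<theta> \<le> 1" "0 < \<beta>" "\<beta> \<le> 1"
    and semigroup: "c0_contraction_semigroup (phase_space \<Omega> \<beta>) (phase_norm \<Omega> \<alpha> \<kappa> \<beta>) S"
    and generator: "has_generator (phase_space \<Omega> \<beta>) (phase_norm \<Omega> \<alpha> \<kappa> \<beta>) S
           (B_dom \<Omega> \<alpha> \<gamma> \<delta> \<theta> \<beta>) (B_op \<Omega> \<alpha> \<kappa> \<gamma> \<delta> \<theta> \<beta>)"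
begin

abbreviation "X \<equiv> phase_space \<Omega> \<beta>"
abbreviation "N \<equiv> phase_norm \<Omega> \<alpha> \<kappa> \<beta>"
abbreviation "st \<equiv> mode_state \<alpha> \<kappa> \<beta>"
abbreviation "fam \<equiv> phase_family \<Omega> \<alpha> \<kappa> \<beta>"
abbreviation "q \<mu> \<equiv> \<gamma> * \<mu> / sqrt (1 + \<kappa> * \<mu> powr \<beta>)"
text \<open>The quotient \<open>sqrt \<alpha> / \<gamma>\<close> is the ratio \<open>a\<close> that
  does not depend on \<mu>; the first coefficient is written as \<open>a * q \<mu>\<close> to match
  the form of the Lyapunov estimate.\<close>

abbreviation "gen \<mu> \<equiv> mode_gen (sqrt \<alpha> / \<gamma> * q \<mu>) (q \<mu>) (sqrt \<alpha> * sqrt \<mu>) (\<delta> * \<mu> powr \<theta>)"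
abbreviation "euler \<mu> t n \<equiv> ((\<lambda>Y. Y + (t / real n) *\<^sub>R gen \<mu> Y) ^^ n)"

lemmas N_seminorm = seminorm_on_phase_space[OF less_imp_le[OF pos(1)] less_imp_le[OF pos(2)], of \<Omega> \<beta>]
lemmas N_has_sum = phase_norm_has_sum[OF less_imp_le[OF pos(1)] less_imp_le[OF pos(2)], of _ \<Omega> \<beta>]
lemmas N_nonneg = phase_norm_nonneg[OF less_imp_le[OF pos(1)] less_imp_le[OF pos(2)], of \<Omega> \<beta>]
lemmas X_subspace = subspace_phase_space[of \<Omega> \<beta>]

lemma S_maps: "0 \<le> t \<Longrightarrow> x \<in> X \<Longrightarrow> S t x \<in> X \<and> N (S t x) \<le> N x"
  using semigroup unfolding c0_contraction_semigroup_def by blast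

lemma S_add: "0 \<le> t \<Longrightarrow> x \<in> X \<Longrightarrow> y \<in> X \<Longrightarrow> S t (x + y) = S t x + S t y"
  using semigroup unfolding c0_contraction_semigroup_def by blast

lemma S_scaleR: "0 \<le> t \<Longrightarrow> x \<in> X \<Longrightarrow> S t (r *\<^sub>R x) = r *\<^sub>R S t x"
proof -
  assume *: "0 \<le> t" "x \<in> X"
  have "of_real r *\<^sub>C y = r *\<^sub>R y" for y :: "'n state"
    by (cases y) (simp add: scaleC_prod_def scaleR_lsq_def)
  moreover have "S t (of_real r *\<^sub>C x) = of_real r *\<^sub>C S t x"
    using semigroup * unfolding c0_contraction_semigroup_def by blast
  ultimately show ?thesis by simp
qed

lemma S_diff: "0 \<le> t \<Longrightarrow> x \<in> X \<Longrightarrow> y \<in> X \<Longrightarrow> S t (x - y) = S t x - S t y"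
  using S_add[of t x "- y"] S_scaleR[of t y "-1"] subspace_neg[OF X_subspace, of y] by simp

lemma S_sum: "0 \<le> t \<Longrightarrow> (\<And>i. i \<in> I \<Longrightarrow> f i \<in> X) \<Longrightarrow> S t (sum f I) = (\<Sum>i\<in>I. S t (f i))"
proof (induction I rule: infinite_finite_induct)
  case (insert i I)
  then have "S t (f i + sum f I) = S t (f i) + S t (sum f I)"
    by (intro S_add subspace_sum[OF X_subspace]) auto
  then show ?case using insert by simp
qed (use S_scaleR[of t 0 0] subspace_0[OF X_subspace] in simp_all)

text \<open>States on one eigenvector form a space of dimension at most four that the generator maps
  into itself, so Euler's method never leaves it and only the action of the generator on this space
  enters.\<close>

lemma mode_convergence:
  assumes "0 < \<mu>" "e \<in> eigenspace \<Omega> \<mu>" "0 \<le> t"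
  shows "(\<lambda>n. N (S t (st \<mu> e Y) - st \<mu> e (euler \<mu> t n Y))) \<longlonglongrightarrow> 0"
proof (rule euler_tendsto_semigroup[where S = S, OF N_seminorm S_maps S_add S_scaleR _ _ linear_mode_state _ linear_mode_gen _ assms(3)])
  show "\<And>x. x \<in> X \<Longrightarrow> S 0 x = x" "\<And>s t x. 0 \<le> s \<Longrightarrow> 0 \<le> t \<Longrightarrow> x \<in> X \<Longrightarrow> S (s + t) x = S s (S t x)"
    using semigroup unfolding c0_contraction_semigroup_def by blast+
  show "range (st \<mu> e) \<subseteq> X" using mode_state_in_phase_space[OF assms(2)] by blast
  fix b :: mode
  have "st \<mu> e b \<in> B_dom \<Omega> \<alpha> \<gamma> \<delta> \<theta> \<beta>"
    by (rule mode_state_generator[OF bounded pos(1) less_imp_le[OF pos(2)] pos(7) assms(1,2)])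
  moreover have "st \<mu> e (gen \<mu> b) = B_op \<Omega> \<alpha> \<kappa> \<gamma> \<delta> \<theta> \<beta> (st \<mu> e b)"
    using pos(3) by (simp add: mode_state_generator(2)[OF bounded pos(1) less_imp_le[OF pos(2)] pos(7) assms(1,2)])
  ultimately show "((\<lambda>h. N ((1 / h) *\<^sub>R (S h (st \<mu> e b) - st \<mu> e b) - st \<mu> e (gen \<mu> b))) \<longlongrightarrow> 0) (at_right 0)"
    using generator mode_state_in_phase_space[OF assms(2), of \<alpha> \<kappa> \<beta>] unfolding has_generator_def by blast
qed

text \<open>The rate \<omega> is fixed before \<open>F\<close>, \<open>e\<close>, \<open>Y\<close>
  and \<open>t\<close>, whereas \<open>K\<close> is chosen for each mode. Finiteness of
  \<open>F\<close> lets the number of steps tend to infinity in all modes at once, which removes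
  \<open>K\<close>.\<close>

lemma mode_decay:
  obtains \<omega> where "0 < \<omega>" "\<And>F e Y t. \<lbrakk>finite F; \<And>\<mu>. \<mu> \<in> F \<Longrightarrow> e \<mu> \<in> eigenspace \<Omega> \<mu> \<and> e \<mu> \<noteq> 0; 0 \<le> t\<rbrakk> \<Longrightarrow>
    N (S t (\<Sum>\<mu>\<in>F. st \<mu> (e \<mu>) (Y \<mu>))) \<le> 2 * exp (- \<omega> * t) * N (\<Sum>\<mu>\<in>F. st \<mu> (e \<mu>) (Y \<mu>))"
proof -
  obtain \<mu>\<^sub>0 where \<mu>0: "0 < \<mu>\<^sub>0" "\<And>\<mu> e. e \<in> eigenspace \<Omega> \<mu> \<Longrightarrow> e \<noteq> 0 \<Longrightarrow> \<mu>\<^sub>0 \<le> \<mu>"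
    using eigenvalues_bounded_below[OF bounded] by blast
  obtain q0 s0 d0 C where cpos: "0 < q0" "0 < s0" "0 < d0" "0 < C"
    and coeff: "\<forall>\<mu>\<ge>\<mu>\<^sub>0. q0 \<le> q \<mu> \<and> s0 \<le> sqrt \<alpha> * sqrt \<mu> \<and> d0 \<le> \<delta> * \<mu> powr \<theta> \<and>
      (sqrt \<alpha> * sqrt \<mu>)\<^sup>2 \<le> C * (q \<mu>)\<^sup>2 \<and> \<delta> * \<mu> powr \<theta> \<le> C * (q \<mu>)\<^sup>2 \<and>
      \<delta> * \<mu> powr \<theta> \<le> C * (sqrt \<alpha> * sqrt \<mu>)\<^sup>2"
    using mode_coefficient_bounds[OF pos(1) less_imp_le[OF pos(2)] pos(3-8) \<mu>0(1)] unfolding Let_def by (elim exE conjE) (rule that)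
  have a: "0 < sqrt \<alpha> / \<gamma>" using pos by simp
  obtain \<omega> where \<omega>: "0 < \<omega>" and decay: "\<And>q s d. \<lbrakk>q0 \<le> q; s0 \<le> s; d0 \<le> d; s\<^sup>2 \<le> C * q\<^sup>2; d \<le> C * q\<^sup>2; d \<le> C * s\<^sup>2\<rbrakk> \<Longrightarrow>
       \<exists>K. \<forall>h\<ge>0. \<forall>k Y. (norm (((\<lambda>Y. Y + h *\<^sub>R mode_gen (sqrt \<alpha> / \<gamma> * q) q s d Y) ^^ k) Y))\<^sup>2
          \<le> 4 * exp (real k * (- 2 * \<omega> * h + K * h\<^sup>2)) * (norm Y)\<^sup>2"
    by (rule mode_euler_decay[OF a cpos]) (rule that; blast)
  show thesis
  proof (rule that[OF \<omega>])
    fix F and e :: "real \<Rightarrow> 'n lsq" and Y :: "real \<Rightarrow> mode" and t :: real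
    assume F: "finite F" and e: "\<And>\<mu>. \<mu> \<in> F \<Longrightarrow> e \<mu> \<in> eigenspace \<Omega> \<mu> \<and> e \<mu> \<noteq> 0" and t: "0 \<le> t"
    have \<mu>: "\<mu>\<^sub>0 \<le> \<mu>" if "\<mu> \<in> F" for \<mu> using \<mu>0(2) e[OF that] by blast
    have E: "0 < \<mu> \<and> e \<mu> \<in> eigenspace \<Omega> \<mu>" if "\<mu> \<in> F" for \<mu> using e[OF that] \<mu>[OF that] \<mu>0(1) by simp
    have stX: "st \<mu> (e \<mu>) y \<in> X" if "\<mu> \<in> F" for \<mu> y
      by (rule mode_state_in_phase_space) (use E[OF that] in blast)
    have "\<forall>\<mu>\<in>F. \<exists>K. \<forall>h\<ge>0. \<forall>k Y. (norm (((\<lambda>Y. Y + h *\<^sub>R gen \<mu> Y) ^^ k) Y))\<^sup>2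
          \<le> 4 * exp (real k * (- 2 * \<omega> * h + K * h\<^sup>2)) * (norm Y)\<^sup>2"
      by (intro ballI decay) (use coeff \<mu> in auto)
    from bchoice[OF this] obtain K where K: "\<And>\<mu> h k Y. \<mu> \<in> F \<Longrightarrow> 0 \<le> h \<Longrightarrow> (norm (((\<lambda>Y. Y + h *\<^sub>R gen \<mu> Y) ^^ k) Y))\<^sup>2
          \<le> 4 * exp (real k * (- 2 * \<omega> * h + K \<mu> * h\<^sup>2)) * (norm Y)\<^sup>2"
      by blast
    define x where "x = (\<Sum>\<mu>\<in>F. st \<mu> (e \<mu>) (Y \<mu>))"
    define w where "w n = (\<Sum>\<mu>\<in>F. st \<mu> (e \<mu>) (euler \<mu> t n (Y \<mu>)))" for n
    \<comment> \<open>The \<open>n\<close> steps of length \<open>t / n\<close> turn the error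
      \<open>K \<mu> * h\<^sup>2\<close> per step into
      \<open>K \<mu> * t\<^sup>2 * inverse (real n)\<close>, the only part of the bound that still
      depends on \<open>n\<close>.\<close>
    define R where "R n = (\<Sum>\<mu>\<in>F. 4 * exp (- 2 * \<omega> * t + K \<mu> * t\<^sup>2 * inverse (real n)) * (norm (Y \<mu>))\<^sup>2 * (norm (e \<mu>))\<^sup>2)" for n
    define \<epsilon> where "\<epsilon> n = (\<Sum>\<mu>\<in>F. N (S t (st \<mu> (e \<mu>) (Y \<mu>)) - st \<mu> (e \<mu>) (euler \<mu> t n (Y \<mu>))))" for n
    have norm_sum: "(N (\<Sum>\<mu>\<in>F. st \<mu> (e \<mu>) (y \<mu>)))\<^sup>2 = (\<Sum>\<mu>\<in>F. (norm (y \<mu>))\<^sup>2 * (norm (e \<mu>))\<^sup>2)" for y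
      by (rule phase_norm_mode_state_sum[OF pos(1) less_imp_le[OF pos(2)] F E])
    have "N (S t x) \<le> sqrt (R n) + \<epsilon> n" if n: "0 < n" for n
    proof -
      have "S t x = (\<Sum>\<mu>\<in>F. S t (st \<mu> (e \<mu>) (Y \<mu>)))" unfolding x_def by (rule S_sum[OF t stX])
      then have split: "S t x = w n + (\<Sum>\<mu>\<in>F. S t (st \<mu> (e \<mu>) (Y \<mu>)) - st \<mu> (e \<mu>) (euler \<mu> t n (Y \<mu>)))"
        by (simp add: w_def sum_subtractf)
      have d: "S t (st \<mu> (e \<mu>) (Y \<mu>)) - st \<mu> (e \<mu>) (euler \<mu> t n (Y \<mu>)) \<in> X" if "\<mu> \<in> F" for \<mu>
        using S_maps[OF t stX[OF that]] stX[OF that] subspace_diff[OF X_subspace] by blast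
      have "N (S t x) \<le> N (w n) + N (\<Sum>\<mu>\<in>F. S t (st \<mu> (e \<mu>) (Y \<mu>)) - st \<mu> (e \<mu>) (euler \<mu> t n (Y \<mu>)))"
        unfolding split by (rule seminorm_onD(3)[OF N_seminorm _ subspace_sum[OF X_subspace d]])
          (unfold w_def, rule subspace_sum[OF X_subspace stX])
      also have "\<dots> \<le> N (w n) + \<epsilon> n"
        unfolding \<epsilon>_def by (intro add_left_mono seminorm_on_sum[OF N_seminorm d])
      also have "N (w n) \<le> sqrt (R n)"
      proof (rule real_le_rsqrt)
        have "real n * (- 2 * \<omega> * (t / real n) + k * (t / real n)\<^sup>2) = - 2 * \<omega> * t + k * t\<^sup>2 * inverse (real n)" for k
          using n by (simp add: field_simps power2_eq_square)
        then have "(norm (euler \<mu> t n (Y \<mu>)))\<^sup>2 \<le> 4 * exp (- 2 * \<omega> * t + K \<mu> * t\<^sup>2 * inverse (real n)) * (norm (Y \<mu>))\<^sup>2"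
          if "\<mu> \<in> F" for \<mu>
          using K[OF that, of "t / real n" n "Y \<mu>"] t by simp
        then show "(N (w n))\<^sup>2 \<le> R n" unfolding w_def norm_sum R_def by (intro sum_mono mult_right_mono) auto
      qed
      finally show ?thesis by simp
    qed
    moreover have "(\<lambda>n. sqrt (R n) + \<epsilon> n) \<longlonglongrightarrow> sqrt (\<Sum>\<mu>\<in>F. 4 * exp (- 2 * \<omega> * t + K \<mu> * t\<^sup>2 * 0) * (norm (Y \<mu>))\<^sup>2 * (norm (e \<mu>))\<^sup>2) + (\<Sum>\<mu>\<in>F. 0)"
      unfolding R_def \<epsilon>_def
    proof (intro tendsto_add tendsto_sum tendsto_real_sqrt tendsto_mult tendsto_const tendsto_exp lim_inverse_n)
      fix \<mu> assume "\<mu> \<in> F"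
      then show "(\<lambda>n. N (S t (st \<mu> (e \<mu>) (Y \<mu>)) - st \<mu> (e \<mu>) (euler \<mu> t n (Y \<mu>)))) \<longlonglongrightarrow> 0"
        using mode_convergence E t by blast
    qed
    ultimately have "N (S t x) \<le> sqrt (\<Sum>\<mu>\<in>F. 4 * exp (- 2 * \<omega> * t + K \<mu> * t\<^sup>2 * 0) * (norm (Y \<mu>))\<^sup>2 * (norm (e \<mu>))\<^sup>2) + (\<Sum>\<mu>\<in>F. 0)"
      by (intro LIMSEQ_le_const[of "\<lambda>n. sqrt (R n) + \<epsilon> n"]) (auto intro!: exI[of _ 1])
    also have "(\<Sum>\<mu>\<in>F. 4 * exp (- 2 * \<omega> * t + K \<mu> * t\<^sup>2 * 0) * (norm (Y \<mu>))\<^sup>2 * (norm (e \<mu>))\<^sup>2) = (2 * exp (- \<omega> * t) * N x)\<^sup>2"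
    proof -
      have "(exp (- \<omega> * t))\<^sup>2 = exp (- 2 * \<omega> * t)" by (simp add: power2_eq_square exp_add[symmetric])
      then show ?thesis by (simp add: x_def norm_sum power_mult_distrib sum_distrib_left mult.assoc)
    qed
    finally show "N (S t (\<Sum>\<mu>\<in>F. st \<mu> (e \<mu>) (Y \<mu>))) \<le> 2 * exp (- \<omega> * t) * N (\<Sum>\<mu>\<in>F. st \<mu> (e \<mu>) (Y \<mu>))"
      using N_nonneg[of x] unfolding x_def by simp
  qed
qed

text \<open>States all of whose modes are scalar multiples of one family of eigenvectors are approximated by
  finite sums of mode states; every state is the sum of four of these.\<close>

lemma aligned_state_approx:
  assumes x: "x \<in> X" and c: "\<And>\<mu>. c \<mu> \<in> eigenspace \<Omega> \<mu>"
    and fam: "\<And>\<mu>. fam x \<mu> = (case Y \<mu> of (U, V, W, Z) \<Rightarrow> (U *\<^sub>R c \<mu>, V *\<^sub>R c \<mu>, W *\<^sub>R c \<mu>, Z *\<^sub>R c \<mu>))"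
    and \<epsilon>: "0 < \<epsilon>"
  obtains F where "finite F" "\<And>\<mu>. \<mu> \<in> F \<Longrightarrow> c \<mu> \<noteq> 0" "N (x - (\<Sum>\<mu>\<in>F. st \<mu> (c \<mu>) (Y \<mu>))) \<le> \<epsilon>"
proof -
  obtain \<mu>\<^sub>0 where \<mu>0: "0 < \<mu>\<^sub>0" "\<And>\<mu> e. e \<in> eigenspace \<Omega> \<mu> \<Longrightarrow> e \<noteq> 0 \<Longrightarrow> \<mu>\<^sub>0 \<le> \<mu>"
    using eigenvalues_bounded_below[OF bounded] by blast
  have "0 < \<epsilon>\<^sup>2" using \<epsilon> by simp
  from has_sum_finite_approximation[OF N_has_sum[OF x] this] obtain G
    where G: "finite G" "dist (\<Sum>\<mu>\<in>G. (norm (fam x \<mu>))\<^sup>2) ((N x)\<^sup>2) \<le> \<epsilon>\<^sup>2" by blast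
  \<comment> \<open>Indices with vanishing component are dropped because the decay of finite sums is
    stated for nonzero eigenvectors. They contribute nothing to the norm of
    \<open>x\<close>.\<close>
  define F where "F = {\<mu> \<in> G. c \<mu> \<noteq> 0}"
  have F: "finite F" "F \<subseteq> G" using G(1) by (auto simp: F_def)
  have cF: "c \<mu> \<noteq> 0" "0 < \<mu>" if "\<mu> \<in> F" for \<mu>
  proof -
    show "c \<mu> \<noteq> 0" using that by (simp add: F_def)
    then show "0 < \<mu>" using \<mu>0(2)[OF c] \<mu>0(1) by force
  qed
  let ?x = "\<Sum>\<mu>\<in>F. st \<mu> (c \<mu>) (Y \<mu>)"
  have stX: "st \<mu> (c \<mu>) y \<in> X" for \<mu> y by (rule mode_state_in_phase_space[OF c])
  have xF: "?x \<in> X" by (rule subspace_sum[OF X_subspace stX])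
  have zero: "fam x \<nu> = 0" if "c \<nu> = 0" for \<nu>
    using that by (simp add: fam zero_prod_def split: prod.splits)
  have "fam ?x \<nu> = (if \<nu> \<in> F then fam x \<nu> else 0)" for \<nu>
  proof -
    have "fam (st \<mu> (c \<mu>) (Y \<mu>)) \<nu> = (if \<mu> = \<nu> then fam x \<nu> else 0)" if "\<mu> \<in> F" for \<mu>
      using phase_family_mode_state[OF pos(1) less_imp_le[OF pos(2)] cF(2)[OF that] c] unfolding fam
      by (cases "Y \<mu>") auto
    then have "fam ?x \<nu> = (\<Sum>\<mu>\<in>F. if \<mu> = \<nu> then fam x \<nu> else 0)"
      by (subst phase_family_sum[where \<beta> = \<beta>]) (auto intro!: stX sum.cong)
    then show ?thesis using F(1) by simp
  qed
  moreover have "fam (x - ?x) \<nu> = fam x \<nu> - fam ?x \<nu>" for \<nu>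
    using phase_family_add[OF x subspace_neg[OF X_subspace xF], of \<alpha> \<kappa> \<nu>] phase_family_scaleR[OF xF, of \<alpha> \<kappa> "-1" \<nu>] by simp
  \<comment> \<open>Cutting off the modes in \<open>G\<close> removes exactly their share of the
    squared norm and leaves the tail of the series.\<close>
  ultimately have eq: "(norm (fam (x - ?x) \<nu>))\<^sup>2 = (norm (fam x \<nu>))\<^sup>2 + - (if \<nu> \<in> G then (norm (fam x \<nu>))\<^sup>2 else 0)" for \<nu>
    using zero[of \<nu>] F(2) by (auto simp: F_def)
  have "((\<lambda>\<nu>. if \<nu> \<in> G then (norm (fam x \<nu>))\<^sup>2 else 0) has_sum (\<Sum>\<mu>\<in>G. (norm (fam x \<mu>))\<^sup>2)) UNIV"
    by (rule has_sum_finite_neutralI[OF G(1)]) auto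
  then have "((\<lambda>\<nu>. (norm (fam (x - ?x) \<nu>))\<^sup>2) has_sum (N x)\<^sup>2 + - (\<Sum>\<mu>\<in>G. (norm (fam x \<mu>))\<^sup>2)) UNIV"
    unfolding eq using N_has_sum[OF x] by (intro has_sum_add) (simp_all add: has_sum_uminus)
  then have "(N (x - ?x))\<^sup>2 = (N x)\<^sup>2 + - (\<Sum>\<mu>\<in>G. (norm (fam x \<mu>))\<^sup>2)"
    using has_sum_unique[OF N_has_sum[OF subspace_diff[OF X_subspace x xF]]] by blast
  then have "(N (x - ?x))\<^sup>2 \<le> \<epsilon>\<^sup>2" using G(2) by (simp add: dist_real_def abs_le_iff)
  then have "N (x - ?x) \<le> \<epsilon>" by (rule power2_le_imp_le) (use \<epsilon> in simp)
  then show thesis using that[OF F(1) cF(1)] by blast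
qed

lemma decay:
  obtains \<omega> where "0 < \<omega>" "\<And>x t. \<lbrakk>x \<in> X; 0 \<le> t\<rbrakk> \<Longrightarrow> N (S t x) \<le> 8 * exp (- \<omega> * t) * N x"
proof -
  obtain \<omega> where \<omega>: "0 < \<omega>" and fin: "\<And>F e Y t. \<lbrakk>finite F; \<And>\<mu>. \<mu> \<in> F \<Longrightarrow> e \<mu> \<in> eigenspace \<Omega> \<mu> \<and> e \<mu> \<noteq> 0; 0 \<le> t\<rbrakk> \<Longrightarrow>
    N (S t (\<Sum>\<mu>\<in>F. st \<mu> (e \<mu>) (Y \<mu>))) \<le> 2 * exp (- \<omega> * t) * N (\<Sum>\<mu>\<in>F. st \<mu> (e \<mu>) (Y \<mu>))"
    by (rule mode_decay) (rule that; blast)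
  have aligned: "N (S t x) \<le> 2 * exp (- \<omega> * t) * N x"
    if x: "x \<in> X" and t: "0 \<le> t" and c: "\<And>\<mu>. c \<mu> \<in> eigenspace \<Omega> \<mu>"
    and fam: "\<And>\<mu>. fam x \<mu> = (case Y \<mu> of (U, V, W, Z) \<Rightarrow> (U *\<^sub>R c \<mu>, V *\<^sub>R c \<mu>, W *\<^sub>R c \<mu>, Z *\<^sub>R c \<mu>))"
    for x t c Y
  proof (rule field_le_epsilon)
    fix \<epsilon>' :: real assume "0 < \<epsilon>'"
    \<comment> \<open>Two of the three parts pay for replacing \<open>N y\<close> by
      \<open>N x + \<epsilon>\<close> under the factor \<open>2 * exp (- \<omega> * t)\<close>,
      which is at most 2; the third pays for \<open>x - y\<close>, which the contraction does not
      enlarge.\<close>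
    define \<epsilon> where "\<epsilon> = \<epsilon>' / 3"
    have \<epsilon>: "0 < \<epsilon>" using \<open>0 < \<epsilon>'\<close> by (simp add: \<epsilon>_def)
    obtain F where F: "finite F" "\<And>\<mu>. \<mu> \<in> F \<Longrightarrow> c \<mu> \<noteq> 0" "N (x - (\<Sum>\<mu>\<in>F. st \<mu> (c \<mu>) (Y \<mu>))) \<le> \<epsilon>"
      by (rule aligned_state_approx[OF x c fam \<epsilon>]) (rule that; blast)
    define y where "y = (\<Sum>\<mu>\<in>F. st \<mu> (c \<mu>) (Y \<mu>))"
    have y: "y \<in> X" unfolding y_def by (rule subspace_sum[OF X_subspace mode_state_in_phase_space[OF c]])
    have d: "x - y \<in> X" by (rule subspace_diff[OF X_subspace x y])
    have Nd: "N (x - y) \<le> \<epsilon>" using F(3) by (simp add: y_def)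
    have "y = x + (-1) *\<^sub>R (x - y)" by simp
    then have "N y \<le> N x + N ((-1) *\<^sub>R (x - y))"
      using seminorm_onD(3)[OF N_seminorm x subspace_scale[OF X_subspace d, of "-1"]] by simp
    then have Ny: "N y \<le> N x + \<epsilon>" using Nd seminorm_onD(4)[OF N_seminorm d, of "-1"] by simp
    have "S t x = S t y + S t (x - y)" using S_add[OF t y d] by simp
    then have "N (S t x) \<le> N (S t y) + N (S t (x - y))"
      using seminorm_onD(3)[OF N_seminorm] S_maps[OF t y] S_maps[OF t d] by simp
    also have "\<dots> \<le> 2 * exp (- \<omega> * t) * N y + \<epsilon>"
    proof (rule add_mono)
      show "N (S t y) \<le> 2 * exp (- \<omega> * t) * N y"
        unfolding y_def using c F(2) by (intro fin[OF F(1) _ t]) blast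
      show "N (S t (x - y)) \<le> \<epsilon>" using S_maps[OF t d] Nd by linarith
    qed
    also have "\<dots> \<le> 2 * exp (- \<omega> * t) * (N x + \<epsilon>) + \<epsilon>" using Ny by simp
    also have "\<dots> \<le> 2 * exp (- \<omega> * t) * N x + \<epsilon>'"
    proof -
      have "exp (- \<omega> * t) \<le> 1" using \<omega> t by simp
      from mult_right_mono[OF this, of \<epsilon>] have "exp (- \<omega> * t) * \<epsilon> \<le> \<epsilon>" using \<epsilon> by simp
      moreover have "\<epsilon>' = 3 * \<epsilon>" by (simp add: \<epsilon>_def)
      ultimately show ?thesis unfolding distrib_left by linarith
    qed
    finally show "N (S t x) \<le> 2 * exp (- \<omega> * t) * N x + \<epsilon>'" .
  qed
  show thesis
  proof (rule that[OF \<omega>])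
    fix x t assume x: "x \<in> X" and t: "(0::real) \<le> t"
    \<comment> \<open>A state with a single nonzero entry is aligned with the components of that
      entry, its coordinate being the weight from \<open>phase_family\<close>. Each of the four
      parts has norm at most \<open>N x\<close>, so four estimates with constant 2 give 8.\<close>
    obtain u v w z where xe: "x = (u, v, w, z)" by (cases x)
    have dom: "u \<in> power_dom \<Omega> 1" "v \<in> power_dom \<Omega> (1/2)" "w \<in> power_dom \<Omega> (\<beta>/2)" "z \<in> power_dom \<Omega> 0"
      using x by (auto simp: xe phase_space_def)
    note zero = subspace_0[OF subspace_power_dom, of \<Omega>]
    have c0: "components \<Omega> 0 = (\<lambda>_. 0)" using components_scaleR[OF zero, of 0] by simp
    have A0: "A_pow \<Omega> s 0 = (\<lambda>_. 0)" for s by (simp add: A_pow_def scale_power_def c0)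
    note ce = eigen_expansionD(1)[OF power_domD(2)]
    have f0: "family_norm (\<lambda>_. 0 :: 'n lsq) = 0" by (simp add: family_norm_def)
    have mem: "(u, 0, 0, 0) \<in> X" "(0, v, 0, 0) \<in> X" "(0, 0, w, 0) \<in> X" "(0, 0, 0, z) \<in> X"
      using dom zero by (simp_all add: phase_space_def)
    have le: "N (u, 0, 0, 0) \<le> N x" "N (0, v, 0, 0) \<le> N x" "N (0, 0, w, 0) \<le> N x" "N (0, 0, 0, z) \<le> N x"
      using pos by (simp_all add: xe phase_norm_def A0 f0) (rule real_le_rsqrt, simp)
    have "N (S t (u, 0, 0, 0)) \<le> 2 * exp (- \<omega> * t) * N (u, 0, 0, 0)"
      by (rule aligned[OF mem(1) t, of "components \<Omega> u" "\<lambda>\<mu>. (sqrt \<alpha> * \<mu> powr 1, 0, 0, 0)", OF ce[OF dom(1)]])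
         (simp add: phase_family_def A0 c0, simp add: A_pow_def scale_power_def)
    moreover have "N (S t (0, v, 0, 0)) \<le> 2 * exp (- \<omega> * t) * N (0, v, 0, 0)"
      by (rule aligned[OF mem(2) t, of "components \<Omega> v" "\<lambda>\<mu>. (0, sqrt \<alpha> * \<mu> powr (1/2), 0, 0)", OF ce[OF dom(2)]])
         (simp add: phase_family_def A0 c0, simp add: A_pow_def scale_power_def)
    moreover have "N (S t (0, 0, w, 0)) \<le> 2 * exp (- \<omega> * t) * N (0, 0, w, 0)"
      by (rule aligned[OF mem(3) t, of "components \<Omega> w" "\<lambda>\<mu>. (0, 0, sqrt (1 + \<kappa> * \<mu> powr \<beta>), 0)", OF ce[OF dom(3)]])
         (simp add: phase_family_def A0 c0)
    moreover have "N (S t (0, 0, 0, z)) \<le> 2 * exp (- \<omega> * t) * N (0, 0, 0, z)"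
      by (rule aligned[OF mem(4) t, of "components \<Omega> z" "\<lambda>\<mu>. (0, 0, 0, 1)", OF ce[OF dom(4)]])
         (simp add: phase_family_def A0 c0)
    moreover have "N (S t x) \<le> (N (S t (u, 0, 0, 0)) + N (S t (0, v, 0, 0))) + (N (S t (0, 0, w, 0)) + N (S t (0, 0, 0, z)))"
    proof -
      note SX = S_maps[OF t mem(1)] S_maps[OF t mem(2)] S_maps[OF t mem(3)] S_maps[OF t mem(4)]
      note XA = subspace_add[OF X_subspace]
      have "x = ((u, 0, 0, 0) + (0, v, 0, 0)) + ((0, 0, w, 0) + (0, 0, 0, z))" by (simp add: xe)
      then have "S t x = (S t (u, 0, 0, 0) + S t (0, v, 0, 0)) + (S t (0, 0, w, 0) + S t (0, 0, 0, z))"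
        using S_add[OF t XA[OF mem(1,2)] XA[OF mem(3,4)]] S_add[OF t mem(1,2)] S_add[OF t mem(3,4)] by metis
      then show ?thesis
        using seminorm_onD(3)[OF N_seminorm XA[of "S t (u, 0, 0, 0)" "S t (0, v, 0, 0)"] XA[of "S t (0, 0, w, 0)" "S t (0, 0, 0, z)"]]
          seminorm_onD(3)[OF N_seminorm, of "S t (u, 0, 0, 0)" "S t (0, v, 0, 0)"]
          seminorm_onD(3)[OF N_seminorm, of "S t (0, 0, w, 0)" "S t (0, 0, 0, z)"] SX by simp
    qed
    moreover have mono: "2 * exp (- \<omega> * t) * y \<le> 2 * exp (- \<omega> * t) * N x" if "y \<le> N x" for y
      using that by (rule mult_left_mono) simp
    ultimately show "N (S t x) \<le> 8 * exp (- \<omega> * t) * N x"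
      using mono[OF le(1)] mono[OF le(2)] mono[OF le(3)] mono[OF le(4)] by linarith
  qed
qed

lemma semigroup_exponentially_stable: "exponentially_stable X N S"
proof -
  obtain \<omega> where \<omega>: "0 < \<omega>" "\<And>x t. \<lbrakk>x \<in> X; 0 \<le> t\<rbrakk> \<Longrightarrow> N (S t x) \<le> 8 * exp (- \<omega> * t) * N x"
    by (rule decay) (rule that; blast)
  have "operator_norm X N (S t) \<le> 8 * exp (- \<omega> * t)" if t: "0 \<le> t" for t
    unfolding operator_norm_def
  proof (rule cSup_least)
    \<comment> \<open>The zero state shows that the supremum defining the operator norm is taken
      over a non-empty set, so that an upper bound of the set bounds it.\<close>
    have "N (S t 0) \<in> {N (S t x) |x. x \<in> X \<and> N x \<le> 1}"
      using subspace_0[OF X_subspace] seminorm_on_zero[OF N_seminorm] by (intro CollectI exI[of _ 0]) simp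
    then show "{N (S t x) |x. x \<in> X \<and> N x \<le> 1} \<noteq> {}" by blast
    fix y assume "y \<in> {N (S t x) |x. x \<in> X \<and> N x \<le> 1}"
    then obtain x where x: "y = N (S t x)" "x \<in> X" "N x \<le> 1" by blast
    have "8 * exp (- \<omega> * t) * N x \<le> 8 * exp (- \<omega> * t) * 1" using x(3) by (intro mult_left_mono) auto
    then show "y \<le> 8 * exp (- \<omega> * t)" using \<omega>(2)[OF x(2) t] unfolding x(1) by linarith
  qed
  then show ?thesis unfolding exponentially_stable_def using \<omega>(1) by (intro exI[of _ 8] exI[of _ \<omega>]) auto
qed

end

theorem mainTheorem5:
  fixes \<Omega> :: "(real ^ 'n) set"
    and \<alpha> \<kappa> \<gamma> \<delta> \<theta> \<beta> :: real
    and S :: "real \<Rightarrow> 'n state \<Rightarrow> 'n state"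
  assumes "open \<Omega>" and "bounded \<Omega>" and "smooth_boundary \<Omega>"
    and "\<alpha> > 0" and "\<kappa> > 0" and "\<gamma> > 0" and "\<delta> > 0"
    and "0 \<le> \<theta>" and "\<theta> \<le> 1" and "0 < \<beta>" and "\<beta> \<le> 1"
    and "c0_contraction_semigroup (phase_space \<Omega> \<beta>) (phase_norm \<Omega> \<alpha> \<kappa> \<beta>) S"
    and "has_generator (phase_space \<Omega> \<beta>) (phase_norm \<Omega> \<alpha> \<kappa> \<beta>) S
           (B_dom \<Omega> \<alpha> \<gamma> \<delta> \<theta> \<beta>) (B_op \<Omega> \<alpha> \<kappa> \<gamma> \<delta> \<theta> \<beta>)"
  shows "exponentially_stable (phase_space \<Omega> \<beta>) (phase_norm \<Omega> \<alpha> \<kappa> \<beta>) S"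
proof -
  interpret plate_semigroup \<Omega> \<alpha> \<kappa> \<gamma> \<delta> \<theta> \<beta> S
    using assms by unfold_locales auto
  show ?thesis by (rule semigroup_exponentially_stable)
qed

end
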